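(* Let $p\in\mathcal P$ with $d_Qp=0$. Then $p$ is cohomologous (i.e. differs by an element $d_Q b$, $b\in\mathcal P$) to a polynomial in the variables $u_\mu$, $u_{\mu\nu}$ and $R^{(0)}_{\mu\nu;\rho\sigma;\lambda_1\dots\lambda_n}$ ($n\ge0$).
   Context: Minkowski metric $\eta=\mathrm{diag}(1,-1,-1,-1)$. $\mathcal P$ is the graded-commutative algebra of polynomials in the jet variables $y^\alpha_{\nu_1\dots\nu_n}$ ($n\ge0$) of the classical massless fields $y^\alpha\in\{h_{\mu\nu}$ (symmetric, even), $u_\rho$ (odd), $\tilde u_\sigma$ (odd)$\}$, the jet variables being taken modulo the wave equation (so traces in derivative indices vanish). Formal derivatives: $d_\mu y^\alpha_{\nu_1\dots\nu_n}=y^\alpha_{\mu\nu_1\dots\nu_n}$. Ghost number $gh(h)=0$, $gh(u)=1$, $gh(\tilde u)=-1$; canonical dimension $1$ for each field plus $1$ per derivative. $d_Q$ is the graded derivation of $\mathcal P$ with $d_Qh_{\mu\nu}=-\frac i2(d_\mu u_\nu+d_\nu u_\mu-\eta_{\mu\nu}d_\rho u^\rho)$, $d_Qu_\mu=0$, $d_Q\tilde u_\mu=i\,d^\nu h_{\mu\nu}$, $[d_Q,d_\mu]=0$ (so $d_Q^2=0$). Notation: $h=\eta^{\mu\nu}h_{\mu\nu}$, $\hat h_{\mu\nu}=h_{\mu\nu}-\frac12\eta_{\mu\nu}h$, $\Gamma_{\mu;\nu\rho}=d_\rho\hat h_{\mu\nu}+d_\nu\hat h_{\mu\rho}-d_\mu\hat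 h_{\nu\rho}$, $R_{\mu\nu;\rho\sigma}=d_\rho\Gamma_{\mu;\nu\sigma}-d_\sigma\Gamma_{\mu;\nu\rho}$, $u_{\mu\nu}=\frac12(d_\mu u_\nu-d_\nu u_\mu)$, and $R^{(0)}_{\mu\nu;\rho\sigma;\lambda_1\dots\lambda_n}$ is the traceless part (in all indices) of $d_{\lambda_1}\cdots d_{\lambda_n}R_{\mu\nu;\rho\sigma}$. *)

theory Defs
  imports Complex_Main "HOL-Library.Poly_Mapping"
begin

text \<open>Space-time indices are naturals 0..3 (0 = time).  A field component is
  h_{ab} (stored with a \<le> b, symmetric), u_a or ~u_a.  A jet variable is a field
  component together with the derivative multi-index, recorded as the list of
  multiplicities [c0,c1,c2,c3] of the derivative indices 0,1,2,3.  Modulo the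
  wave equation d0 d0 = d1 d1 + d2 d2 + d3 d3 (eta = diag(1,-1,-1,-1)), a basis of
  the jet variables is given by the multi-indices with c0 \<le> 1.\<close>

datatype field = H nat nat | U nat | Ut nat

datatype gen = J field "nat list"

fun field_key :: "field \<Rightarrow> nat list" where
  "field_key (H a b) = [0, a, b]"
| "field_key (U a) = [1, a, 0]"
| "field_key (Ut a) = [2, a, 0]"

fun gen_key :: "gen \<Rightarrow> nat list" where
  "gen_key (J f c) = field_key f @ c"

definition gen_less :: "gen \<Rightarrow> gen \<Rightarrow> bool" where
  "gen_less g h \<longleftrightarrow> (gen_key g, gen_key h) \<in> lexord {(x, y). x < (y::nat)}"

fun field_valid :: "field \<Rightarrow> bool" where
  "field_valid (H a b) \<longleftrightarrow> a \<le> b \<and> b < 4"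
| "field_valid (U a) \<longleftrightarrow> a < 4"
| "field_valid (Ut a) \<longleftrightarrow> a < 4"

fun gen_valid :: "gen \<Rightarrow> bool" where
  "gen_valid (J f c) \<longleftrightarrow> field_valid f \<and> length c = 4 \<and> c ! 0 \<le> 1"

fun gen_odd :: "gen \<Rightarrow> bool" where
  "gen_odd (J (H a b) c) = False"
| "gen_odd (J (U a) c) = True"
| "gen_odd (J (Ut a) c) = True"

text \<open>A monomial is a finitely supported exponent map; odd generators have
  exponent at most 1.  The monomial m stands for the product of its even
  generators (with multiplicity) followed by its odd generators in increasing
  gen_less order.  An element of P is a finitely supported map from monomials to
  complex coefficients.\<close>

type_synonym mon = "gen \<Rightarrow>\<^sub>0 nat"
type_synonym poly = "mon \<Rightarrow>\<^sub>0 complex"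

definition mon_valid :: "mon \<Rightarrow> bool" where
  "mon_valid m \<longleftrightarrow> (\<forall>g\<in>Poly_Mapping.keys m. gen_valid g \<and> (gen_odd g \<longrightarrow> Poly_Mapping.lookup m g = 1))"

definition Pset :: "poly set" where
  "Pset = {p. \<forall>m\<in>Poly_Mapping.keys p. mon_valid m}"

definition odd_keys :: "mon \<Rightarrow> gen set" where
  "odd_keys m = {g\<in>Poly_Mapping.keys m. gen_odd g}"

definition even_keys :: "mon \<Rightarrow> gen set" where
  "even_keys m = {g\<in>Poly_Mapping.keys m. \<not> gen_odd g}"

text \<open>Sign of reordering (odd part of m)(odd part of n) into increasing order.\<close>
definition mon_sign :: "mon \<Rightarrow> mon \<Rightarrow> complex" where
  "mon_sign m n = (-1) ^ card {(g, h). g \<in> odd_keys m \<and> h \<in> odd_keys n \<and> gen_less h g}"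

definition mon_poly :: "mon \<Rightarrow> poly" where
  "mon_poly m = Poly_Mapping.single m 1"

definition const :: "complex \<Rightarrow> poly" where
  "const c = Poly_Mapping.single 0 c"

definition var :: "gen \<Rightarrow> poly" where
  "var g = mon_poly (Poly_Mapping.single g 1)"

text \<open>Graded-commutative product (not the commutative convolution product of
  Poly_Mapping).\<close>
definition pmul :: "poly \<Rightarrow> poly \<Rightarrow> poly" where
  "pmul p q = (\<Sum>m\<in>Poly_Mapping.keys p. \<Sum>n\<in>Poly_Mapping.keys q.
      if odd_keys m \<inter> odd_keys n = {}
      then Poly_Mapping.single (m + n) (mon_sign m n * Poly_Mapping.lookup p m * Poly_Mapping.lookup q n)
      else 0)"

definition smult :: "complex \<Rightarrow> poly \<Rightarrow> poly" where
  "smult c p = pmul (const c) p"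

definition odd_list :: "mon \<Rightarrow> gen list" where
  "odd_list m = (THE xs. set xs = odd_keys m \<and> sorted_wrt gen_less xs)"

definition even_part :: "mon \<Rightarrow> mon" where
  "even_part m = Abs_poly_mapping (\<lambda>g. if gen_odd g then 0 else Poly_Mapping.lookup m g)"

definition mon_of_list :: "gen list \<Rightarrow> mon" where
  "mon_of_list xs = (\<Sum>g\<leftarrow>xs. Poly_Mapping.single g 1)"

text \<open>Graded derivation of parity e (0 = even, 1 = odd) determined by its values
  f on the generators:
  D(E o_1 ... o_r) = D(E) o_1...o_r + sum_i (-1)^(e(i-1)) E o_1..o_(i-1) D(o_i) o_(i+1)..o_r.\<close>
definition derive_mon :: "nat \<Rightarrow> (gen \<Rightarrow> poly) \<Rightarrow> mon \<Rightarrow> poly" where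
  "derive_mon e f m =
     (\<Sum>g\<in>even_keys m. smult (of_nat (Poly_Mapping.lookup m g)) (pmul (f g) (mon_poly (m - Poly_Mapping.single g 1))))
   + (\<Sum>i<length (odd_list m).
        smult ((-1) ^ (e * i))
          (pmul (pmul (mon_poly (even_part m + mon_of_list (take i (odd_list m)))) (f (odd_list m ! i)))
                (mon_poly (mon_of_list (drop (Suc i) (odd_list m))))))"

definition derivP :: "nat \<Rightarrow> (gen \<Rightarrow> poly) \<Rightarrow> poly \<Rightarrow> poly" where
  "derivP e f p = (\<Sum>m\<in>Poly_Mapping.keys p. smult (Poly_Mapping.lookup p m) (derive_mon e f m))"

fun dgen :: "nat \<Rightarrow> gen \<Rightarrow> poly" where
  "dgen \<mu> (J f c) =
     (if \<mu> = 0 \<and> c ! 0 = 1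
      then (\<Sum>i\<in>{1,2,3}. var (J f (c[0 := 0, i := c ! i + 2])))
      else var (J f (c[\<mu> := c ! \<mu> + 1])))"

definition dmu :: "nat \<Rightarrow> poly \<Rightarrow> poly" where
  "dmu \<mu> = derivP 0 (dgen \<mu>)"

definition eta :: "nat \<Rightarrow> nat \<Rightarrow> complex" where
  "eta i j = (if i = j then (if i = 0 then 1 else -1) else 0)"

definition jet :: "field \<Rightarrow> nat list \<Rightarrow> poly" where
  "jet f ns = foldr dmu ns (var (J f [0, 0, 0, 0]))"

definition hjet :: "nat \<Rightarrow> nat \<Rightarrow> nat list \<Rightarrow> poly" where
  "hjet a b ns = jet (H (min a b) (max a b)) ns"

definition applyDs :: "nat list \<Rightarrow> poly \<Rightarrow> poly" where
  "applyDs c p = foldr (\<lambda>i q. (dmu i ^^ (c ! i)) q) [0, 1, 2, 3] p"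

fun dQbase :: "field \<Rightarrow> poly" where
  "dQbase (H a b) = smult (- \<i> / 2)
      (jet (U b) [a] + jet (U a) [b] - smult (eta a b) (\<Sum>\<rho><4. smult (eta \<rho> \<rho>) (jet (U \<rho>) [\<rho>])))"
| "dQbase (U a) = 0"
| "dQbase (Ut a) = smult \<i> (\<Sum>\<nu><4. smult (eta \<nu> \<nu>) (hjet a \<nu> [\<nu>]))"

fun dQgen :: "gen \<Rightarrow> poly" where
  "dQgen (J f c) = applyDs c (dQbase f)"

definition dQ :: "poly \<Rightarrow> poly" where
  "dQ = derivP 1 dQgen"

definition htr :: poly where
  "htr = (\<Sum>\<mu><4. smult (eta \<mu> \<mu>) (hjet \<mu> \<mu> []))"

definition hhat :: "nat \<Rightarrow> nat \<Rightarrow> poly" where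
  "hhat \<mu> \<nu> = hjet \<mu> \<nu> [] - smult (eta \<mu> \<nu> / 2) htr"

definition Gamma :: "nat \<Rightarrow> nat \<Rightarrow> nat \<Rightarrow> poly" where
  "Gamma \<mu> \<nu> \<rho> = dmu \<rho> (hhat \<mu> \<nu>) + dmu \<nu> (hhat \<mu> \<rho>) - dmu \<mu> (hhat \<nu> \<rho>)"

definition Riem :: "nat \<Rightarrow> nat \<Rightarrow> nat \<Rightarrow> nat \<Rightarrow> poly" where
  "Riem \<mu> \<nu> \<rho> \<sigma> = dmu \<rho> (Gamma \<mu> \<nu> \<sigma>) - dmu \<sigma> (Gamma \<mu> \<nu> \<rho>)"

definition uu :: "nat \<Rightarrow> nat \<Rightarrow> poly" where
  "uu \<mu> \<nu> = smult (1/2) (jet (U \<nu>) [\<mu>] - jet (U \<mu>) [\<nu>])"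

text \<open>A rank-k tensor with entries in P is a function on index lists of length k
  with entries < 4.\<close>

definition valid_idx :: "nat \<Rightarrow> nat list \<Rightarrow> bool" where
  "valid_idx k idx \<longleftrightarrow> length idx = k \<and> set idx \<subseteq> {..<4}"

definition traceless :: "nat \<Rightarrow> (nat list \<Rightarrow> poly) \<Rightarrow> bool" where
  "traceless k t \<longleftrightarrow> (\<forall>a b idx. a < b \<and> b < k \<and> valid_idx k idx \<longrightarrow>
      (\<Sum>i<4. smult (eta i i) (t (idx[a := i, b := i]))) = 0)"

definition pure_trace :: "nat \<Rightarrow> (nat list \<Rightarrow> poly) \<Rightarrow> bool" where
  "pure_trace k t \<longleftrightarrow> (\<exists>S :: nat \<Rightarrow> nat \<Rightarrow> nat list \<Rightarrow> poly.
      (\<forall>a b idx i j. S a b (idx[a := i, b := j]) = S a b idx) \<and>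
      (\<forall>idx. valid_idx k idx \<longrightarrow>
         t idx = (\<Sum>a<k. \<Sum>b\<in>{a<..<k}. smult (eta (idx ! a) (idx ! b)) (S a b idx))))"

definition traceless_part :: "nat \<Rightarrow> (nat list \<Rightarrow> poly) \<Rightarrow> nat list \<Rightarrow> poly" where
  "traceless_part k t = (THE t0. (\<forall>idx. \<not> valid_idx k idx \<longrightarrow> t0 idx = 0) \<and>
      traceless k t0 \<and> pure_trace k (\<lambda>idx. t idx - t0 idx))"

definition RD :: "nat list \<Rightarrow> poly" where
  "RD idx = foldr dmu (drop 4 idx) (Riem (idx ! 0) (idx ! 1) (idx ! 2) (idx ! 3))"

definition R0 :: "nat \<Rightarrow> nat list \<Rightarrow> poly" where
  "R0 n = traceless_part (4 + n) (\<lambda>idx. if valid_idx (4 + n) idx then RD idx else 0)"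

definition R0_u_gens :: "poly set" where
  "R0_u_gens = {jet (U \<mu>) [] | \<mu>. \<mu> < 4} \<union> {uu \<mu> \<nu> | \<mu> \<nu>. \<mu> < 4 \<and> \<nu> < 4}
     \<union> {R0 n idx | n idx. valid_idx (4 + n) idx}"

inductive_set subalg :: "poly set \<Rightarrow> poly set" for G where
  const: "const c \<in> subalg G"
| gen: "g \<in> G \<Longrightarrow> g \<in> subalg G"
| add: "p \<in> subalg G \<Longrightarrow> q \<in> subalg G \<Longrightarrow> p + q \<in> subalg G"
| mul: "p \<in> subalg G \<Longrightarrow> q \<in> subalg G \<Longrightarrow> pmul p q \<in> subalg G"

end

theory Submission
  imports Defs
begin

text \<open>The differential preserves the span of the jet variables, on which the algebra is free
  graded-commutative. A linear map \<open>k\<close> on that span with \<open>d k d = d\<close> and \<open>k k = 0\<close> extends to an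
  odd derivation \<open>K\<close>, and \<open>E = d K + K d\<close> is an even derivation commuting with \<open>d\<close>. It is
  diagonalisable, its eigenvalue on a product of eigenvectors being the number of contractible factors;
  closed sums of eigenvectors with positive eigenvalues are exact, and the kernel of \<open>E\<close> is generated by closed
  linear elements. So only linear elements have to be treated.

  Modulo the wave equation a linear element is a family of symbols in the polynomial ring in \<open>\<xi>\<close> modulo
  \<open>\<xi> \<cdot> \<xi>\<close>. The antighost part of a closed element vanishes, and second derivatives of ghosts are exact.
  The symbol \<open>f\<close> of a closed graviton element satisfies \<open>\<xi>\<^sub>a f\<^sup>a\<^sup>b = (\<xi> \<cdot> \<xi>) g\<^sup>b\<close>; subtracting the
  exact element defined by \<open>g\<close> makes it divergence-free before reduction modulo \<open>\<xi> \<cdot> \<xi>\<close>, hence a double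
  curl, that is, a combination of jets of the curvature. Finally all traces of these jets are exact, so they may be
  replaced by their traceless parts.\<close>

subsection \<open>The graded-commutative product\<close>

text \<open>The Koszul homotopy divides by degrees in a free polynomial ring, while jets determine a
  symbol only modulo \<open>xi2\<close>. This is why a closed graviton symbol has to be made
  divergence-free exactly, not just modulo \<open>xi2\<close>, before it can be integrated twice.
  The computation is done in \<open>hhat\<close>: under \<open>dQ\<close> the field \<open>h\<close>
  picks up a metric term, but \<open>hhat\<close> changes by a symmetrised gradient alone, so that
  closedness becomes a divergence condition. No formula for \<open>k\<close> is given; any linear
  section of \<open>d\<close> on its image is corrected until \<open>k k = 0\<close>. Then
  \<open>d k + k d\<close> is idempotent on linear elements, which is what makes the eigenvalues on
  products count factors. The replacement of curvature jets by \<open>R0\<close> meets another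
  obstacle: the traceless part is a definite description over tensors with polynomial entries.
  Existence, uniqueness and the fact that the difference is a combination of traces of the given
  tensor all come from one scalar projector, obtained from a Hermitian inner product on complex
  tensors.\<close>

declare One_nat_def [simp del]

abbreviation (input) lk :: "('a \<Rightarrow>\<^sub>0 'b::zero) \<Rightarrow> 'a \<Rightarrow> 'b" where "lk \<equiv> Poly_Mapping.lookup"
abbreviation (input) sg :: "'a \<Rightarrow> 'b \<Rightarrow> ('a \<Rightarrow>\<^sub>0 'b::zero)" where "sg \<equiv> Poly_Mapping.single"
abbreviation (input) ks :: "('a \<Rightarrow>\<^sub>0 'b::zero) \<Rightarrow> 'a set" where "ks \<equiv> Poly_Mapping.keys"

section \<open>Linear extension of maps on monomials\<close>

definition lext :: "('a \<Rightarrow> 'b::zero \<Rightarrow> 'c::comm_monoid_add) \<Rightarrow> ('a \<Rightarrow>\<^sub>0 'b) \<Rightarrow> 'c" where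
  "lext F p = (\<Sum>k\<in>ks p. F k (lk p k))"

lemma lext_superset:
  assumes "finite A" "ks p \<subseteq> A" "\<And>k. F k 0 = 0"
  shows "lext F p = (\<Sum>k\<in>A. F k (lk p k))"
  unfolding lext_def using assms
  by (intro sum.mono_neutral_left) (auto simp: in_keys_iff)

lemma lext_add:
  assumes "\<And>k. F k 0 = 0" "\<And>k x y. F k (x + y) = F k x + F k y"
  shows "lext F (p + q) = lext F p + lext F q"
proof -
  let ?A = "ks p \<union> ks q"
  have "lext F (p + q) = (\<Sum>k\<in>?A. F k (lk (p + q) k))"
    using keys_add[of p q] assms(1) by (intro lext_superset) auto
  also have "\<dots> = (\<Sum>k\<in>?A. F k (lk p k)) + (\<Sum>k\<in>?A. F k (lk q k))"
    by (simp add: lookup_add assms(2) sum.distrib)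
  also have "\<dots> = lext F p + lext F q"
    using lext_superset[of ?A p F] lext_superset[of ?A q F] assms(1) by simp
  finally show ?thesis .
qed

lemma lext_single [simp]: "F k 0 = 0 \<Longrightarrow> lext F (sg k c) = F k c"
  by (cases "c = 0") (auto simp: lext_def)

lemma lext_0 [simp]: "lext F 0 = 0"
  by (simp add: lext_def)

lemma poly_mapping_sum_single: "p = (\<Sum>k\<in>ks p. sg k (lk p k))"
proof (rule poly_mapping_eqI)
  fix k
  show "lk p k = lk (\<Sum>k\<in>ks p. sg k (lk p k)) k"
    by (simp add: lookup_sum lookup_single when_def in_keys_iff)
qed

text \<open>The \<open>single\<close> case keeps the membership \<open>k \<in> ks p\<close>, so that
  facts about the support of the polynomial, such as validity of its monomials, survive the
  induction.\<close>

lemma poly_mapping_induct_add [case_names zero single add]: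
  assumes "P 0" "\<And>k c. k \<in> ks p \<Longrightarrow> P (sg k c)" "\<And>p q. P p \<Longrightarrow> P q \<Longrightarrow> P (p + q)"
  shows "P (p :: 'a \<Rightarrow>\<^sub>0 'b::comm_monoid_add)"
proof -
  have "P (\<Sum>k\<in>A. sg k (lk p k))" if "finite A" "A \<subseteq> ks p" for A
    using that by (induction A) (auto intro: assms)
  from this[of "ks p"] show ?thesis
    using poly_mapping_sum_single[of p] by simp
qed

lemma additive_sum:
  fixes f :: "'a::ab_group_add \<Rightarrow> 'b::ab_group_add"
  assumes "\<And>x y. f (x + y) = f x + f y"
  shows "f (\<Sum>i\<in>A. g i) = (\<Sum>i\<in>A. f (g i))"
proof -
  have "f 0 = 0" using assms[of 0 0] by simp
  then show ?thesis by (induction A rule: infinite_finite_induct) (auto simp: assms)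
qed

lemma additive_0:
  fixes f :: "'a::ab_group_add \<Rightarrow> 'b::ab_group_add"
  assumes "\<And>x y. f (x + y) = f x + f y"
  shows "f 0 = 0"
  using assms[of 0 0] by simp

lemma additive_minus:
  fixes f :: "'a::ab_group_add \<Rightarrow> 'b::ab_group_add"
  assumes "\<And>x y. f (x + y) = f x + f y"
  shows "f (- x) = - f x"
  using assms[of x "-x"] additive_0[OF assms] by (simp add: eq_neg_iff_add_eq_0 add.commute)

lemma additive_diff:
  fixes f :: "'a::ab_group_add \<Rightarrow> 'b::ab_group_add"
  assumes "\<And>x y. f (x + y) = f x + f y"
  shows "f (x - y) = f x - f y"
  using assms[of x "-y"] additive_minus[OF assms, of y] by simp

lemma odd_keys_0 [simp]: "odd_keys 0 = {}"
  by (simp add: odd_keys_def)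

lemma finite_odd_keys [simp]: "finite (odd_keys m)"
  by (simp add: odd_keys_def)

lemma finite_even_keys [simp]: "finite (even_keys m)"
  by (simp add: even_keys_def)

lemma keys_add_nat: "ks (m + n :: mon) = ks m \<union> ks n"
  by (auto simp: in_keys_iff lookup_add)

lemma odd_keys_add: "odd_keys (m + n) = odd_keys m \<union> odd_keys n"
  by (auto simp: odd_keys_def keys_add_nat)

section \<open>Bilinearity and associativity of the product\<close>

definition term_prod :: "mon \<Rightarrow> mon \<Rightarrow> complex \<Rightarrow> complex \<Rightarrow> poly" where
  "term_prod m n a b = (if odd_keys m \<inter> odd_keys n = {} then sg (m + n) (mon_sign m n * a * b) else 0)"

lemma term_prod_0 [simp]: "term_prod m n 0 b = 0" "term_prod m n a 0 = 0"
  by (auto simp: term_prod_def)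

lemma term_prod_add: "term_prod m n (a + a') b = term_prod m n a b + term_prod m n a' b" "term_prod m n a (b + b') = term_prod m n a b + term_prod m n a b'"
  by (auto simp: term_prod_def single_add[symmetric] algebra_simps)

lemma pmul_lext: "pmul p q = lext (\<lambda>m a. lext (\<lambda>n b. term_prod m n a b) q) p"
  by (simp add: pmul_def lext_def term_prod_def)

lemma pmul_add_left: "pmul (p + p') q = pmul p q + pmul p' q"
  unfolding pmul_lext by (rule lext_add) (auto simp: lext_def term_prod_add sum.distrib)

lemma pmul_add_right: "pmul p (q + q') = pmul p q + pmul p q'"
proof -
  have *: "lext (\<lambda>n b. term_prod m n a b) (q + q') = lext (\<lambda>n b. term_prod m n a b) q + lext (\<lambda>n b. term_prod m n a b) q'" for m a
    by (rule lext_add) (auto simp: term_prod_add)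
  show ?thesis unfolding pmul_lext * by (simp add: lext_def sum.distrib)
qed

lemma pmul_0 [simp]: "pmul 0 q = 0" "pmul p 0 = 0"
  by (simp_all add: pmul_def)

lemma pmul_single: "pmul (sg m a) (sg n b) = term_prod m n a b"
  by (simp add: pmul_lext)

lemmas pmul_sum_left = additive_sum[of "\<lambda>p. pmul p q" for q, OF pmul_add_left]
lemmas pmul_sum_right = additive_sum[of "pmul p" for p, OF pmul_add_right]
lemmas pmul_minus_left = additive_minus[of "\<lambda>p. pmul p q" for q, OF pmul_add_left]
lemmas pmul_minus_right = additive_minus[of "pmul p" for p, OF pmul_add_right]
lemmas pmul_diff_left = additive_diff[of "\<lambda>p. pmul p q" for q, OF pmul_add_left]
lemma mon_sign_0 [simp]: "mon_sign 0 n = 1" "mon_sign m 0 = 1"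
  by (simp_all add: mon_sign_def)

text \<open>The inversions of a disjoint union against \<open>k\<close> are the disjoint union of
  the inversions. This multiplicativity in each argument is what associativity of
  \<open>pmul\<close> rests on.\<close>

lemma mon_sign_add_left:
  assumes "odd_keys m \<inter> odd_keys n = {}"
  shows "mon_sign (m + n) k = mon_sign m k * mon_sign n k"
proof -
  have "{(g, h). g \<in> odd_keys (m + n) \<and> h \<in> odd_keys k \<and> gen_less h g} =
    {(g, h). g \<in> odd_keys m \<and> h \<in> odd_keys k \<and> gen_less h g} \<union>
    {(g, h). g \<in> odd_keys n \<and> h \<in> odd_keys k \<and> gen_less h g}" (is "?A = ?B \<union> ?C")
    by (auto simp: odd_keys_add)
  moreover have "finite ?B" by (rule finite_subset[of _ "odd_keys m \<times> odd_keys k"]) auto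
  moreover have "finite ?C" by (rule finite_subset[of _ "odd_keys n \<times> odd_keys k"]) auto
  moreover have "?B \<inter> ?C = {}" using assms by auto
  ultimately have "card ?A = card ?B + card ?C" by (simp add: card_Un_disjoint)
  then show ?thesis by (simp add: mon_sign_def power_add)
qed

lemma mon_sign_add_right:
  assumes "odd_keys n \<inter> odd_keys k = {}"
  shows "mon_sign m (n + k) = mon_sign m n * mon_sign m k"
proof -
  have "{(g, h). g \<in> odd_keys m \<and> h \<in> odd_keys (n + k) \<and> gen_less h g} =
    {(g, h). g \<in> odd_keys m \<and> h \<in> odd_keys n \<and> gen_less h g} \<union>
    {(g, h). g \<in> odd_keys m \<and> h \<in> odd_keys k \<and> gen_less h g}" (is "?A = ?B \<union> ?C")
    by (auto simp: odd_keys_add)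
  moreover have "finite ?B" by (rule finite_subset[of _ "odd_keys m \<times> odd_keys n"]) auto
  moreover have "finite ?C" by (rule finite_subset[of _ "odd_keys m \<times> odd_keys k"]) auto
  moreover have "?B \<inter> ?C = {}" using assms by auto
  ultimately have "card ?A = card ?B + card ?C" by (simp add: card_Un_disjoint)
  then show ?thesis by (simp add: mon_sign_def power_add)
qed

lemma pmul_assoc: "pmul (pmul p q) r = pmul p (pmul q r)"
proof (induction p rule: poly_mapping_induct_add)
  case (single m a)
  show ?case
  proof (induction q rule: poly_mapping_induct_add)
    case (single n b)
    show ?case
    proof (induction r rule: poly_mapping_induct_add)
      case (single k c)
      show ?case
        by (auto simp: pmul_single term_prod_def odd_keys_add mon_sign_add_left mon_sign_add_right
            Int_Un_distrib Int_Un_distrib2 add.assoc mult_ac)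
    qed (simp_all add: pmul_add_right)
  qed (simp_all add: pmul_add_right pmul_add_left)
qed (simp_all add: pmul_add_left)

lemma smult_single: "smult c (sg m a) = sg m (c * a)"
  by (simp add: smult_def const_def pmul_single term_prod_def)

lemma lookup_smult: "lk (smult c p) m = c * lk p m"
proof (induction p rule: poly_mapping_induct_add)
  case (single k a) show ?case by (simp add: smult_single lookup_single when_def)
next
  case (add p q) then show ?case by (simp add: smult_def pmul_add_right lookup_add algebra_simps)
qed (simp add: smult_def)

interpretation PV: vector_space smult
  by unfold_locales (auto intro!: poly_mapping_eqI simp: lookup_smult lookup_add algebra_simps)

lemma pmul_smult_left: "pmul (smult c p) q = smult c (pmul p q)"
  by (simp add: smult_def pmul_assoc)

lemma pmul_single_0: "pmul (sg m a) (sg 0 c) = sg m (a * c)"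
  by (simp add: pmul_single term_prod_def)

lemma pmul_const_right: "pmul p (const c) = smult c p"
proof (induction p rule: poly_mapping_induct_add)
  case (single k a) show ?case by (simp add: smult_single const_def pmul_single_0 mult.commute)
qed (simp_all add: pmul_add_left PV.scale_right_distrib)

lemma pmul_smult_right: "pmul p (smult c q) = smult c (pmul p q)"
  by (metis smult_def pmul_assoc pmul_const_right)

lemma const_add: "const (a + b) = const a + const b"
  by (simp add: const_def single_add)

lemma smult_const: "smult a (const b) = const (a * b)"
  by (simp add: const_def smult_single)

lemma pmul_const_1: "pmul (const 1) p = p" "pmul p (const 1) = p"
  by (simp_all add: pmul_const_right flip: smult_def)

text \<open>The parity automorphism, which absorbs all the signs of the graded Leibniz rule.\<close>

definition alpha :: "poly \<Rightarrow> poly" where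
  "alpha = Poly_Mapping.mapp (\<lambda>m c. (-1) ^ card (odd_keys m) * c)"

lemma lookup_alpha: "lk (alpha p) m = (-1) ^ card (odd_keys m) * lk p m"
  by (simp add: alpha_def lookup_mapp when_def in_keys_iff)

lemma alpha_add: "alpha (p + q) = alpha p + alpha q"
  by (rule poly_mapping_eqI) (simp add: lookup_alpha lookup_add algebra_simps)

lemmas alpha_0 [simp] = additive_0[of alpha, OF alpha_add]
lemmas alpha_minus = additive_minus[of alpha, OF alpha_add]
lemma alpha_smult: "alpha (smult c p) = smult c (alpha p)"
  by (rule poly_mapping_eqI) (simp add: lookup_alpha lookup_smult)

lemma alpha_alpha [simp]: "alpha (alpha p) = p"
  by (rule poly_mapping_eqI) (simp add: lookup_alpha flip: mult.assoc power_mult_distrib)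

lemma alpha_single: "alpha (sg m c) = sg m ((-1) ^ card (odd_keys m) * c)"
  by (rule poly_mapping_eqI) (simp add: lookup_alpha lookup_single when_def)

lemma alpha_const [simp]: "alpha (const c) = const c"
  by (simp add: const_def alpha_single)

lemma alpha_pmul: "alpha (pmul p q) = pmul (alpha p) (alpha q)"
proof (induction p rule: poly_mapping_induct_add)
  case (single m a)
  show ?case
  proof (induction q rule: poly_mapping_induct_add)
    case (single n b)
    show ?case
      by (auto simp: pmul_single term_prod_def alpha_single odd_keys_add card_Un_disjoint power_add algebra_simps)
  qed (simp_all add: pmul_add_right alpha_add)
qed (simp_all add: pmul_add_left alpha_add)

section \<open>The order of generators and graded commutativity\<close>

lemma gen_key_inj: "gen_key g = gen_key h \<longleftrightarrow> g = h"
proof -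
  \<comment> \<open>Since all field keys have the same length, the appended multi-index can be split
    off unambiguously.\<close>
  have "length (field_key f) = 3" for f by (cases f) auto
  moreover have "field_key f = field_key f' \<longleftrightarrow> f = f'" for f f' by (cases f; cases f') auto
  ultimately show ?thesis by (cases g; cases h) (metis append_eq_append_conv gen_key.simps gen.inject)
qed

lemma gen_less_irrefl: "\<not> gen_less g g"
  unfolding gen_less_def by (rule lexord_irreflexive) auto

lemma gen_less_linear: "gen_less g h \<or> g = h \<or> gen_less h g"
proof -
  have "\<forall>a b. (a, b) \<in> {(x, y). x < (y::nat)} \<or> a = b \<or> (b, a) \<in> {(x, y). x < (y::nat)}" by auto
  from lexord_linear[OF this, of "gen_key g" "gen_key h"] show ?thesis
    by (simp add: gen_less_def gen_key_inj)
qed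

lemma gen_less_trans: "gen_less g h \<Longrightarrow> gen_less h k \<Longrightarrow> gen_less g k"
  unfolding gen_less_def by (rule lexord_trans) (auto intro: transI)

lemma gen_less_asym: "gen_less g h \<Longrightarrow> \<not> gen_less h g"
  using gen_less_trans gen_less_irrefl by blast

text \<open>The order is total and the odd parts are disjoint, so every pair of odd generators is an
  inversion for exactly one of the two arrangements. The two inversion counts add up to the product
  of the cardinalities.\<close>

lemma mon_sign_swap:
  assumes "odd_keys m \<inter> odd_keys n = {}"
  shows "mon_sign m n = (-1) ^ (card (odd_keys m) * card (odd_keys n)) * mon_sign n m"
proof -
  let ?A = "{(g, h). g \<in> odd_keys m \<and> h \<in> odd_keys n \<and> gen_less h g}"
  let ?B = "{(g, h). g \<in> odd_keys n \<and> h \<in> odd_keys m \<and> gen_less h g}"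
  let ?B' = "{(g, h). g \<in> odd_keys m \<and> h \<in> odd_keys n \<and> gen_less g h}"
  have "bij_betw prod.swap ?B ?B'"
    by (auto simp: bij_betw_def inj_on_def image_iff)
  then have "card ?B = card ?B'" by (rule bij_betw_same_card)
  moreover have un: "?A \<union> ?B' = odd_keys m \<times> odd_keys n"
    using assms gen_less_linear by auto
  moreover have "?A \<inter> ?B' = {}" using gen_less_asym by auto
  moreover have "finite ?A" by (rule finite_subset[of _ "odd_keys m \<times> odd_keys n"]) auto
  moreover have "finite ?B'" by (rule finite_subset[of _ "odd_keys m \<times> odd_keys n"]) auto
  ultimately have *: "card (odd_keys m) * card (odd_keys n) = card ?A + card ?B"
    using card_Un_disjoint[of ?A ?B'] by (simp only: un card_cartesian_product)
  have "(-1::complex) ^ (card ?A + card ?B) * (-1) ^ card ?B = (-1) ^ card ?A"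
    by (simp add: power_add mult.assoc flip: power_mult_distrib)
  then show ?thesis by (simp add: mon_sign_def *)
qed

text \<open>\<open>alpha p = p\<close> forces every monomial in the support of \<open>p\<close> to
  have an even number of odd generators, which makes the exponent in the swap sign even.\<close>

lemma pmul_commute_even:
  assumes "alpha p = p"
  shows "pmul p q = pmul q p"
proof -
  have ev: "even (card (odd_keys m))" if "m \<in> ks p" for m
  proof (rule ccontr)
    assume "odd (card (odd_keys m))"
    moreover have "lk (alpha p) m = lk p m" by (simp add: assms)
    ultimately show False using that by (simp add: lookup_alpha in_keys_iff)
  qed
  have term_prod_eq: "term_prod m n a b = term_prod n m b a" if "m \<in> ks p" for m n a b
    using mon_sign_swap[of m n] ev[OF that] by (auto simp: term_prod_def Int_commute add.commute mult.commute mult.left_commute)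
  have *: "pmul (sg m a) q = pmul q (sg m a)" if "m \<in> ks p" for m a
  proof (induction q rule: poly_mapping_induct_add)
    case (single n b) show ?case using term_prod_eq[OF that] by (simp add: pmul_single)
  qed (simp_all add: pmul_add_right pmul_add_left)
  then have "pmul (\<Sum>m\<in>ks p. sg m (lk p m)) q = pmul q (\<Sum>m\<in>ks p. sg m (lk p m))"
    unfolding pmul_sum_left pmul_sum_right by (rule sum.cong[OF refl])
  then show ?thesis by (simp flip: poly_mapping_sum_single)
qed

text \<open>When \<open>p\<close> is odd, the swap sign against a monomial of \<open>q\<close>
  depends only on the parity of that monomial, and this is the sign that \<open>alpha\<close>
  inserts.\<close>

lemma pmul_anticommute_odd:
  assumes "alpha p = - p"
  shows "pmul p q = pmul (alpha q) p"
proof -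
  have ev: "odd (card (odd_keys m))" if "m \<in> ks p" for m
  proof (rule ccontr)
    assume "\<not> odd (card (odd_keys m))"
    moreover have "lk (alpha p) m = lk (- p) m" by (simp add: assms)
    ultimately show False using that by (simp add: lookup_alpha in_keys_iff)
  qed
  have term_prod_eq: "term_prod m n a b = term_prod n m ((-1) ^ card (odd_keys n) * b) a" if "m \<in> ks p" for m n a b
  proof -
    have "(-1::complex) ^ (card (odd_keys m) * card (odd_keys n)) = (-1) ^ card (odd_keys n)"
      using ev[OF that] by (simp add: power_mult)
    then show ?thesis using mon_sign_swap[of m n] by (auto simp: term_prod_def Int_commute add.commute mult.commute mult.left_commute)
  qed
  have *: "pmul (sg m a) q = pmul (alpha q) (sg m a)" if "m \<in> ks p" for m a
  proof (induction q rule: poly_mapping_induct_add)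
    case (single n b) show ?case using term_prod_eq[OF that] by (simp add: pmul_single alpha_single)
  qed (simp_all add: pmul_add_right pmul_add_left alpha_add)
  then have "pmul (\<Sum>m\<in>ks p. sg m (lk p m)) q = pmul (alpha q) (\<Sum>m\<in>ks p. sg m (lk p m))"
    unfolding pmul_sum_left pmul_sum_right by (rule sum.cong[OF refl])
  then show ?thesis by (simp flip: poly_mapping_sum_single)
qed

section \<open>Valid monomials and induction over \<open>Pset\<close>\<close>

lemma mon_valid_add:
  assumes "mon_valid m" "mon_valid n" "odd_keys m \<inter> odd_keys n = {}"
  shows "mon_valid (m + n)"
  using assms unfolding mon_valid_def
  by (auto simp: keys_add_nat lookup_add odd_keys_def in_keys_iff)

lemma Pset_0 [simp]: "0 \<in> Pset" by (simp add: Pset_def)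

lemma Pset_add: "p \<in> Pset \<Longrightarrow> q \<in> Pset \<Longrightarrow> p + q \<in> Pset"
  using keys_add[of p q] by (auto simp: Pset_def)

lemma Pset_sum: "(\<And>i. i \<in> A \<Longrightarrow> f i \<in> Pset) \<Longrightarrow> sum f A \<in> Pset"
  by (induction A rule: infinite_finite_induct) (auto intro: Pset_add)

lemma Pset_single: "mon_valid m \<Longrightarrow> sg m c \<in> Pset"
  by (simp add: Pset_def)

lemma Pset_smult: "p \<in> Pset \<Longrightarrow> smult c p \<in> Pset"
  by (auto simp: Pset_def in_keys_iff lookup_smult)

lemma Pset_minus: "p \<in> Pset \<Longrightarrow> - p \<in> Pset"
  by (auto simp: Pset_def)

lemma Pset_diff: "p \<in> Pset \<Longrightarrow> q \<in> Pset \<Longrightarrow> p - q \<in> Pset"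
  using Pset_add[of p "-q"] Pset_minus[of q] by simp

lemma Pset_const: "const c \<in> Pset"
  by (simp add: const_def Pset_single mon_valid_def)

lemma Pset_alpha: "p \<in> Pset \<Longrightarrow> alpha p \<in> Pset"
  by (auto simp: Pset_def in_keys_iff lookup_alpha)

lemma Pset_pmul: "p \<in> Pset \<Longrightarrow> q \<in> Pset \<Longrightarrow> pmul p q \<in> Pset"
  unfolding pmul_def by (intro Pset_sum) (auto simp: Pset_def intro!: mon_valid_add)

lemma mon_valid_single: "gen_valid g \<Longrightarrow> mon_valid (sg g 1)"
  by (simp add: mon_valid_def)

lemma Pset_var: "gen_valid g \<Longrightarrow> var g \<in> Pset"
  by (simp add: var_def mon_poly_def Pset_single mon_valid_single)

lemma odd_keys_single: "odd_keys (sg g 1) = (if gen_odd g then {g} else {})"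
  by (auto simp: odd_keys_def)

lemma alpha_var: "alpha (var g) = (if gen_odd g then - var g else var g)"
  by (simp add: var_def mon_poly_def alpha_single odd_keys_single single_uminus)

lemma mon_diff_add: "g \<in> ks m \<Longrightarrow> sg g 1 + (m - sg g 1) = (m :: mon)"
  by (rule poly_mapping_eqI) (auto simp: lookup_add lookup_minus lookup_single when_def in_keys_iff)

lemma mon_valid_diff:
  assumes "mon_valid m"
  shows "mon_valid (m - sg g 1)"
  using assms unfolding mon_valid_def
  by (auto simp: in_keys_iff lookup_minus lookup_single when_def)

lemma odd_keys_diff:
  assumes "mon_valid m" 
  shows "odd_keys (m - sg g 1) = odd_keys m - {g}"
proof -
  have "x \<in> odd_keys (m - sg g 1) \<longleftrightarrow> x \<in> odd_keys m - {g}" for x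
    using assms by (auto simp: odd_keys_def in_keys_iff lookup_minus lookup_single when_def mon_valid_def)
  then show ?thesis by blast
qed

lemma var_mult_mon:
  assumes "mon_valid m"
  shows "pmul (var g) (sg m c) = (if gen_odd g \<and> g \<in> ks m then 0 else sg (sg g 1 + m) (mon_sign (sg g 1) m * c))"
  using assms by (auto simp: var_def mon_poly_def pmul_single term_prod_def odd_keys_single odd_keys_def)

lemma mon_sign_sq [simp]: "mon_sign m n * mon_sign m n = 1"
  unfolding mon_sign_def by (simp flip: power_mult_distrib)

lemma mon_sign_cancel [simp]: "mon_sign m n * (mon_sign m n * c) = c"
  by (simp flip: mult.assoc)

text \<open>By induction on the total degree, every valid monomial is reached by left multiplication
  with single generators. Leibniz rules and eigenvector decompositions then need to be checked for
  one generator at a time.\<close>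

lemma Pset_induct [consumes 1, case_names const var add]:
  assumes "p \<in> Pset" "\<And>c. P (const c)"
    "\<And>g p. gen_valid g \<Longrightarrow> p \<in> Pset \<Longrightarrow> P p \<Longrightarrow> P (pmul (var g) p)"
    "\<And>p q. p \<in> Pset \<Longrightarrow> q \<in> Pset \<Longrightarrow> P p \<Longrightarrow> P q \<Longrightarrow> P (p + q)"
  shows "P p"
proof -
  have mon: "P (sg m c)" if "mon_valid m" "n = (\<Sum>g\<in>ks m. lk m g)" for m c n
    using that
  proof (induction n arbitrary: m c)
    case 0
    then have "m = 0" by (auto intro!: poly_mapping_eqI simp: in_keys_iff)
    then show ?case using assms(2)[of c] by (simp add: const_def)
  next
    case (Suc n)
    then have "\<exists>g. g \<in> ks m" by (metis Zero_not_Suc all_not_in_conv sum.empty)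
    then obtain g where g: "g \<in> ks m" by blast
    let ?m = "m - sg g 1"
    have "(\<Sum>x\<in>ks m. lk m x) = (\<Sum>x\<in>ks m. lk ?m x + (if x = g then 1 else 0))"
      using g by (intro sum.cong) (auto simp: lookup_minus lookup_single when_def in_keys_iff)
    also have "\<dots> = (\<Sum>x\<in>ks m. lk ?m x) + 1"
      using g by (simp add: sum.distrib)
    also have "(\<Sum>x\<in>ks m. lk ?m x) = (\<Sum>x\<in>ks ?m. lk ?m x)"
      by (rule sum.mono_neutral_right) (auto simp: in_keys_iff lookup_minus)
    finally have "n = (\<Sum>x\<in>ks ?m. lk ?m x)" using Suc.prems by simp
    then have 1: "P (sg ?m d)" for d
      using Suc.IH mon_valid_diff[OF Suc.prems(1)] by blast
    \<comment> \<open>An odd generator has exponent 1 in a valid monomial, so it no longer occurs in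
      \<open>?m\<close> and the product below does not vanish.\<close>
    have n: "\<not> (gen_odd g \<and> g \<in> ks ?m)"
      using Suc.prems g by (auto simp: mon_valid_def in_keys_iff lookup_minus)
    \<comment> \<open>The sign in the coefficient cancels the one produced by sorting
      \<open>g\<close> into \<open>?m\<close>.\<close>
    have "pmul (var g) (sg ?m (mon_sign (sg g 1) ?m * c)) = sg m c"
      unfolding var_mult_mon[OF mon_valid_diff[OF Suc.prems(1)]] if_not_P[OF n] mon_diff_add[OF g] by simp
    moreover have "gen_valid g" using Suc.prems g by (auto simp: mon_valid_def)
    ultimately show ?case using assms(3)[OF _ _ 1] Pset_single[OF mon_valid_diff[OF Suc.prems(1)]]
      by metis
  qed
  have "(\<Sum>m\<in>A. sg m (lk p m)) \<in> Pset \<and> P (\<Sum>m\<in>A. sg m (lk p m))" if "finite A" "A \<subseteq> ks p" for A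
    using that
  proof (induction A)
    case empty then show ?case using assms(2)[of 0] by (simp add: const_def)
  next
    case (insert m A)
    then have "mon_valid m" using assms(1) by (auto simp: Pset_def)
    then show ?case using insert by (auto intro!: Pset_add Pset_single assms(4) mon)
  qed
  from this[of "ks p"] show ?thesis using poly_mapping_sum_single[of p] by simp
qed

subsection \<open>Odd derivations\<close>

lemma derivP_lext: "derivP e f p = lext (\<lambda>m a. smult a (derive_mon e f m)) p"
  by (simp add: derivP_def lext_def)

lemma derivP_add: "derivP e f (p + q) = derivP e f p + derivP e f q"
  unfolding derivP_lext by (rule lext_add) (auto simp: PV.scale_left_distrib)

lemma derivP_single: "derivP e f (sg m c) = smult c (derive_mon e f m)"
  by (simp add: derivP_lext)

lemma derivP_smult: "derivP e f (smult c p) = smult c (derivP e f p)"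
proof (induction p rule: poly_mapping_induct_add)
  case (single k a) show ?case by (simp add: smult_single derivP_single)
qed (simp_all add: derivP_add PV.scale_right_distrib additive_0[of "derivP e f", OF derivP_add])

lemma odd_list: "set (odd_list m) = odd_keys m" "sorted_wrt gen_less (odd_list m)"
proof -
  interpret gl: linorder "\<lambda>g h. gen_less g h \<or> g = h" gen_less
    using gen_less_asym gen_less_trans gen_less_linear gen_less_irrefl by unfold_locales blast+
  have "\<exists>!xs. set xs = odd_keys m \<and> sorted_wrt gen_less xs"
  proof (rule ex_ex1I)
    show "\<exists>xs. set xs = odd_keys m \<and> sorted_wrt gen_less xs"
      by (rule exI[of _ "gl.sorted_list_of_set (odd_keys m)"]) auto
  qed (metis gl.strict_sorted_equal)
  from theI'[OF this] show "set (odd_list m) = odd_keys m" "sorted_wrt gen_less (odd_list m)"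
    by (auto simp: odd_list_def)
qed

lemma odd_list_less: "i < j \<Longrightarrow> j < length (odd_list m) \<Longrightarrow> gen_less (odd_list m ! i) (odd_list m ! j)"
  using odd_list(2) by (simp add: sorted_wrt_iff_nth_less)

lemma distinct_odd_list: "distinct (odd_list m)"
  unfolding distinct_conv_nth using odd_list_less[of _ _ m] gen_less_irrefl
  by (metis linorder_neqE_nat)

lemma lookup_even_part: "lk (even_part m) g = (if gen_odd g then 0 else lk m g)"
proof -
  have "{g. (if gen_odd g then 0 else lk m g) \<noteq> 0} \<subseteq> ks m"
    by (auto simp: in_keys_iff split: if_splits)
  then have "finite {g. (if gen_odd g then 0 else lk m g) \<noteq> 0}"
    by (rule finite_subset) simp
  then show ?thesis unfolding even_part_def by (simp add: lookup_Abs_poly_mapping)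
qed

lemma odd_keys_even_part: "odd_keys (even_part m) = {}"
  by (auto simp: odd_keys_def in_keys_iff lookup_even_part)

lemma lookup_mon_of_list: "distinct xs \<Longrightarrow> lk (mon_of_list xs) g = (if g \<in> set xs then 1 else 0)"
  by (induction xs) (auto simp: mon_of_list_def lookup_add lookup_single when_def)

lemma odd_keys_mon_of_list:
  assumes "distinct xs"
  shows "odd_keys (mon_of_list xs) = {g \<in> set xs. gen_odd g}"
  by (auto simp: odd_keys_def in_keys_iff lookup_mon_of_list[OF assms] split: if_splits)

text \<open>The condition on generator values under which \<open>derivP 1 f\<close> is an odd
  derivation of \<open>Pset\<close>; parity is tested by \<open>alpha\<close>.\<close>

definition reverses_parity :: "(gen \<Rightarrow> poly) \<Rightarrow> bool" where
  "reverses_parity f \<longleftrightarrow>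
     (\<forall>g. gen_valid g \<longrightarrow> f g \<in> Pset \<and> alpha (f g) = (if gen_odd g then f g else - f g))"

text \<open>The contribution of \<open>g\<close> as a left derivative: the sign is the cost of
  pulling \<open>g\<close> to the front of \<open>m\<close>, and it is trivial for even
  \<open>g\<close>, where the exponent gives the usual factor.\<close>

definition mon_deriv :: "(gen \<Rightarrow> poly) \<Rightarrow> mon \<Rightarrow> gen \<Rightarrow> poly" where
  "mon_deriv f m g = smult (of_nat (lk m g) * mon_sign (sg g 1) (m - sg g 1))
     (pmul (f g) (mon_poly (m - sg g 1)))"

text \<open>Moving \<open>f (o_i)\<close> to the front costs no sign because it is even for odd \<open>o_i\<close>.\<close>

lemma derive_mon_left:
  assumes f: "reverses_parity f" and m: "mon_valid m"
  shows "derive_mon 1 f m = (\<Sum>g\<in>ks m. mon_deriv f m g)"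
proof -
  let ?xs = "odd_list m"
  have odd1: "lk m g = 1" if "g \<in> odd_keys m" for g
    using m that by (auto simp: mon_valid_def odd_keys_def)
  have odd_term: "smult ((-1) ^ (1 * i)) (pmul (pmul (mon_poly (even_part m + mon_of_list (take i ?xs))) (f (?xs ! i)))
                (mon_poly (mon_of_list (drop (Suc i) ?xs)))) = mon_deriv f m (?xs ! i)"
    if i: "i < length ?xs" for i
  proof -
    let ?g = "?xs ! i" and ?a = "even_part m + mon_of_list (take i ?xs)" and ?b = "mon_of_list (drop (Suc i) ?xs)"
    have g: "?g \<in> odd_keys m" using i odd_list(1) nth_mem by blast
    then have gv: "gen_valid ?g" "gen_odd ?g" using m by (auto simp: mon_valid_def odd_keys_def)
    then have ev: "alpha (f ?g) = f ?g" using f by (auto simp: reverses_parity_def)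
    have allodd: "gen_odd x" if "x \<in> set ?xs" for x using that odd_list(1)[of m] by (auto simp: odd_keys_def)
    have dt: "distinct (take i ?xs)" "distinct (drop (Suc i) ?xs)" using distinct_odd_list by auto
    have ab: "?a + ?b = m - sg ?g 1"
    proof (rule poly_mapping_eqI)
      fix x
      have split: "?xs = take i ?xs @ ?g # drop (Suc i) ?xs" using i by (rule id_take_nth_drop)
      have "distinct (take i ?xs @ ?g # drop (Suc i) ?xs)" using distinct_odd_list split by metis
      moreover have "x \<in> odd_keys m \<longleftrightarrow> x \<in> set (take i ?xs) \<or> x = ?g \<or> x \<in> set (drop (Suc i) ?xs)"
        using split odd_list(1)[of m] by (metis Un_iff set_append set_ConsD list.set_intros(1,2))
      ultimately show "lk (?a + ?b) x = lk (m - sg ?g 1) x"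
        using odd1[of x] gv
        by (auto simp: lookup_add lookup_minus lookup_even_part lookup_mon_of_list[OF dt(1)]
            lookup_mon_of_list[OF dt(2)] lookup_single when_def odd_keys_def in_keys_iff)
    qed
    have oa: "odd_keys ?a = set (take i ?xs)"
      using allodd set_take_subset[of i ?xs]
      by (auto simp: odd_keys_add odd_keys_even_part odd_keys_mon_of_list[OF dt(1)])
    have ob: "odd_keys ?b = set (drop (Suc i) ?xs)"
      using allodd set_drop_subset[of "Suc i" ?xs] by (auto simp: odd_keys_mon_of_list[OF dt(2)])
    have less: "gen_less x y" if xy: "x \<in> set (take i ?xs)" "y \<in> set (drop (Suc i) ?xs)" for x y
    proof -
      obtain j where "j < i" "x = ?xs ! j" using xy(1) i by (auto simp: in_set_conv_nth)
      moreover obtain k where "k < length (drop (Suc i) ?xs)" "y = drop (Suc i) ?xs ! k"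
        using xy(2) by (metis in_set_conv_nth)
      then have "Suc i + k < length ?xs" "y = ?xs ! (Suc i + k)" by auto
      ultimately show ?thesis using odd_list_less[of j "Suc i + k" m] by simp
    qed
    have "{(g, h). g \<in> odd_keys ?a \<and> h \<in> odd_keys ?b \<and> gen_less h g} = {}"
      using less gen_less_asym unfolding oa ob by auto
    then have sab: "mon_sign ?a ?b = 1" by (simp only: mon_sign_def card.empty power_0)
    have "odd_keys ?a \<inter> odd_keys ?b = {}" using less gen_less_irrefl unfolding oa ob by auto
    then have prod: "pmul (mon_poly ?a) (mon_poly ?b) = mon_poly (m - sg ?g 1)"
      by (simp add: mon_poly_def pmul_single term_prod_def sab ab)
    \<comment> \<open>The odd generators that \<open>?g\<close> passes on its way to the front are
      the \<open>i\<close> entries before it in the list; this reproduces the sign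
      \<open>(-1) ^ i\<close> of \<open>derive_mon\<close>.\<close>
    have "{(g, h). g \<in> odd_keys (sg ?g 1) \<and> h \<in> odd_keys (m - sg ?g 1) \<and> gen_less h g} = Pair ?g ` set (take i ?xs)"
    proof -
      have "h \<in> odd_keys (m - sg ?g 1) \<and> gen_less h ?g \<longleftrightarrow> h \<in> set (take i ?xs)" for h
      proof
        assume h: "h \<in> odd_keys (m - sg ?g 1) \<and> gen_less h ?g"
        then obtain j where j: "j < length ?xs" "h = ?xs ! j"
          using odd_keys_diff[OF m] odd_list(1)[of m] by (metis DiffD1 in_set_conv_nth)
        have "\<not> i \<le> j" using h j odd_list_less[of i j m] gen_less_asym gen_less_irrefl
          by (metis le_neq_implies_less)
        then show "h \<in> set (take i ?xs)" using j by (auto simp: in_set_conv_nth)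
      next
        assume "h \<in> set (take i ?xs)"
        then obtain j where j: "j < i" "h = ?xs ! j" using i by (auto simp: in_set_conv_nth)
        then have "gen_less h ?g" using odd_list_less i by blast
        moreover have "h \<in> odd_keys m" using j i odd_list(1)[of m] by (metis nth_mem order.strict_trans)
        ultimately show "h \<in> odd_keys (m - sg ?g 1) \<and> gen_less h ?g"
          using odd_keys_diff[OF m] gen_less_irrefl by auto
      qed
      then show ?thesis using gv by (auto simp: odd_keys_single)
    qed
    moreover have "card (Pair ?g ` set (take i ?xs)) = i"
      using dt(1) i by (simp add: card_image inj_on_def distinct_card)
    ultimately have sg: "mon_sign (sg ?g 1) (m - sg ?g 1) = (-1) ^ i"
      by (simp add: mon_sign_def)
    have "pmul (pmul (mon_poly ?a) (f ?g)) (mon_poly ?b) = pmul (f ?g) (mon_poly (m - sg ?g 1))"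
      by (metis pmul_commute_even[OF ev] pmul_assoc prod)
    then show ?thesis by (simp add: mon_deriv_def sg odd1[OF g])
  qed
  have even_term: "smult (of_nat (lk m g)) (pmul (f g) (mon_poly (m - sg g 1))) = mon_deriv f m g"
    if "g \<in> even_keys m" for g
    using that by (simp add: mon_deriv_def mon_sign_def odd_keys_single even_keys_def)
  have "(\<Sum>i<length ?xs. mon_deriv f m (?xs ! i)) = (\<Sum>g\<in>odd_keys m. mon_deriv f m g)"
    using sum.reindex_bij_betw[OF bij_betw_nth[OF distinct_odd_list refl refl], of "mon_deriv f m" m] odd_list(1)[of m]
    by simp
  moreover have "ks m = even_keys m \<union> odd_keys m" "even_keys m \<inter> odd_keys m = {}"
    by (auto simp: even_keys_def odd_keys_def)
  ultimately show ?thesis unfolding derive_mon_def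
    by (simp add: odd_term[simplified] even_term sum.union_disjoint)
qed

lemma Pset_mon_poly: "mon_valid m \<Longrightarrow> mon_poly m \<in> Pset"
  by (simp add: mon_poly_def Pset_single)

lemma Pset_derive_mon:
  assumes "reverses_parity f" "mon_valid m"
  shows "derive_mon 1 f m \<in> Pset"
  unfolding derive_mon_left[OF assms] mon_deriv_def using assms
  by (auto intro!: Pset_sum Pset_smult Pset_pmul Pset_mon_poly mon_valid_diff
      simp: reverses_parity_def mon_valid_def[of m])

lemma Pset_derivP: "reverses_parity f \<Longrightarrow> p \<in> Pset \<Longrightarrow> derivP 1 f p \<in> Pset"
  unfolding derivP_def by (intro Pset_sum Pset_smult Pset_derive_mon) (auto simp: Pset_def)

lemma derivP_const [simp]: "derivP e f (const c) = 0"
proof -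
  have "odd_list 0 = []" using odd_list(1)[of 0] by simp
  then show ?thesis by (simp add: const_def derivP_single derive_mon_def even_keys_def)
qed

lemma derivP_1_var: "reverses_parity f \<Longrightarrow> gen_valid g \<Longrightarrow> derivP 1 f (var g) = f g"
  by (simp add: var_def mon_poly_def derivP_single derive_mon_left mon_valid_single mon_deriv_def
      flip: const_def) (simp add: pmul_const_1)

text \<open>A single generator involves no reordering, so this holds for arbitrary \<open>f\<close>.
  It serves \<open>dmu\<close>, and also lets \<open>derivP 0\<close> extend any map on generators
  linearly.\<close>

lemma derive_mon_0_single: "derive_mon 0 f (sg g 1) = f g"
proof -
  have ol: "odd_list (sg g 1) = (if gen_odd g then [g] else [])"
  proof (cases "gen_odd g")
    case True
    then have "set (odd_list (sg g 1)) = {g}" using odd_list(1)[of "sg g 1"] by (simp add: odd_keys_single)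
    then have "length (odd_list (sg g 1)) = 1" using distinct_card[OF distinct_odd_list[of "sg g 1"]] by simp
    then show ?thesis using True \<open>set (odd_list (sg g 1)) = {g}\<close> by (auto simp: length_Suc_conv One_nat_def)
  next
    case False then show ?thesis using odd_list(1)[of "sg g 1"] by (simp add: odd_keys_single)
  qed
  have ek: "even_keys (sg g 1) = (if gen_odd g then {} else {g})" by (auto simp: even_keys_def)
  have "gen_odd g \<Longrightarrow> even_part (sg g 1) = 0"
    by (rule poly_mapping_eqI) (auto simp: lookup_even_part lookup_single when_def)
  then show ?thesis
    by (simp add: derive_mon_def ol ek mon_of_list_def mon_poly_def lessThan_Suc One_nat_def[symmetric]
        flip: const_def) (auto simp: pmul_const_1 lessThan_Suc One_nat_def)
qed

lemma derivP_0_var: "derivP 0 f (var g) = f g"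
  by (simp add: var_def mon_poly_def derivP_single derive_mon_0_single)

text \<open>The part of the Leibniz rule in which a generator \<open>x\<close> other than
  \<open>g\<close> is differentiated. Moving \<open>g\<close> past \<open>x\<close> and moving it
  past \<open>f x\<close> cost different signs when \<open>g\<close> is odd, because
  \<open>f x\<close> has the opposite parity to \<open>x\<close>; \<open>alpha (var g)\<close>
  accounts for the discrepancy.\<close>

lemma mon_deriv_mult:
  assumes f: "reverses_parity f" and m: "mon_valid m" and g: "gen_valid g" and x: "x \<in> ks m" "x \<noteq> g"
    and ng: "\<not> (gen_odd g \<and> g \<in> ks m)"
  shows "smult (mon_sign (sg g 1) m) (mon_deriv f (sg g 1 + m) x) = pmul (alpha (var g)) (mon_deriv f m x)"
proof -
  let ?r = "m - sg x 1"
  have xm: "m = sg x 1 + ?r" using mon_diff_add[OF x(1)] by simp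
  have xv: "gen_valid x" using m x by (auto simp: mon_valid_def)
  have r: "mon_valid ?r" using m by (rule mon_valid_diff)
  have ngr: "\<not> (gen_odd g \<and> g \<in> ks ?r)" using ng xm by (metis Un_iff keys_add_nat)
  have 1: "sg g 1 + m - sg x 1 = sg g 1 + ?r"
    using x by (intro poly_mapping_eqI) (auto simp: lookup_add lookup_minus lookup_single when_def)
  have okx: "odd_keys (sg x 1) \<inter> odd_keys ?r = {}" using odd_keys_diff[OF m] by (auto simp: odd_keys_single)
  have okg: "odd_keys (sg g 1) \<inter> odd_keys ?r = {}" using ngr by (auto simp: odd_keys_single odd_keys_def)
  have s1: "mon_sign (sg g 1) m = mon_sign (sg g 1) (sg x 1) * mon_sign (sg g 1) ?r"
    by (subst xm, rule mon_sign_add_right[OF okx])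
  have s2: "mon_sign (sg x 1) (sg g 1 + ?r) = mon_sign (sg x 1) (sg g 1) * mon_sign (sg x 1) ?r"
    by (rule mon_sign_add_right[OF okg])
  have s3: "mon_sign (sg g 1) (sg x 1) = (if gen_odd g \<and> gen_odd x then -1 else 1) * mon_sign (sg x 1) (sg g 1)"
    by (subst mon_sign_swap) (use x in \<open>auto simp: odd_keys_single\<close>)
  have vr: "pmul (var g) (mon_poly ?r) = smult (mon_sign (sg g 1) ?r) (mon_poly (sg g 1 + ?r))"
    unfolding mon_poly_def var_mult_mon[OF r] if_not_P[OF ngr] by (simp add: smult_single)
  have "pmul (alpha (var g)) (f x) = smult (if gen_odd g \<and> gen_odd x then -1 else 1) (pmul (f x) (var g))"
  proof (cases "gen_odd x")
    case True
    then have "alpha (f x) = f x" using f xv by (simp add: reverses_parity_def)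
    then show ?thesis using True pmul_commute_even[of "f x" "alpha (var g)"]
      by (auto simp: alpha_var pmul_minus_right)
  next
    case False
    then have "alpha (f x) = - f x" using f xv by (simp add: reverses_parity_def)
    then show ?thesis using False pmul_anticommute_odd[of "f x" "var g"] by simp
  qed
  then have "pmul (alpha (var g)) (mon_deriv f m x) =
     smult (of_nat (lk m x) * mon_sign (sg x 1) ?r * (if gen_odd g \<and> gen_odd x then -1 else 1) * mon_sign (sg g 1) ?r)
       (pmul (f x) (mon_poly (sg g 1 + ?r)))"
    unfolding mon_deriv_def
    by (simp add: pmul_smult_right pmul_smult_left vr pmul_assoc mult_ac flip: pmul_assoc[of "alpha (var g)"])
  moreover have "lk (sg g 1 + m) x = lk m x" using x by (simp add: lookup_add lookup_single)
  ultimately show ?thesis unfolding mon_deriv_def 1 s2 s1 s3 by (simp add: mult_ac)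
qed

lemma derivP_var_mult_mon:
  assumes f: "reverses_parity f" and m: "mon_valid m" and g: "gen_valid g"
  shows "derivP 1 f (pmul (var g) (mon_poly m)) =
    pmul (f g) (mon_poly m) + pmul (alpha (var g)) (derivP 1 f (mon_poly m))"
proof -
  have D: "derivP 1 f (mon_poly n) = (\<Sum>x\<in>ks n. mon_deriv f n x)" if "mon_valid n" for n
    using that by (simp add: mon_poly_def derivP_single derive_mon_left[OF f])
  have og: "alpha (f g) = (if gen_odd g then f g else - f g)" using f g by (simp add: reverses_parity_def)
  show ?thesis
  proof (cases "gen_odd g \<and> g \<in> ks m")
    \<comment> \<open>Here the product vanishes and the two terms on the right must cancel.
      Differentiating a factor other than \<open>g\<close> leaves \<open>g\<close> in place, which
      the additional \<open>var g\<close> annihilates; only the factor \<open>g\<close> of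
      \<open>m\<close> contributes, and it does so with the opposite sign.\<close>
    case True
    let ?r = "m - sg g 1"
    have gm: "g \<in> ks m" and go: "gen_odd g" using True by auto
    have l1: "lk m g = 1" using m gm go by (auto simp: mon_valid_def)
    have "pmul (var g) (mon_deriv f m x) = 0" if "x \<in> ks m" "x \<noteq> g" for x
    proof -
      have "pmul (var g) (f x) = pmul (f x) (var g) \<or> pmul (var g) (f x) = - pmul (f x) (var g)"
      proof (cases "gen_odd x")
        case True
        then have "alpha (f x) = f x" using f m that by (auto simp: reverses_parity_def mon_valid_def)
        then show ?thesis using pmul_commute_even by metis
      next
        case False
        then have "alpha (f x) = - f x" using f m that by (auto simp: reverses_parity_def mon_valid_def)
        then show ?thesis using pmul_anticommute_odd[of "f x" "var g"] go by (simp add: alpha_var pmul_minus_left)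
      qed
      moreover have "pmul (var g) (mon_poly (m - sg x 1)) = 0"
        unfolding mon_poly_def var_mult_mon[OF mon_valid_diff[OF m]]
        using go gm that by (simp add: in_keys_iff lookup_minus lookup_single)
      ultimately have "pmul (pmul (var g) (f x)) (mon_poly (m - sg x 1)) = 0"
        by (metis pmul_assoc pmul_minus_left pmul_0(2) minus_zero)
      then show ?thesis by (simp add: mon_deriv_def pmul_smult_right flip: pmul_assoc)
    qed
    then have "pmul (var g) (derivP 1 f (mon_poly m)) = pmul (var g) (mon_deriv f m g)"
      unfolding D[OF m] pmul_sum_right by (subst sum.remove[OF _ gm]) auto
    also have "\<dots> = smult (mon_sign (sg g 1) ?r) (pmul (f g) (pmul (var g) (mon_poly ?r)))"
      using pmul_commute_even[of "f g" "var g"] og go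
      by (simp add: mon_deriv_def l1 pmul_smult_right flip: pmul_assoc)
    also have "pmul (var g) (mon_poly ?r) = smult (mon_sign (sg g 1) ?r) (mon_poly m)"
      unfolding mon_poly_def var_mult_mon[OF mon_valid_diff[OF m]]
      using l1 mon_diff_add[OF gm] by (simp add: in_keys_iff lookup_minus smult_single)
    finally have "pmul (var g) (derivP 1 f (mon_poly m)) = pmul (f g) (mon_poly m)"
      by (simp add: pmul_smult_right)
    moreover have "pmul (var g) (mon_poly m) = 0"
      unfolding mon_poly_def var_mult_mon[OF m] using True by simp
    ultimately show ?thesis using go
      by (simp add: alpha_var pmul_minus_left additive_0[of "derivP 1 f", OF derivP_add])
  next
    case False
    let ?s = "mon_sign (sg g 1) m" and ?n = "sg g 1 + m"
    have n: "mon_valid ?n" using False m g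
      by (auto intro!: mon_valid_add mon_valid_single simp: odd_keys_single odd_keys_def)
    have "derivP 1 f (pmul (var g) (mon_poly m)) = smult ?s (derivP 1 f (mon_poly ?n))"
      unfolding mon_poly_def var_mult_mon[OF m] if_not_P[OF False]
      by (simp add: derivP_smult[symmetric] smult_single)
    also have "\<dots> = (\<Sum>x\<in>insert g (ks m). smult ?s (mon_deriv f ?n x))"
      unfolding D[OF n] by (simp add: PV.scale_sum_right keys_add_nat)
    also have "\<dots> = (\<Sum>x\<in>insert g (ks m) - {g}. smult ?s (mon_deriv f ?n x)) + smult ?s (mon_deriv f ?n g)"
      by (subst sum.remove[of _ g]) (auto simp: add.commute)
    also have "(\<Sum>x\<in>insert g (ks m) - {g}. smult ?s (mon_deriv f ?n x)) =
        (\<Sum>x\<in>ks m - {g}. pmul (alpha (var g)) (mon_deriv f m x))"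
      using mon_deriv_mult[OF f m g _ _ False] by (intro sum.cong) auto
    \<comment> \<open>The exponent of \<open>g\<close> in \<open>?n\<close> is one more than in
      \<open>m\<close>: the extra 1 yields the term \<open>f g\<close>, and the rest belongs to the
      derivative of \<open>m\<close>.\<close>
    also have "smult ?s (mon_deriv f ?n g) = smult (1 + of_nat (lk m g)) (pmul (f g) (mon_poly m))"
    proof -
      have "?n - sg g 1 = m" by simp
      then show ?thesis by (simp add: mon_deriv_def lookup_add mult_ac)
    qed
    also have "\<dots> = pmul (f g) (mon_poly m) + (if g \<in> ks m then pmul (alpha (var g)) (mon_deriv f m g) else 0)"
    proof (cases "g \<in> ks m")
      case True
      then have go: "\<not> gen_odd g" using False by auto
      let ?r = "m - sg g 1"
      have s: "mon_sign (sg g 1) ?r = 1" using go by (simp add: mon_sign_def odd_keys_single)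
      have "pmul (var g) (mon_poly ?r) = mon_poly m"
        unfolding mon_poly_def var_mult_mon[OF mon_valid_diff[OF m]]
        using go mon_diff_add[OF True] s by simp
      moreover have "pmul (var g) (f g) = pmul (f g) (var g)"
        using pmul_anticommute_odd[of "f g" "var g"] og go pmul_commute_even[of "var g" "f g"] by (simp add: alpha_var)
      ultimately have "pmul (alpha (var g)) (mon_deriv f m g) = smult (of_nat (lk m g)) (pmul (f g) (mon_poly m))"
        using go by (simp add: alpha_var mon_deriv_def s pmul_smult_right flip: pmul_assoc) (simp add: pmul_assoc)
      then show ?thesis using True by (simp add: PV.scale_left_distrib)
    next
      case False then show ?thesis by (simp add: in_keys_iff)
    qed
    finally have "derivP 1 f (pmul (var g) (mon_poly m)) = pmul (f g) (mon_poly m) +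
      ((\<Sum>x\<in>ks m - {g}. pmul (alpha (var g)) (mon_deriv f m x)) + (if g \<in> ks m then pmul (alpha (var g)) (mon_deriv f m g) else 0))"
      by (simp add: add_ac)
    also have "(\<Sum>x\<in>ks m - {g}. pmul (alpha (var g)) (mon_deriv f m x)) + (if g \<in> ks m then pmul (alpha (var g)) (mon_deriv f m g) else 0)
      = pmul (alpha (var g)) (derivP 1 f (mon_poly m))"
      unfolding D[OF m] pmul_sum_right
      by (cases "g \<in> ks m") (auto simp: sum.remove[of _ g] add.commute)
    finally show ?thesis .
  qed
qed

lemma derivP_var_mult:
  assumes f: "reverses_parity f" and p: "p \<in> Pset" and g: "gen_valid g"
  shows "derivP 1 f (pmul (var g) p) = pmul (f g) p + pmul (alpha (var g)) (derivP 1 f p)"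
proof (induction p rule: poly_mapping_induct_add)
  case (single m c)
  have "sg m c = smult c (mon_poly m)" by (simp add: mon_poly_def smult_single)
  moreover have "mon_valid m" using single p by (auto simp: Pset_def)
  ultimately show ?case using derivP_var_mult_mon[OF f _ g, of m]
    by (simp add: pmul_smult_right derivP_smult PV.scale_right_distrib)
qed (simp_all add: pmul_add_right derivP_add additive_0[of "derivP 1 f", OF derivP_add] algebra_simps)

lemma derivP_pmul:
  assumes f: "reverses_parity f" and p: "p \<in> Pset" and q: "q \<in> Pset"
  shows "derivP 1 f (pmul p q) = pmul (derivP 1 f p) q + pmul (alpha p) (derivP 1 f q)"
  using p
proof (induction rule: Pset_induct)
  case (const c)
  show ?case by (simp add: derivP_smult flip: smult_def)
next
  case (var g p)
  have "derivP 1 f (pmul (pmul (var g) p) q) = pmul (f g) (pmul p q) + pmul (alpha (var g)) (derivP 1 f (pmul p q))"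
    unfolding pmul_assoc by (rule derivP_var_mult[OF f Pset_pmul[OF var(2) q] var(1)])
  also have "\<dots> = pmul (pmul (f g) p + pmul (alpha (var g)) (derivP 1 f p)) q + pmul (alpha (pmul (var g) p)) (derivP 1 f q)"
    by (simp add: var.IH pmul_add_right pmul_add_left pmul_assoc alpha_pmul)
  finally show ?case by (simp only: derivP_var_mult[OF f var(2) var(1)])
next
  case (add p p')
  then show ?case by (simp add: pmul_add_left derivP_add alpha_add algebra_simps)
qed

lemma alpha_derivP:
  assumes f: "reverses_parity f" and p: "p \<in> Pset"
  shows "alpha (derivP 1 f p) = - derivP 1 f (alpha p)"
  using p
proof (induction rule: Pset_induct)
  case (const c)
  show ?case by simp
next
  case (var g p)
  have fg: "alpha (f g) = (if gen_odd g then f g else - f g)" using f var by (simp add: reverses_parity_def)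
  have "derivP 1 f (alpha (pmul (var g) p)) = (if gen_odd g then - derivP 1 f (pmul (var g) (alpha p)) else derivP 1 f (pmul (var g) (alpha p)))"
    by (simp add: alpha_pmul alpha_var pmul_minus_left additive_minus[of "derivP 1 f", OF derivP_add])
  then show ?case
    unfolding derivP_var_mult[OF f var(2,1)] derivP_var_mult[OF f Pset_alpha[OF var(2)] var(1)]
    by (auto simp: alpha_add alpha_pmul var.IH fg alpha_var alpha_minus pmul_minus_left pmul_minus_right)
next
  case (add p p')
  then show ?case by (simp add: derivP_add alpha_add)
qed

text \<open>\<open>q\<close> and \<open>k\<close> are a differential and a homotopy on generators.
  \<open>EE_var\<close> says that \<open>Q K + K Q\<close> is idempotent on generators, so each
  generator splits into eigenvectors for 0 and 1. \<open>rep\<close> moves the 0-part into the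
  target subalgebra up to an exact term; the representative is closed so that products of
  representatives remain cohomologous to the products themselves.\<close>

locale contraction =
  fixes q k :: "gen \<Rightarrow> poly" and G :: "poly set"
  assumes rq: "reverses_parity q" and rk: "reverses_parity k"
    and QQ_var: "\<And>g. gen_valid g \<Longrightarrow> derivP 1 q (q g) = 0"
    and EE_var: "\<And>g e. gen_valid g \<Longrightarrow> e = derivP 1 q (k g) + derivP 1 k (q g) \<Longrightarrow>
      derivP 1 q (derivP 1 k e) + derivP 1 k (derivP 1 q e) = e"
    and rep: "\<And>g. gen_valid g \<Longrightarrow> \<exists>w\<in>subalg G \<inter> Pset. \<exists>b\<in>Pset. derivP 1 q w = 0 \<and>
      var g - (derivP 1 q (k g) + derivP 1 k (q g)) = w + derivP 1 q b"
begin

definition "Q = derivP 1 q"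
definition "K = derivP 1 k"
definition "E p = Q (K p) + K (Q p)"

lemma Q_add: "Q (x + y) = Q x + Q y" by (simp add: Q_def derivP_add)
lemma K_add: "K (x + y) = K x + K y" by (simp add: K_def derivP_add)
lemma E_add: "E (x + y) = E x + E y" by (simp add: E_def Q_add K_add)
lemma Q_smult: "Q (smult c x) = smult c (Q x)" by (simp add: Q_def derivP_smult)
lemma K_smult: "K (smult c x) = smult c (K x)" by (simp add: K_def derivP_smult)
lemma E_smult: "E (smult c x) = smult c (E x)" by (simp add: E_def Q_smult K_smult PV.scale_right_distrib)
lemma Q_Pset: "x \<in> Pset \<Longrightarrow> Q x \<in> Pset" by (simp add: Q_def Pset_derivP rq)
lemma K_Pset: "x \<in> Pset \<Longrightarrow> K x \<in> Pset" by (simp add: K_def Pset_derivP rk)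
lemma E_Pset: "x \<in> Pset \<Longrightarrow> E x \<in> Pset" by (simp add: E_def Q_Pset K_Pset Pset_add)
lemma Q_const [simp]: "Q (const c) = 0" by (simp add: Q_def)
lemma K_const [simp]: "K (const c) = 0" by (simp add: K_def)
lemmas Q_0 [simp] = additive_0[of Q, OF Q_add]
lemmas K_0 [simp] = additive_0[of K, OF K_add]
lemmas Q_diff = additive_diff[of Q, OF Q_add]
lemmas E_diff = additive_diff[of E, OF E_add]
lemmas E_sum = additive_sum[of E, OF E_add]

lemma Q_pmul: "x \<in> Pset \<Longrightarrow> y \<in> Pset \<Longrightarrow> Q (pmul x y) = pmul (Q x) y + pmul (alpha x) (Q y)"
  by (simp add: Q_def derivP_pmul rq)
lemma K_pmul: "x \<in> Pset \<Longrightarrow> y \<in> Pset \<Longrightarrow> K (pmul x y) = pmul (K x) y + pmul (alpha x) (K y)"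
  by (simp add: K_def derivP_pmul rk)
lemma alpha_Q: "x \<in> Pset \<Longrightarrow> alpha (Q x) = - Q (alpha x)" by (simp add: Q_def alpha_derivP rq)
lemma alpha_K: "x \<in> Pset \<Longrightarrow> alpha (K x) = - K (alpha x)" by (simp add: K_def alpha_derivP rk)

lemma Q_var: "gen_valid g \<Longrightarrow> Q (var g) = q g" by (simp add: Q_def derivP_1_var rq)
lemma K_var: "gen_valid g \<Longrightarrow> K (var g) = k g" by (simp add: K_def derivP_1_var rk)

lemma QQ: "x \<in> Pset \<Longrightarrow> Q (Q x) = 0"
proof (induction rule: Pset_induct)
  case (var g p)
  have "Q (Q (var g)) = 0" unfolding Q_var[OF var(1)] using QQ_var[OF var(1)] by (simp only: Q_def)
  moreover have "Q (alpha (var g)) = - alpha (Q (var g))" using alpha_Q[of "var g"] Pset_var[OF var(1)] by simp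
  ultimately show ?case using var
    by (simp add: Q_pmul Pset_var Q_Pset Q_add Pset_pmul Pset_alpha pmul_minus_left)
qed (simp_all add: Q_add)

text \<open>The anticommutator of two odd derivations is an even derivation: the mixed terms cancel
  because \<open>Q\<close> and \<open>K\<close> both anticommute with \<open>alpha\<close>.\<close>

lemma E_pmul:
  assumes "x \<in> Pset" "y \<in> Pset"
  shows "E (pmul x y) = pmul (E x) y + pmul x (E y)"
  using assms
  by (simp add: E_def Q_pmul K_pmul Q_add K_add Q_Pset K_Pset Pset_pmul Pset_alpha alpha_Q alpha_K
      pmul_add_left pmul_add_right pmul_minus_left)

text \<open>On a closed sum \<open>x\<close> with top eigenvalue \<open>Suc n\<close>, the operator
  \<open>E - Suc n\<close> kills the top component and returns a closed sum of the others, exact by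
  induction. Since \<open>E x = Q (K x)\<close> is exact as well, so is the nonzero multiple
  \<open>Suc n\<close> of \<open>x\<close>.\<close>

lemma eigensum_exact:
  assumes "\<And>i. i \<in> {1..n} \<Longrightarrow> F i \<in> Pset \<and> E (F i) = smult (of_nat i) (F i)"
    and "Q (\<Sum>i=1..n. F i) = 0"
  shows "\<exists>b\<in>Pset. (\<Sum>i=1..n. F i) = Q b"
  using assms
proof (induction n arbitrary: F)
  case 0 then show ?case by (auto intro!: bexI[of _ 0])
next
  case (Suc n)
  let ?x = "\<Sum>i=1..Suc n. F i"
  let ?F = "\<lambda>i. smult (of_nat i - of_nat (Suc n)) (F i)"
  have xP: "?x \<in> Pset" using Suc.prems(1) by (intro Pset_sum) auto
  have Ex: "E ?x = Q (K ?x)" using Suc.prems(2) by (simp only: E_def K_0 add_0_right)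
  have "E ?x - smult (of_nat (Suc n)) ?x = (\<Sum>i=1..Suc n. ?F i)"
    unfolding E_sum PV.scale_sum_right sum_subtractf[symmetric]
    using Suc.prems(1) by (intro sum.cong) (auto simp: PV.scale_left_diff_distrib)
  also have "\<dots> = (\<Sum>i=1..n. ?F i)" by simp
  finally have y: "(\<Sum>i=1..n. ?F i) = E ?x - smult (of_nat (Suc n)) ?x" by simp
  have "\<exists>b\<in>Pset. (\<Sum>i=1..n. ?F i) = Q b"
  proof (rule Suc.IH)
    fix i assume "i \<in> {1..n}"
    then show "?F i \<in> Pset \<and> E (?F i) = smult (of_nat i) (?F i)"
      using Suc.prems(1)[of i] by (simp add: Pset_smult E_smult mult.commute)
  next
    show "Q (\<Sum>i=1..n. ?F i) = 0"
      unfolding y Q_diff Q_smult Suc.prems(2) Ex using QQ[OF K_Pset[OF xP]] by simp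
  qed
  then obtain b where b: "b \<in> Pset" "E ?x - smult (of_nat (Suc n)) ?x = Q b" using y by auto
  have Q_eq: "smult (of_nat (Suc n)) ?x = Q (K ?x - b)" using b(2) unfolding Ex Q_diff by (simp add: algebra_simps)
  have nz: "1 / of_nat (Suc n) * of_nat (Suc n) = (1 :: complex)" by (simp del: of_nat_Suc)
  have "?x = smult (1 / of_nat (Suc n)) (smult (of_nat (Suc n)) ?x)" by (simp only: PV.scale_scale nz PV.scale_one)
  also have "\<dots> = smult (1 / of_nat (Suc n)) (Q (K ?x - b))" by (rule arg_cong, rule Q_eq)
  also have "\<dots> = Q (smult (1 / of_nat (Suc n)) (K ?x - b))" by (rule Q_smult[symmetric])
  finally have "?x = Q (smult (1 / of_nat (Suc n)) (K ?x - b))" .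
  moreover have "smult (1 / of_nat (Suc n)) (K ?x - b) \<in> Pset"
    using b(1) xP by (intro Pset_smult Pset_diff K_Pset)
  ultimately show ?case by blast
qed

text \<open>The eigenvalue-0 elements for which the desired conclusion already holds. Stability
  under sums and products lets the eigenvalue-0 component of a polynomial be built up generator by
  generator.\<close>

definition M :: "poly set" where
  "M = {x \<in> Pset. E x = 0 \<and> (\<exists>w\<in>subalg G \<inter> Pset. \<exists>b\<in>Pset. Q w = 0 \<and> x = w + Q b)}"

lemma M_closed: "x \<in> M \<Longrightarrow> Q x = 0"
  by (auto simp: M_def Q_add QQ)

text \<open>With \<open>x = w + Q b\<close> and \<open>y = w' + Q b'\<close>, the product differs
  from that of \<open>w\<close> and \<open>w'\<close> by
  \<open>Q (pmul (alpha w) b' + pmul b y)\<close>, because \<open>alpha w\<close> and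
  \<open>y\<close> are closed.\<close>

lemma M_pmul:
  assumes "x \<in> M" "y \<in> M"
  shows "pmul x y \<in> M"
proof -
  obtain w b where w: "w \<in> subalg G" "w \<in> Pset" "b \<in> Pset" "Q w = 0" "x = w + Q b"
    using assms(1) by (auto simp: M_def)
  obtain w' b' where w': "w' \<in> subalg G" "w' \<in> Pset" "b' \<in> Pset" "Q w' = 0" "y = w' + Q b'"
    using assms(2) by (auto simp: M_def)
  have P: "x \<in> Pset" "y \<in> Pset" "E x = 0" "E y = 0" using assms by (auto simp: M_def)
  have "Q (alpha w) = 0" using alpha_Q[OF w(2)] w(4) by (metis alpha_0 neg_equal_0_iff_equal)
  then have "pmul w (Q b') = Q (pmul (alpha w) b')"
    using w w' by (simp add: Q_pmul Pset_alpha)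
  moreover have "pmul (Q b) y = Q (pmul b y)"
    using w P M_closed[OF assms(2)] by (simp add: Q_pmul)
  moreover have "pmul x y = pmul w w' + pmul w (Q b') + pmul (Q b) y"
    by (simp add: w(5) w'(5) pmul_add_left pmul_add_right)
  ultimately have "pmul x y = pmul w w' + Q (pmul (alpha w) b' + pmul b y)"
    by (simp add: Q_add)
  moreover have "pmul (alpha w) b' + pmul b y \<in> Pset"
    using w w' P by (intro Pset_add Pset_pmul Pset_alpha)
  moreover have "pmul w w' \<in> subalg G \<inter> Pset" using w w' by (auto intro: subalg.mul Pset_pmul)
  moreover have "Q (pmul w w') = 0" using w w' by (simp add: Q_pmul)
  moreover have "E (pmul x y) = 0" using P by (simp add: E_pmul)
  ultimately show ?thesis using P Pset_pmul unfolding M_def by blast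
qed

text \<open>A generator is \<open>x + y\<close> with \<open>E x = 0\<close> and
  \<open>E y = y\<close>. Multiplication by \<open>x\<close> preserves the eigenvalue and
  multiplication by \<open>y\<close> raises it by 1, as \<open>E\<close> is a derivation.\<close>

lemma eigen_decomposition:
  assumes "p \<in> Pset"
  shows "\<exists>n F. p = (\<Sum>i\<le>n. F i) \<and> F 0 \<in> M \<and> (\<forall>i. F i \<in> Pset \<and> E (F i) = smult (of_nat i) (F i))"
  using assms
proof (induction rule: Pset_induct)
  case (const c)
  have "const c \<in> M" unfolding M_def
    by (auto simp: Pset_const E_def intro!: bexI[of _ 0] bexI[of _ "const c"] subalg.const)
  then show ?case
    by (intro exI[of _ 0] exI[of _ "\<lambda>i. if i = 0 then const c else 0"])
      (auto simp: Pset_const E_def)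
next
  case (var g p)
  then obtain n F where F: "p = (\<Sum>i\<le>n. F i)" "F 0 \<in> M" "\<And>i. F i \<in> Pset" "\<And>i. E (F i) = smult (of_nat i) (F i)"
    by blast
  define y where "y = E (var g)"
  define x where "x = var g - y"
  have gP: "var g \<in> Pset" using var(1) by (rule Pset_var)
  have yP: "y \<in> Pset" and xP: "x \<in> Pset" using gP by (auto simp: y_def x_def E_Pset Pset_diff)
  have yeq: "y = derivP 1 q (k g) + derivP 1 k (q g)"
    using var(1) by (simp add: y_def E_def Q_var K_var) (simp add: Q_def K_def)
  have Ey: "E y = y" using EE_var[OF var(1) yeq] by (simp add: E_def Q_def K_def)
  then have Ex: "E x = 0" by (simp add: x_def E_diff) (simp add: y_def)
  have xM: "x \<in> M" unfolding M_def using rep[OF var(1)] xP Ex by (simp add: x_def yeq Q_def)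
  \<comment> \<open>The induction hypothesis says nothing about the vanishing of \<open>F i\<close>
    for \<open>i > n\<close>; without truncation the shifted sum up to \<open>Suc n\<close> would
    pick up the stray term \<open>F (Suc n)\<close>.\<close>
  define F' where "F' = (\<lambda>i. if i \<le> n then F i else 0)"
  define H where "H = (\<lambda>i. pmul x (F' i) + (if i = 0 then 0 else pmul y (F' (i - 1))))"
  have F': "F' i \<in> Pset" "E (F' i) = smult (of_nat i) (F' i)" for i
    using F by (auto simp: F'_def E_def)
  have "(\<Sum>i\<le>Suc n. H i) = pmul x (\<Sum>i\<le>Suc n. F' i) + (\<Sum>i\<le>Suc n. if i = 0 then 0 else pmul y (F' (i - 1)))"
    by (simp only: H_def sum.distrib pmul_sum_right)
  also have "(\<Sum>i\<le>Suc n. if i = 0 then 0 else pmul y (F' (i - 1))) = pmul y (\<Sum>i\<le>n. F' i)"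
    by (subst sum.atMost_Suc_shift) (simp add: pmul_sum_right)
  also have "(\<Sum>i\<le>Suc n. F' i) = p" by (simp add: F'_def F(1))
  also have "(\<Sum>i\<le>n. F' i) = p" by (simp add: F'_def F(1))
  finally have "(\<Sum>i\<le>Suc n. H i) = pmul (var g) p" by (simp add: x_def pmul_diff_left)
  moreover have "H 0 \<in> M" using M_pmul[OF xM F(2)] by (simp add: H_def F'_def)
  moreover have "H i \<in> Pset" for i using F' xP yP by (auto simp: H_def intro!: Pset_add Pset_pmul)
  moreover have "E (H i) = smult (of_nat i) (H i)" for i
  proof (cases i)
    case 0 then show ?thesis using xP F' by (simp add: H_def E_pmul Ex)
  next
    case (Suc j)
    then show ?thesis using xP yP F'
      by (simp add: H_def E_pmul E_add Ex Ey pmul_smult_right pmul_add_right PV.scale_right_distrib PV.scale_left_distrib)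
  qed
  ultimately show ?case by metis
next
  case (add p p')
  obtain n F where F: "p = (\<Sum>i\<le>n. F i)" "F 0 \<in> M" "\<And>i. F i \<in> Pset" "\<And>i. E (F i) = smult (of_nat i) (F i)"
    using add by blast
  obtain n' F' where F': "p' = (\<Sum>i\<le>n'. F' i)" "F' 0 \<in> M" "\<And>i. F' i \<in> Pset" "\<And>i. E (F' i) = smult (of_nat i) (F' i)"
    using add by blast
  define H where "H = (\<lambda>i. (if i \<le> n then F i else 0) + (if i \<le> n' then F' i else 0))"
  have "(\<Sum>i\<le>max n n'. if i \<le> n then F i else 0) = p"
    unfolding F(1) by (rule sum.mono_neutral_cong_right) auto
  moreover have "(\<Sum>i\<le>max n n'. if i \<le> n' then F' i else 0) = p'"
    unfolding F'(1) by (rule sum.mono_neutral_cong_right) auto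
  ultimately have "p + p' = (\<Sum>i\<le>max n n'. H i)" by (simp add: H_def sum.distrib)
  moreover have "F 0 + F' 0 \<in> M"
  proof -
    obtain w b where w: "w \<in> subalg G" "w \<in> Pset" "b \<in> Pset" "Q w = 0" "F 0 = w + Q b"
      using F(2) by (auto simp: M_def)
    obtain w' b' where w': "w' \<in> subalg G" "w' \<in> Pset" "b' \<in> Pset" "Q w' = 0" "F' 0 = w' + Q b'"
      using F'(2) by (auto simp: M_def)
    have "F 0 + F' 0 = (w + w') + Q (b + b')" by (simp add: w w' Q_add)
    moreover have "w + w' \<in> subalg G \<inter> Pset" using w w' by (auto intro: subalg.add Pset_add)
    moreover have "E (F 0 + F' 0) = 0" using F(2) F'(2) by (simp add: E_add M_def)
    moreover have "Q (w + w') = 0" by (simp add: w w' Q_add)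
    moreover have "b + b' \<in> Pset" "F 0 + F' 0 \<in> Pset" using w w' F(3) F'(3) by (blast intro: Pset_add)+
    ultimately show ?thesis unfolding M_def by blast
  qed
  then have "H 0 \<in> M" by (simp add: H_def)
  moreover have "H i \<in> Pset \<and> E (H i) = smult (of_nat i) (H i)" for i
    using F F' by (auto simp: H_def E_add PV.scale_right_distrib Pset_add) (simp_all add: E_def)
  ultimately show ?case by blast
qed

theorem cohomologous_subalg:
  assumes "p \<in> Pset" "Q p = 0"
  shows "\<exists>b\<in>Pset. p - Q b \<in> subalg G"
proof -
  obtain n F where F: "p = (\<Sum>i\<le>n. F i)" "F 0 \<in> M" "\<And>i. F i \<in> Pset \<and> E (F i) = smult (of_nat i) (F i)"
    using eigen_decomposition[OF assms(1)] by blast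
  have p: "p = F 0 + (\<Sum>i=1..n. F i)"
    unfolding F(1) by (simp add: atMost_atLeast0 sum.atLeast_Suc_atMost One_nat_def)
  then have "Q (\<Sum>i=1..n. F i) = 0" using assms(2) M_closed[OF F(2)] by (simp add: Q_add)
  from eigensum_exact[OF F(3) this] obtain b where b: "b \<in> Pset" "(\<Sum>i=1..n. F i) = Q b" by blast
  obtain w b' where w: "w \<in> subalg G" "b' \<in> Pset" "F 0 = w + Q b'" using F(2) by (auto simp: M_def)
  have "p - Q (b' + b) = w" by (simp add: p b w Q_add)
  then show ?thesis using w b Pset_add by (metis)
qed

end

subsection \<open>Linear elements\<close>

definition LinF :: "field set \<Rightarrow> poly set" where
  "LinF X = PV.span {var (J f c) | f c. f \<in> X \<and> gen_valid (J f c)}"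

abbreviation "Lin \<equiv> LinF UNIV"

lemma LinF_var: "f \<in> X \<Longrightarrow> gen_valid (J f c) \<Longrightarrow> var (J f c) \<in> LinF X"
  unfolding LinF_def by (rule PV.span_base) blast

lemma LinF_0 [simp]: "0 \<in> LinF X" unfolding LinF_def by (rule PV.span_zero)
lemma LinF_add: "p \<in> LinF X \<Longrightarrow> q \<in> LinF X \<Longrightarrow> p + q \<in> LinF X" unfolding LinF_def by (rule PV.span_add)
lemma LinF_diff: "p \<in> LinF X \<Longrightarrow> q \<in> LinF X \<Longrightarrow> p - q \<in> LinF X" unfolding LinF_def by (rule PV.span_diff)
lemma LinF_smult: "p \<in> LinF X \<Longrightarrow> smult c p \<in> LinF X" unfolding LinF_def by (rule PV.span_scale)
lemma LinF_sum: "(\<And>i. i \<in> A \<Longrightarrow> f i \<in> LinF X) \<Longrightarrow> sum f A \<in> LinF X" unfolding LinF_def by (rule PV.span_sum)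
lemma LinF_uminus: "p \<in> LinF X \<Longrightarrow> - p \<in> LinF X" unfolding LinF_def by (rule PV.span_neg)
lemma LinF_mono: "X \<subseteq> Y \<Longrightarrow> LinF X \<subseteq> LinF Y" unfolding LinF_def by (rule PV.span_mono) blast
lemma LinF_Lin: "p \<in> LinF X \<Longrightarrow> p \<in> Lin" using LinF_mono[of X UNIV] by blast

lemmas LinF_intros = LinF_uminus LinF_0 LinF_add LinF_diff LinF_smult LinF_sum

lemma LinF_induct [consumes 1, case_names zero var smult add]:
  assumes "p \<in> LinF X" "P 0" "\<And>f c. f \<in> X \<Longrightarrow> gen_valid (J f c) \<Longrightarrow> P (var (J f c))"
    "\<And>c p. p \<in> LinF X \<Longrightarrow> P p \<Longrightarrow> P (smult c p)"
    "\<And>p q. p \<in> LinF X \<Longrightarrow> q \<in> LinF X \<Longrightarrow> P p \<Longrightarrow> P q \<Longrightarrow> P (p + q)"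
  shows "P p"
proof -
  have "p \<in> PV.span {var (J f c) | f c. f \<in> X \<and> gen_valid (J f c)}" using assms(1) by (simp add: LinF_def)
  then have "p \<in> LinF X \<and> P p"
  proof (induction rule: PV.span_induct_alt)
    case (step c x y)
    then show ?case by (auto intro!: assms(3-5) LinF_intros LinF_var)
  qed (auto simp: assms(2))
  then show ?thesis by simp
qed

lemma LinF_Pset: "p \<in> LinF X \<Longrightarrow> p \<in> Pset"
  by (induction rule: LinF_induct) (auto intro: Pset_add Pset_smult Pset_var)

lemma LinF_odd: "p \<in> LinF X \<Longrightarrow> (\<And>f c. f \<in> X \<Longrightarrow> gen_odd (J f c)) \<Longrightarrow> alpha p = - p"
  by (induction rule: LinF_induct) (auto simp: alpha_add alpha_smult alpha_var)

lemma LinF_even: "p \<in> LinF X \<Longrightarrow> (\<And>f c. f \<in> X \<Longrightarrow> \<not> gen_odd (J f c)) \<Longrightarrow> alpha p = p"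
  by (induction rule: LinF_induct) (auto simp: alpha_add alpha_smult alpha_var)

section \<open>Formal derivatives and the wave equation on linear elements\<close>

lemma dmu_add: "dmu i (x + y) = dmu i x + dmu i y" by (simp add: dmu_def derivP_add)
lemma dmu_smult: "dmu i (smult c x) = smult c (dmu i x)" by (simp add: dmu_def derivP_smult)
lemmas dmu_0 [simp] = additive_0[of "dmu i" for i, OF dmu_add]
lemmas dmu_diff = additive_diff[of "dmu i" for i, OF dmu_add]
lemmas dmu_minus = additive_minus[of "dmu i" for i, OF dmu_add]
lemmas dmu_sum = additive_sum[of "dmu i" for i, OF dmu_add]
lemma dmu_var: "dmu i (var g) = dgen i g" by (simp add: dmu_def derivP_0_var)

lemma less_4_cases: "(i::nat) < 4 \<Longrightarrow> i = 0 \<or> i = 1 \<or> i = 2 \<or> i = 3"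
  by auto

lemma list_4: "length c = 4 \<Longrightarrow> \<exists>x y z w. c = [x, y, z, w]"
  by (auto simp: numeral_eq_Suc length_Suc_conv)

lemma gen_valid_4:
  assumes "gen_valid (J f c)"
  obtains y z w where "c = [0, y, z, w] \<or> c = [1, y, z, w]" "field_valid f"
proof -
  from assms obtain x y z w where c: "c = [x, y, z, w]" using list_4[of c] by auto
  then have "x = 0 \<or> x = 1" using assms by auto
  then show ?thesis using that c assms by auto
qed

lemma dmu_0_0: "dmu 0 (var (J f [0, y, z, w])) = var (J f [1, y, z, w])"
  by (simp add: dmu_var)
lemma dmu_0_1: "dmu 0 (var (J f [1, y, z, w])) =
    var (J f [0, Suc (Suc y), z, w]) + var (J f [0, y, Suc (Suc z), w]) + var (J f [0, y, z, Suc (Suc w)])"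
  by (simp add: dmu_var numeral_eq_Suc One_nat_def)
lemma dmu_1: "dmu 1 (var (J f [x, y, z, w])) = var (J f [x, Suc y, z, w])"
  by (simp add: dmu_var One_nat_def)
lemma dmu_2: "dmu 2 (var (J f [x, y, z, w])) = var (J f [x, y, Suc z, w])"
  by (simp add: dmu_var numeral_eq_Suc One_nat_def)
lemma dmu_3: "dmu 3 (var (J f [x, y, z, w])) = var (J f [x, y, z, Suc w])"
  by (simp add: dmu_var numeral_eq_Suc One_nat_def)

lemmas dmu_vars = dmu_0_0 dmu_0_1 dmu_1 dmu_2 dmu_3

lemma gen_valid_list: "gen_valid (J f [x, y, z, w]) \<longleftrightarrow> field_valid f \<and> x \<le> 1"
  by simp

lemma dmu_LinF:
  assumes "p \<in> LinF X" "i < 4"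
  shows "dmu i p \<in> LinF X"
  using assms(1)
proof (induction rule: LinF_induct)
  case (var f c)
  from gen_valid_4[OF var(2)] obtain y z w where c: "c = [0, y, z, w] \<or> c = [1, y, z, w]" "field_valid f" .
  then show ?case using less_4_cases[OF assms(2)] var(1)
    by (elim disjE) (auto simp: dmu_vars simp del: gen_valid.simps simp: gen_valid_list intro!: LinF_intros LinF_var)
qed (auto simp: dmu_add dmu_smult intro: LinF_intros)

lemma dmu_commute:
  assumes "p \<in> Lin" "i < 4" "j < 4"
  shows "dmu i (dmu j p) = dmu j (dmu i p)"
  using assms(1)
proof (induction rule: LinF_induct)
  case (var f c)
  from gen_valid_4[OF var(2)] obtain y z w where c: "c = [0, y, z, w] \<or> c = [1, y, z, w]" .
  then show ?case using less_4_cases[OF assms(2)] less_4_cases[OF assms(3)]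
    by (elim disjE) (simp_all add: dmu_vars dmu_add add_ac)
qed (simp_all add: dmu_add dmu_smult)

lemma wave:
  assumes "p \<in> Lin"
  shows "dmu 0 (dmu 0 p) = dmu 1 (dmu 1 p) + dmu 2 (dmu 2 p) + dmu 3 (dmu 3 p)"
  using assms(1)
proof (induction rule: LinF_induct)
  case (var f c)
  from gen_valid_4[OF var(2)] obtain y z w where c: "c = [0, y, z, w] \<or> c = [1, y, z, w]" .
  then show ?case 
    by (elim disjE) (simp_all add: dmu_vars dmu_add add_ac)
qed (simp_all add: dmu_add dmu_smult PV.scale_right_distrib)

lemma sum_4: "(\<Sum>i<(4::nat). F i) = F 0 + F 1 + F 2 + (F 3 :: 'a::comm_monoid_add)"
  by (simp add: numeral_eq_Suc One_nat_def)

lemma wave_eta: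
  assumes "p \<in> Lin"
  shows "(\<Sum>i<4. smult (eta i i) (dmu i (dmu i p))) = 0"
  by (simp add: sum_4 eta_def wave[OF assms])

lemma funpow_1: "((f :: 'a \<Rightarrow> 'a) ^^ 1) = f"
  by (simp add: One_nat_def fun_eq_iff)

lemma funpow_dmu_LinF: "p \<in> LinF X \<Longrightarrow> i < 4 \<Longrightarrow> (dmu i ^^ n) p \<in> LinF X"
  by (induction n) (auto intro: dmu_LinF)

lemma funpow_dmu_commute: "p \<in> Lin \<Longrightarrow> i < 4 \<Longrightarrow> j < 4 \<Longrightarrow> dmu j ((dmu i ^^ n) p) = (dmu i ^^ n) (dmu j p)"
  by (induction n) (auto simp: dmu_commute[of _ j i] funpow_dmu_LinF)

lemma funpow_dmu_add: "(dmu i ^^ n) (p + q) = (dmu i ^^ n) p + (dmu i ^^ n) q"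
  by (induction n) (auto simp: dmu_add)
lemma funpow_dmu_smult: "(dmu i ^^ n) (smult c p) = smult c ((dmu i ^^ n) p)"
  by (induction n) (auto simp: dmu_smult)

text \<open>The exponents form a function, so that the exponent map of a monomial in the
  \<open>xi i\<close> can be inserted directly. The exponent of index 0 may exceed 1;
  \<open>dmu 0\<close> then applies the wave equation.\<close>

definition Ds :: "(nat \<Rightarrow> nat) \<Rightarrow> poly \<Rightarrow> poly" where
  "Ds c p = (dmu 0 ^^ c 0) ((dmu 1 ^^ c 1) ((dmu 2 ^^ c 2) ((dmu 3 ^^ c 3) p)))"

lemma applyDs_Ds: "applyDs c p = Ds (\<lambda>i. c ! i) p"
  by (simp add: applyDs_def Ds_def)

lemma Ds_add: "Ds c (p + q) = Ds c p + Ds c q"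
  by (simp add: Ds_def funpow_dmu_add)
lemma Ds_smult: "Ds c (smult a p) = smult a (Ds c p)"
  by (simp add: Ds_def funpow_dmu_smult)
lemmas Ds_0 [simp] = additive_0[of "Ds i" for i, OF Ds_add]
lemma Ds_LinF: "p \<in> LinF X \<Longrightarrow> Ds c p \<in> LinF X"
  by (auto simp: Ds_def intro!: funpow_dmu_LinF)

lemma dmu_Ds: "p \<in> Lin \<Longrightarrow> i < 4 \<Longrightarrow> dmu i (Ds c p) = Ds c (dmu i p)"
  by (simp add: Ds_def funpow_dmu_commute funpow_dmu_LinF)

lemma Ds_Suc:
  assumes "p \<in> Lin" "i < 4"
  shows "Ds (c(i := Suc (c i))) p = dmu i (Ds c p)"
  using less_4_cases[OF assms(2)] assms(1)
  by (elim disjE) (simp_all add: Ds_def funpow_dmu_commute funpow_dmu_LinF)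

abbreviation "jet0 f \<equiv> var (J f [0, 0, 0, 0])"

lemma funpow_dmu_3: "(dmu 3 ^^ n) (var (J f [x, y, z, w])) = var (J f [x, y, z, w + n])"
  by (induction n) (simp_all add: dmu_3)
lemma funpow_dmu_2: "(dmu 2 ^^ n) (var (J f [x, y, z, w])) = var (J f [x, y, z + n, w])"
  by (induction n) (simp_all add: dmu_2)
lemma funpow_dmu_1: "(dmu 1 ^^ n) (var (J f [x, y, z, w])) = var (J f [x, y + n, z, w])"
  by (induction n) (simp_all add: dmu_1)

lemma Ds_jet0: "c 0 \<le> 1 \<Longrightarrow> Ds c (jet0 f) = var (J f [c 0, c 1, c 2, c 3])"
  using le_Suc_eq[of "c 0" 0]
  by (auto simp: Ds_def funpow_dmu_1 funpow_dmu_2 funpow_dmu_3 dmu_0_0 funpow_1 One_nat_def[symmetric])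

lemma foldr_dmu_LinF: "p \<in> LinF X \<Longrightarrow> set ns \<subseteq> {..<4} \<Longrightarrow> foldr dmu ns p \<in> LinF X"
  by (induction ns) (auto intro: dmu_LinF)

definition "Hs = {H a b | a b. True}"
definition "Us = {U a | a. True}"
definition "Uts = {Ut a | a. True}"

definition hh :: "nat \<Rightarrow> nat \<Rightarrow> poly" where "hh a b = jet0 (H (min a b) (max a b))"

lemma hjet_hh: "hjet a b ns = foldr dmu ns (hh a b)"
  by (simp add: hjet_def jet_def hh_def)

lemma hh_sym: "hh a b = hh b a" by (simp add: hh_def min.commute max.commute)

lemma hh_LinF: "a < 4 \<Longrightarrow> b < 4 \<Longrightarrow> hh a b \<in> LinF Hs"
  by (auto simp: hh_def Hs_def intro!: LinF_var)
lemma U_LinF: "a < 4 \<Longrightarrow> jet0 (U a) \<in> LinF Us"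
  by (auto simp: Us_def intro!: LinF_var)
lemma Ut_LinF: "a < 4 \<Longrightarrow> jet0 (Ut a) \<in> LinF Uts"
  by (auto simp: Uts_def intro!: LinF_var)

lemma dQbase_H: "a < 4 \<Longrightarrow> b < 4 \<Longrightarrow> dQbase (H a b) \<in> LinF Us"
  by (auto simp: jet_def intro!: LinF_intros dmu_LinF U_LinF)
lemma dQbase_Ut: "a < 4 \<Longrightarrow> dQbase (Ut a) \<in> LinF Hs"
  by (auto simp: hjet_hh intro!: LinF_intros dmu_LinF hh_LinF)

lemma dQgen_Ds: "dQgen (J f c) = Ds (\<lambda>i. c ! i) (dQbase f)"
  by (simp add: applyDs_Ds)

lemma dQbase_Lin: "field_valid f \<Longrightarrow> dQbase f \<in> Lin"
  using LinF_Lin[OF dQbase_H] LinF_Lin[OF dQbase_Ut] by (cases f) (auto simp del: dQbase.simps(1,3))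

lemma dQgen_Lin: "gen_valid g \<Longrightarrow> dQgen g \<in> Lin"
  by (cases g) (auto simp: applyDs_Ds intro!: Ds_LinF dQbase_Lin simp del: dQbase.simps)

lemma reverses_parity_dQgen: "reverses_parity dQgen"
  unfolding reverses_parity_def
proof (intro allI impI)
  fix g assume g: "gen_valid g"
  obtain f c where gf: "g = J f c" by (cases g)
  have "alpha (dQgen g) = (if gen_odd g then dQgen g else - dQgen g)"
  proof (cases f)
    case (H a b)
    then have "dQgen g \<in> LinF Us" using g gf by (auto simp: dQgen_Ds intro!: Ds_LinF dQbase_H simp del: dQbase.simps dQgen.simps)
    then have "alpha (dQgen g) = - dQgen g" by (rule LinF_odd) (auto simp: Us_def)
    then show ?thesis using gf H by (simp del: dQgen.simps)
  next
    case (U a)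
    then show ?thesis using gf by (simp add: applyDs_Ds)
  next
    case (Ut a)
    then have "dQgen g \<in> LinF Hs" using g gf by (auto simp: dQgen_Ds intro!: Ds_LinF dQbase_Ut simp del: dQbase.simps dQgen.simps)
    then have "alpha (dQgen g) = dQgen g" by (rule LinF_even) (auto simp: Hs_def)
    then show ?thesis using gf Ut by (simp del: dQgen.simps)
  qed
  then show "dQgen g \<in> Pset \<and> alpha (dQgen g) = (if gen_odd g then dQgen g else - dQgen g)"
    using dQgen_Lin[OF g] LinF_Pset by blast
qed

section \<open>The differential on linear elements\<close>

lemma dQ_add: "dQ (x + y) = dQ x + dQ y" by (simp add: dQ_def derivP_add)
lemma dQ_smult: "dQ (smult c x) = smult c (dQ x)" by (simp add: dQ_def derivP_smult)
lemmas dQ_0 [simp] = additive_0[of dQ, OF dQ_add]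
lemmas dQ_diff = additive_diff[of dQ, OF dQ_add]
lemmas dQ_sum = additive_sum[of dQ, OF dQ_add]
lemma dQ_var: "gen_valid g \<Longrightarrow> dQ (var g) = dQgen g"
  by (simp add: dQ_def derivP_1_var reverses_parity_dQgen)

lemma dQ_Lin: "p \<in> Lin \<Longrightarrow> dQ p \<in> Lin"
  by (induction rule: LinF_induct)
    (auto simp: dQ_add dQ_smult dQ_var simp del: gen_valid.simps dQgen.simps intro!: LinF_intros dQgen_Lin)

text \<open>The critical case is a time derivative of a jet that already has one:
  \<open>dgen\<close> substitutes the wave equation there, and the image under \<open>dQ\<close>
  satisfies the same equation because it is linear in jets.\<close>

lemma dQ_dmu:
  assumes "p \<in> Lin" "i < 4"
  shows "dQ (dmu i p) = dmu i (dQ p)"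
  using assms(1)
proof (induction rule: LinF_induct)
  case (var f c)
  from gen_valid_4[OF var(2)] obtain y z w where c: "c = [0, y, z, w] \<or> c = [1, y, z, w]" and fv: "field_valid f" .
  define b where "b = dQbase f"
  have b: "b \<in> Lin" unfolding b_def using fv by (rule dQbase_Lin)
  have *: "dQ (var (J f [x, y, z, w])) = (dmu 0 ^^ x) ((dmu 1 ^^ y) ((dmu 2 ^^ z) ((dmu 3 ^^ w) b)))"
    if "x \<le> 1" for x y z w
    using that fv unfolding b_def
    by (subst dQ_var) (auto simp: dQgen_Ds Ds_def numeral_eq_Suc One_nat_def simp del: dQgen.simps dQbase.simps)
  have w: "dmu 0 (dmu 0 r) = dmu 1 (dmu 1 r) + dmu 2 (dmu 2 r) + dmu 3 (dmu 3 r)" if "r \<in> Lin" for r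
    using that by (rule wave)
  have Lin3: "(dmu 3 ^^ w) b \<in> Lin" for w using b by (simp add: funpow_dmu_LinF)
  have Lin2: "(dmu 2 ^^ z) ((dmu 3 ^^ w) b) \<in> Lin" for z w using Lin3 by (simp add: funpow_dmu_LinF)
  have Lin1: "(dmu 1 ^^ y) ((dmu 2 ^^ z) ((dmu 3 ^^ w) b)) \<in> Lin" for y z w using Lin2 by (simp add: funpow_dmu_LinF)
  have c0: "dmu 1 (dmu 0 r) = dmu 0 (dmu 1 r)" "dmu 2 (dmu 0 r) = dmu 0 (dmu 2 r)"
    "dmu 3 (dmu 0 r) = dmu 0 (dmu 3 r)" if "r \<in> Lin" for r
    by (rule dmu_commute[OF that]; simp)+
  show ?case using c less_4_cases[OF assms(2)]
    by (elim disjE)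
      (simp_all add: dmu_vars dQ_add * funpow_dmu_commute[symmetric] funpow_dmu_LinF w Lin1 Lin2 Lin3
        dmu_LinF b funpow_1 c0)
qed (simp_all add: dQ_add dQ_smult dmu_add dmu_smult)

lemma dQ_funpow_dmu: "p \<in> Lin \<Longrightarrow> i < 4 \<Longrightarrow> dQ ((dmu i ^^ n) p) = (dmu i ^^ n) (dQ p)"
  by (induction n) (auto simp: dQ_dmu funpow_dmu_LinF)

lemma dQ_Ds: "p \<in> Lin \<Longrightarrow> dQ (Ds c p) = Ds c (dQ p)"
  by (simp add: Ds_def dQ_funpow_dmu funpow_dmu_LinF)

lemma dQ_jet0: "field_valid f \<Longrightarrow> dQ (jet0 f) = dQbase f"
  by (subst dQ_var) (simp_all add: dQgen_Ds Ds_def numeral_eq_Suc One_nat_def del: dQbase.simps dQgen.simps)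

lemma eta_sym: "eta a b = eta b a" by (simp add: eta_def)

lemma dQ_hh:
  assumes "a < 4" "b < 4"
  shows "dQ (hh a b) = smult (- \<i> / 2)
      (dmu a (jet0 (U b)) + dmu b (jet0 (U a)) - smult (eta a b) (\<Sum>\<rho><4. smult (eta \<rho> \<rho>) (dmu \<rho> (jet0 (U \<rho>)))))"
proof -
  have "field_valid (H (min a b) (max a b))" using assms by auto
  then show ?thesis unfolding hh_def
    by (simp only: dQ_jet0) (auto simp: jet_def min_def max_def eta_sym add.commute)
qed

lemma dQ_U: "a < 4 \<Longrightarrow> dQ (jet0 (U a)) = 0"
  by (subst dQ_jet0) auto

lemma dQ_Ut: "a < 4 \<Longrightarrow> dQ (jet0 (Ut a)) = smult \<i> (\<Sum>\<nu><4. smult (eta \<nu> \<nu>) (dmu \<nu> (hh a \<nu>)))"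
  by (subst dQ_jet0) (auto simp: hjet_hh)

lemma hh_Lin: "a < 4 \<Longrightarrow> b < 4 \<Longrightarrow> hh a b \<in> Lin" using hh_LinF LinF_Lin by blast
lemma U_Lin: "a < 4 \<Longrightarrow> jet0 (U a) \<in> Lin" using U_LinF LinF_Lin by blast
lemma Ut_Lin: "a < 4 \<Longrightarrow> jet0 (Ut a) \<in> Lin" using Ut_LinF LinF_Lin by blast

text \<open>Ghosts are closed and gravitons go to ghosts, so only antighosts require a computation.
  There the gradient of the ghost divergence occurs twice with opposite signs, and what remains is
  the wave operator on a ghost.\<close>

lemma dQ_dQ_Lin:
  assumes "p \<in> Lin"
  shows "dQ (dQ p) = 0"
  using assms
proof (induction rule: LinF_induct)
  case (var f c)
  have fv: "field_valid f" using var by simp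
  have LU: "dQ p = 0" if "p \<in> LinF Us" for p
    using that
  proof (induction rule: LinF_induct)
    case (var f c) then show ?case by (auto simp: Us_def dQ_var applyDs_Ds)
  qed (simp_all add: dQ_add dQ_smult)
  have "dQ (dQbase f) = 0"
  proof (cases f)
    case (H a b) then show ?thesis using fv dQbase_H[of a b] LU by (simp del: dQbase.simps)
  next
    case (U a) then show ?thesis by simp
  next
    case (Ut a)
    then have a: "a < 4" using fv by simp
    let ?div = "\<Sum>\<rho><4. smult (eta \<rho> \<rho>) (dmu \<rho> (jet0 (U \<rho>)))"
    define k where "k = - \<i> / 2"
    have divL: "?div \<in> Lin" by (auto intro!: LinF_intros dmu_LinF U_Lin)
    have "dQ (\<Sum>\<nu><4. smult (eta \<nu> \<nu>) (dmu \<nu> (hh a \<nu>))) =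
      (\<Sum>\<nu><4. smult (eta \<nu> \<nu>) (dmu \<nu> (smult k (dmu a (jet0 (U \<nu>)) + dmu \<nu> (jet0 (U a)) - smult (eta a \<nu>) ?div))))"
      using a by (intro trans[OF dQ_sum] sum.cong refl) (simp only: dQ_smult dQ_dmu hh_Lin dQ_hh k_def lessThan_iff)
    also have "\<dots> = smult k (dmu a ?div + (\<Sum>\<nu><4. smult (eta \<nu> \<nu>) (dmu \<nu> (dmu \<nu> (jet0 (U a)))))
        - (\<Sum>\<nu><4. smult (eta \<nu> \<nu> * eta a \<nu>) (dmu \<nu> ?div)))"
      using a by (simp add: dmu_smult dmu_add dmu_diff dmu_sum dmu_commute[of _ a] U_Lin PV.scale_right_distrib
          PV.scale_right_diff_distrib sum.distrib sum_subtractf PV.scale_sum_right mult_ac)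
    also have "(\<Sum>\<nu><4. smult (eta \<nu> \<nu> * eta a \<nu>) (dmu \<nu> ?div)) = (\<Sum>\<nu><4. if \<nu> = a then dmu \<nu> ?div else 0)"
      by (intro sum.cong) (auto simp: eta_def)
    also have "\<dots> = dmu a ?div" using a by simp
    also have "(\<Sum>\<nu><4. smult (eta \<nu> \<nu>) (dmu \<nu> (dmu \<nu> (jet0 (U a))))) = 0" by (rule wave_eta[OF U_Lin[OF a]])
    finally have "dQ (\<Sum>\<nu><4. smult (eta \<nu> \<nu>) (dmu \<nu> (hh a \<nu>))) = 0" by simp
    then show ?thesis using Ut by (simp add: dQ_smult hjet_hh)
  qed
  moreover have "dQ (dQ (var (J f c))) = Ds (\<lambda>i. c ! i) (dQ (dQbase f))"
    using dQ_var[OF var(2)] dQ_Ds[OF dQbase_Lin[OF fv]] by (simp add: dQgen_Ds del: dQgen.simps dQbase.simps)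
  ultimately show ?case by simp
qed (simp_all add: dQ_add dQ_smult)

subsection \<open>Reduction to linear elements\<close>

lemma dQ_LinF_Hs:
  assumes "p \<in> LinF Hs" shows "dQ p \<in> LinF (Us \<union> Uts)"
  using assms
proof (induction rule: LinF_induct)
  case (var f c)
  then obtain a b where "f = H a b" by (auto simp: Hs_def)
  then have "dQ (var (J f c)) \<in> LinF Us"
    using var by (auto simp: dQ_var dQgen_Ds simp del: dQgen.simps dQbase.simps intro!: Ds_LinF dQbase_H)
  then show ?case using LinF_mono[of Us "Us \<union> Uts"] by blast
qed (auto simp: dQ_add dQ_smult intro: LinF_intros)

lemma dQ_LinF_Us_Uts:
  assumes "p \<in> LinF (Us \<union> Uts)" shows "dQ p \<in> LinF Hs"
  using assms
proof (induction rule: LinF_induct)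
  case (var f c)
  then consider a where "f = U a" | a where "f = Ut a" by (auto simp: Us_def Uts_def)
  then show ?case
  proof cases
    case 1 then show ?thesis using var by (simp add: dQ_var applyDs_Ds)
  next
    case 2 then show ?thesis
      using var by (auto simp: dQ_var dQgen_Ds simp del: dQgen.simps dQbase.simps intro!: Ds_LinF dQbase_Ut)
  qed
qed (auto simp: dQ_add dQ_smult intro: LinF_intros)

text \<open>A linear section of \<open>dQ\<close> on the image of \<open>LinF X\<close>, whose
  existence comes from bases of vector spaces.\<close>

lemma right_inverse_dQ:
  obtains g where "\<And>p. g p \<in> LinF X" "\<And>p q. g (p + q) = g p + g q" "\<And>c p. g (smult c p) = smult c (g p)"
    "\<And>p. p \<in> LinF X \<Longrightarrow> dQ (g (dQ p)) = dQ p"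
proof -
  interpret vector_space_pair smult smult by unfold_locales
  have "Vector_Spaces.linear smult smult dQ" by unfold_locales (simp_all add: dQ_add dQ_smult)
  moreover have "PV.subspace (LinF X)" by (simp add: LinF_def)
  ultimately obtain g where g: "g ` UNIV \<subseteq> LinF X" "Vector_Spaces.linear smult smult g" "\<forall>v\<in>dQ ` LinF X. dQ (g v) = v"
    using linear_exists_right_inverse_on by blast
  show ?thesis
    by (rule that[of g]) (use g linear_add[OF g(2)] linear_scale[OF g(2)] in auto)
qed

lemma gen_odd_field: "gen_odd (J f c) \<longleftrightarrow> f \<in> Us \<union> Uts" "\<not> gen_odd (J f c) \<longleftrightarrow> f \<in> Hs"
  by (cases f; auto simp: Us_def Uts_def Hs_def)+

lemma linear_contraction:
  obtains k where "reverses_parity k" "\<And>v. v \<in> Lin \<Longrightarrow> derivP 1 k v \<in> Lin"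
    "\<And>v. v \<in> Lin \<Longrightarrow> dQ (derivP 1 k (dQ v)) = dQ v"
    "\<And>v. v \<in> Lin \<Longrightarrow> derivP 1 k (derivP 1 k v) = 0"
proof -
  obtain ge where ge: "\<And>p. ge p \<in> LinF Hs" "\<And>p q. ge (p + q) = ge p + ge q" "\<And>c p. ge (smult c p) = smult c (ge p)"
    "\<And>p. p \<in> LinF Hs \<Longrightarrow> dQ (ge (dQ p)) = dQ p" using right_inverse_dQ by blast
  obtain go where go: "\<And>p. go p \<in> LinF (Us \<union> Uts)" "\<And>p q. go (p + q) = go p + go q" "\<And>c p. go (smult c p) = smult c (go p)"
    "\<And>p. p \<in> LinF (Us \<union> Uts) \<Longrightarrow> dQ (go (dQ p)) = dQ p" using right_inverse_dQ by blast
  \<comment> \<open>Sections are chosen separately for the two parities, so that the combined map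
    reverses parity. In the next line \<open>derivP 0\<close> only serves as linear extension, since
    \<open>h\<close> is evaluated on linear elements.\<close>
  define hv where "hv g = (if gen_odd g then ge (var g) else go (var g))" for g
  define h where "h = derivP 0 hv"
  have h_add: "h (p + q) = h p + h q" for p q by (simp add: h_def derivP_add)
  have h_smult: "h (smult c p) = smult c (h p)" for c p by (simp add: h_def derivP_smult)
  note h_0 = additive_0[of h, OF h_add] and h_diff = additive_diff[of h, OF h_add]
  have h_var: "h (var g) = hv g" for g by (simp add: h_def derivP_0_var)
  have ho: "h p = ge p" if "p \<in> LinF (Us \<union> Uts)" for p
    using that
  proof (induction rule: LinF_induct)
    case (var f c) then show ?case using gen_odd_field by (simp add: h_var hv_def del: gen_odd.simps)
  qed (auto simp: h_add h_smult h_0 ge additive_0[of ge, OF ge(2)])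
  have he: "h p = go p" if "p \<in> LinF Hs" for p
    using that
  proof (induction rule: LinF_induct)
    case (var f c)
    then have "\<not> gen_odd (J f c)" using gen_odd_field(2) by blast
    then show ?case by (simp add: h_var hv_def)
  qed (auto simp: h_add h_smult h_0 go additive_0[of go, OF go(2)])
  have h_Lin: "h v \<in> Lin" if "v \<in> Lin" for v
    using that
  proof (induction rule: LinF_induct)
    case (var f c) show ?case using ge(1) go(1) by (auto simp: h_var hv_def intro: LinF_Lin)
  qed (auto simp: h_add h_smult h_0 intro: LinF_intros)
  have QhQ: "dQ (h (dQ v)) = dQ v" if "v \<in> Lin" for v
    using that
  proof (induction rule: LinF_induct)
    case (var f c)
    show ?case
    proof (cases "f \<in> Hs")
      case True
      then have "var (J f c) \<in> LinF Hs" using var by (auto intro: LinF_var)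
      then show ?thesis using ho[OF dQ_LinF_Hs] ge(4) by simp
    next
      case False
      then have "var (J f c) \<in> LinF (Us \<union> Uts)" using var gen_odd_field[of f c] by (auto intro!: LinF_var simp del: gen_valid.simps)
      then show ?thesis using he[OF dQ_LinF_Us_Uts] go(4) by simp
    qed
  qed (auto simp: h_add h_smult h_0 dQ_add dQ_smult)
  \<comment> \<open>\<open>h dQ h\<close> already satisfies \<open>d k d = d\<close>, but its square
    need not vanish. The second term leaves \<open>dQ K = dQ h\<close> intact because
    \<open>dQ dQ = 0\<close>, and it achieves \<open>dQ (h (K v)) = 0\<close>, an expression
    contained in both terms of \<open>K (K v)\<close>.\<close>
  define K where "K v = h (dQ (h v)) - dQ (h (h (dQ (h v))))" for v
  define k where "k g = K (var g)" for g
  have K_odd: "K v \<in> LinF Hs" if "v \<in> LinF (Us \<union> Uts)" for v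
  proof -
    have 1: "h (dQ (h v)) \<in> LinF Hs" using that by (simp add: ho ge(1) dQ_LinF_Hs)
    then show ?thesis unfolding K_def by (intro LinF_intros dQ_LinF_Us_Uts) (auto simp: he go(1))
  qed
  have K_even: "K v \<in> LinF (Us \<union> Uts)" if "v \<in> LinF Hs" for v
  proof -
    have 1: "h (dQ (h v)) \<in> LinF (Us \<union> Uts)" using that by (simp add: he go(1) dQ_LinF_Us_Uts)
    then show ?thesis unfolding K_def by (intro LinF_intros dQ_LinF_Hs) (auto simp: ho ge(1))
  qed
  have k: "reverses_parity k"
    unfolding reverses_parity_def
  proof (intro allI impI)
    fix g assume gv: "gen_valid g"
    obtain f c where g: "g = J f c" by (cases g)
    show "k g \<in> Pset \<and> alpha (k g) = (if gen_odd g then k g else - k g)"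
    proof (cases "gen_odd g")
      case True
      then have "k g \<in> LinF Hs" unfolding k_def g using gv gen_odd_field[of f c] g
        by (intro K_odd LinF_var) auto
      moreover from this have "alpha (k g) = k g" by (rule LinF_even) (auto simp: Hs_def)
      ultimately show ?thesis using True LinF_Pset by auto
    next
      case False
      then have "k g \<in> LinF (Us \<union> Uts)" unfolding k_def g using gv gen_odd_field[of f c] g
        by (intro K_even LinF_var) auto
      moreover from this have "alpha (k g) = - k g" by (rule LinF_odd) (auto simp: Us_def Uts_def)
      ultimately show ?thesis using False LinF_Pset by auto
    qed
  qed
  have Kd: "derivP 1 k v = K v" if "v \<in> Lin" for v
    using that
  proof (induction rule: LinF_induct)
    case (var f c) then show ?case unfolding derivP_1_var[OF k var(2)] by (simp only: k_def)
  next
    case zero show ?case by (simp add: K_def h_0 additive_0[of "derivP 1 k", OF derivP_add])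
  next
    case (smult c p) then show ?case by (simp add: derivP_smult K_def h_smult dQ_smult PV.scale_right_diff_distrib)
  next
    case (add p q) then show ?case by (simp add: derivP_add) (simp add: K_def h_add dQ_add)
  qed
  have K_Lin: "K v \<in> Lin" if "v \<in> Lin" for v
    unfolding K_def using that by (intro LinF_intros h_Lin dQ_Lin)
  have QK: "dQ (K v) = dQ (h v)" if "v \<in> Lin" for v
    unfolding K_def using that by (simp add: dQ_diff QhQ h_Lin dQ_Lin dQ_dQ_Lin)
  have "K (K v) = 0" if "v \<in> Lin" for v
  proof -
    have "dQ (h (K v)) = 0"
      unfolding K_def[of v] using that by (simp add: h_diff dQ_diff QhQ h_Lin dQ_Lin)
    then show ?thesis by (simp add: K_def[of "K v"] h_0)
  qed
  then show ?thesis
    using that[OF k] K_Lin by (simp add: Kd K_Lin dQ_Lin QK QhQ)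
qed

text \<open>On linear elements \<open>d k d = d\<close>, \<open>d d = 0\<close> and
  \<open>k k = 0\<close> give \<open>E E = E\<close>, and they make \<open>v - E v\<close> closed.
  The hypothesis on closed linear elements, applied to \<open>v - E v\<close>, therefore supplies
  \<open>rep\<close>.\<close>

theorem cohomologous_subalg_if_linear:
  assumes lin: "\<And>v. v \<in> Lin \<Longrightarrow> dQ v = 0 \<Longrightarrow> \<exists>w\<in>subalg G \<inter> Pset. \<exists>b\<in>Lin. v = w + dQ b"
    and "p \<in> Pset" "dQ p = 0"
  shows "\<exists>b\<in>Pset. p - dQ b \<in> subalg G"
proof -
  obtain k where k: "reverses_parity k" "\<And>v. v \<in> Lin \<Longrightarrow> derivP 1 k v \<in> Lin"
    "\<And>v. v \<in> Lin \<Longrightarrow> dQ (derivP 1 k (dQ v)) = dQ v"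
    "\<And>v. v \<in> Lin \<Longrightarrow> derivP 1 k (derivP 1 k v) = 0" using linear_contraction by blast
  have vL: "var g \<in> Lin" if "gen_valid g" for g
    using that by (cases g) (auto intro: LinF_var simp del: gen_valid.simps)
  have kL: "k g \<in> Lin" if "gen_valid g" for g
    using k(2)[OF vL[OF that]] derivP_1_var[OF k(1) that] by simp
  interpret contraction dQgen k G
  proof
    fix g assume g: "gen_valid g"
    have eq: "dQgen g = dQ (var g)" "k g = derivP 1 k (var g)"
      using g by (simp_all add: dQ_var derivP_1_var[OF k(1)])
    note v = vL[OF g]
    note kadd = derivP_add[of 1 k]
    have E: "derivP 1 dQgen (k g) + derivP 1 k (dQgen g) = dQ (derivP 1 k (var g)) + derivP 1 k (dQ (var g))"
      unfolding eq by (simp add: dQ_def)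
    show "derivP 1 dQgen (dQgen g) = 0" using dQ_dQ_Lin[OF v] by (simp add: eq dQ_def)
    fix e assume e: "e = derivP 1 dQgen (k g) + derivP 1 k (dQgen g)"
    have "dQ (derivP 1 k e) + derivP 1 k (dQ e) = e"
      unfolding e E using v
      by (simp add: kadd dQ_add k dQ_Lin dQ_dQ_Lin additive_0[of "derivP 1 k", OF kadd])
    then show "derivP 1 dQgen (derivP 1 k e) + derivP 1 k (derivP 1 dQgen e) = e" by (simp add: dQ_def)
  next
    fix g assume g: "gen_valid g"
    note v = vL[OF g]
    let ?e = "dQ (derivP 1 k (var g)) + derivP 1 k (dQ (var g))"
    have E: "derivP 1 dQgen (k g) + derivP 1 k (dQgen g) = ?e"
      using g by (simp add: dQ_var derivP_1_var[OF k(1)]) (simp add: dQ_def)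
    have "dQ (var g - ?e) = 0" "var g - ?e \<in> Lin"
      using v by (auto simp: dQ_diff dQ_add k dQ_dQ_Lin dQ_Lin intro!: LinF_intros)
    from lin[OF this(2,1)] obtain w b where wb: "w \<in> subalg G \<inter> Pset" "b \<in> Lin" "var g - ?e = w + dQ b" by blast
    then have "w = (var g - ?e) - dQ b" by simp
    then have "dQ w = 0" using \<open>dQ (var g - ?e) = 0\<close> wb(2) by (simp only: dQ_diff dQ_dQ_Lin) simp
    then show "\<exists>w\<in>subalg G \<inter> Pset. \<exists>b\<in>Pset. derivP 1 dQgen w = 0 \<and>
      var g - (derivP 1 dQgen (k g) + derivP 1 k (dQgen g)) = w + derivP 1 dQgen b"
      unfolding E using wb LinF_Pset by (metis dQ_def)
  qed (rule reverses_parity_dQgen, rule k(1))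
  show ?thesis using cohomologous_subalg[OF assms(2)] assms(3) by (simp add: Q_def dQ_def)
qed

subsection \<open>Traceless parts of tensors\<close>

text \<open>The decomposition into traceless and pure trace tensors is carried out with complex
  entries, where a Hermitian inner product is available, and is transferred to polynomial entries by
  linearity.\<close>

definition ctraceless :: "nat \<Rightarrow> (nat list \<Rightarrow> complex) \<Rightarrow> bool" where
  "ctraceless k x \<longleftrightarrow> (\<forall>a b idx. a < b \<and> b < k \<and> valid_idx k idx \<longrightarrow>
      (\<Sum>i<4. eta i i * x (idx[a := i, b := i])) = 0)"

text \<open>The witness \<open>S\<close> is a parameter, because later constructions conjugate it
  and use it as a coefficient.\<close>

definition cpure_with :: "nat \<Rightarrow> (nat list \<Rightarrow> complex) \<Rightarrow> (nat \<Rightarrow> nat \<Rightarrow> nat list \<Rightarrow> complex) \<Rightarrow> bool" where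
  "cpure_with k y S \<longleftrightarrow> (\<forall>a b idx i j. S a b (idx[a := i, b := j]) = S a b idx) \<and>
      (\<forall>idx. valid_idx k idx \<longrightarrow> y idx = (\<Sum>a<k. \<Sum>b\<in>{a<..<k}. eta (idx ! a) (idx ! b) * S a b idx))"

lemma finite_valid_idx [simp]: "finite {idx. valid_idx k idx}"
  using finite_lists_length_eq[of "{..<4::nat}" k] by (simp add: valid_idx_def conj_commute)

lemma valid_idx_update: "valid_idx k idx \<Longrightarrow> i < 4 \<Longrightarrow> valid_idx k (idx[a := i])"
  using set_update_subset_insert[of idx a i] by (auto simp: valid_idx_def)

lemma valid_idx_nth: "valid_idx k idx \<Longrightarrow> a < k \<Longrightarrow> idx ! a < 4"
  by (force simp: valid_idx_def dest: nth_mem)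

text \<open>Exchanging the entry \<open>j ! a\<close> with the free summation index is an involution
  on the pairs \<open>(j, i)\<close>.\<close>

lemma sum_valid_idx_update:
  fixes F :: "nat list \<Rightarrow> 'c::comm_monoid_add"
  assumes "a < k"
  shows "(\<Sum>j | valid_idx k j. \<Sum>i<4. F (j[a := i])) = (\<Sum>j | valid_idx k j. \<Sum>i<4::nat. F j)"
proof -
  let ?A = "{j. valid_idx k j} \<times> {..<4::nat}"
  have "(\<Sum>(j, i)\<in>?A. F (j[a := i])) = (\<Sum>(j, i)\<in>?A. F j)"
    by (rule sum.reindex_bij_witness[of _ "\<lambda>(j, i). (j[a := i], j ! a)" "\<lambda>(j, i). (j[a := i], j ! a)"])
      (use assms in \<open>auto simp: valid_idx_update valid_idx_nth\<close>, auto simp: valid_idx_def)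
  then show ?thesis by (simp add: sum.cartesian_product)
qed

lemma sum_valid_idx_update2:
  fixes F :: "nat list \<Rightarrow> 'c::comm_monoid_add"
  assumes "a < b" "b < k"
  shows "(\<Sum>j | valid_idx k j. \<Sum>i<4. \<Sum>l<4. F (j[a := i, b := l])) =
    (\<Sum>j | valid_idx k j. \<Sum>i<4::nat. \<Sum>l<4::nat. F j)"
proof -
  have "(\<Sum>j | valid_idx k j. \<Sum>i<4. \<Sum>l<4. F (j[a := i, b := l])) =
      (\<Sum>j | valid_idx k j. \<Sum>i<4::nat. \<Sum>l<4. F (j[b := l]))"
    using sum_valid_idx_update[of a k "\<lambda>j. \<Sum>l<4. F (j[b := l])"] assms by simp
  also have "\<dots> = (\<Sum>i<4::nat. \<Sum>j | valid_idx k j. \<Sum>l<4. F (j[b := l]))" by (rule sum.swap)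
  also have "\<dots> = (\<Sum>i<4::nat. \<Sum>j | valid_idx k j. \<Sum>l<4::nat. F j)"
    using sum_valid_idx_update[of b k F] assms by simp
  finally show ?thesis by (subst sum.swap)
qed

lemma sum_eta_diag:
  "(\<Sum>i<4. \<Sum>l<4. smult (eta i l) (F i l)) = (\<Sum>i<4. smult (eta i i) (F i i))"
proof -
  have "(\<Sum>i<4. \<Sum>l<4. smult (eta i l) (F i l)) = (\<Sum>i<4. \<Sum>l<4. if i = l then smult (eta i i) (F i i) else 0)"
    by (intro sum.cong refl) (simp add: eta_def)
  then show ?thesis by simp
qed

lemma sum_eta_diag_complex:
  "(\<Sum>i<4. \<Sum>l<4. eta i l * F i l) = (\<Sum>i<4. eta i i * F i i)"
proof -
  have "(\<Sum>i<4. \<Sum>l<4. eta i l * F i l) = (\<Sum>i<4. \<Sum>l<4. if i = l then eta i i * F i i else 0)"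
    by (intro sum.cong refl) (simp add: eta_def)
  then show ?thesis by simp
qed

lemma sum_const_4_4: "(\<Sum>i<4::nat. \<Sum>l<4::nat. x) = smult 16 x"
  by (rule poly_mapping_eqI) (simp only: sum_4 lookup_add lookup_smult, simp)

lemma nth_update2:
  "valid_idx k j \<Longrightarrow> a < b \<Longrightarrow> b < k \<Longrightarrow> j[a := i, b := l] ! a = i \<and> j[a := i, b := l] ! b = l"
  by (auto simp: valid_idx_def)

text \<open>Trace and multiplication by the metric are adjoint for the standard bilinear form.\<close>

lemma eta_sum_in_subspace:
  assumes W: "PV.subspace W" and ab: "a < b" "b < k"
    and tr: "\<And>idx. valid_idx k idx \<Longrightarrow> (\<Sum>i<4. smult (eta i i) (t (idx[a := i, b := i]))) \<in> W"
    and S: "\<And>idx i j. S (idx[a := i, b := j]) = S idx"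
  shows "(\<Sum>j | valid_idx k j. smult (eta (j ! a) (j ! b) * S j) (t j)) \<in> W"
proof -
  let ?x = "\<Sum>j | valid_idx k j. smult (eta (j ! a) (j ! b) * S j) (t j)"
  \<comment> \<open>Letting the entries in slots \<open>a\<close> and \<open>b\<close> run freely
    counts every index list 16 times, and the metric then collapses the two inner sums to a trace of
    \<open>t\<close>.\<close>
  have "(\<Sum>j | valid_idx k j. \<Sum>i<4. \<Sum>l<4. smult (eta (j[a := i, b := l] ! a) (j[a := i, b := l] ! b) * S (j[a := i, b := l])) (t (j[a := i, b := l])))
    = (\<Sum>j | valid_idx k j. \<Sum>i<4. \<Sum>l<4. smult (eta i l) (smult (S j) (t (j[a := i, b := l]))))"
    by (intro sum.cong refl) (simp add: nth_update2[OF _ ab] S)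
  also have "\<dots> = (\<Sum>j | valid_idx k j. \<Sum>i<4. smult (eta i i) (smult (S j) (t (j[a := i, b := i]))))"
    by (simp only: sum_eta_diag)
  also have "\<dots> = (\<Sum>j | valid_idx k j. smult (S j) (\<Sum>i<4. smult (eta i i) (t (j[a := i, b := i]))))"
    by (simp add: PV.scale_sum_right mult.commute)
  also have "\<dots> \<in> W"
    by (rule PV.subspace_sum[OF W], rule PV.subspace_scale[OF W], rule tr) simp
  finally have "(\<Sum>j | valid_idx k j. \<Sum>i<4::nat. \<Sum>l<4::nat. smult (eta (j ! a) (j ! b) * S j) (t j)) \<in> W"
    unfolding sum_valid_idx_update2[OF ab, of "\<lambda>j. smult (eta (j ! a) (j ! b) * S j) (t j)"] .
  also have "(\<Sum>j | valid_idx k j. \<Sum>i<4::nat. \<Sum>l<4::nat. smult (eta (j ! a) (j ! b) * S j) (t j)) = smult 16 ?x"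
    by (simp only: sum_const_4_4 PV.scale_sum_right)
  finally have "smult (1/16) (smult 16 ?x) \<in> W" by (rule PV.subspace_scale[OF W])
  then show ?thesis by simp
qed

text \<open>The bilinear pairing moves each metric factor of \<open>y\<close> onto \<open>x\<close>
  as a trace. Scalars are embedded as constant polynomials, so that
  \<open>eta_sum_in_subspace\<close> applies with the subspace \<open>{0}\<close>.\<close>

lemma ctraceless_cpure_orthogonal:
  assumes "ctraceless k x" "cpure_with k y S"
  shows "(\<Sum>j | valid_idx k j. x j * y j) = 0"
proof -
  have "PV.subspace {0}" by simp
  have 0: "const (\<Sum>j | valid_idx k j. eta (j ! a) (j ! b) * S a b j * x j) = 0" if ab: "a < b" "b < k" for a b
  proof -
    have c: "const (sum f A) = (\<Sum>i\<in>A. const (f i))" for f and A :: "'a set"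
      by (rule additive_sum) (rule const_add)
    have "(\<Sum>j | valid_idx k j. smult (eta (j ! a) (j ! b) * S a b j) (const (x j))) \<in> {0}"
    proof (rule eta_sum_in_subspace[OF \<open>PV.subspace {0}\<close> ab])
      fix idx assume "valid_idx k idx"
      then have "(\<Sum>i<4. eta i i * x (idx[a := i, b := i])) = 0" using assms(1) ab by (auto simp: ctraceless_def)
      then show "(\<Sum>i<4. smult (eta i i) (const (x (idx[a := i, b := i])))) \<in> {0}"
        by (simp add: smult_const flip: c) (simp add: const_def)
    qed (use assms(2) in \<open>auto simp: cpure_with_def\<close>)
    then show ?thesis by (simp add: smult_const c)
  qed
  have *: "(\<Sum>j | valid_idx k j. eta (j ! a) (j ! b) * S a b j * x j) = 0" if "a < b" "b < k" for a b
  proof -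
    have "lk (const (\<Sum>j | valid_idx k j. eta (j ! a) (j ! b) * S a b j * x j)) 0 = lk (0 :: poly) 0"
      using that by (rule arg_cong[OF 0])
    then show ?thesis by (simp add: const_def)
  qed
  have "(\<Sum>j | valid_idx k j. x j * y j) =
     (\<Sum>j | valid_idx k j. \<Sum>a<k. \<Sum>b\<in>{a<..<k}. eta (j ! a) (j ! b) * S a b j * x j)"
    using assms(2) by (intro sum.cong) (auto simp: cpure_with_def sum_distrib_left mult_ac)
  also have "\<dots> = (\<Sum>a<k. \<Sum>j | valid_idx k j. \<Sum>b\<in>{a<..<k}. eta (j ! a) (j ! b) * S a b j * x j)"
    by (rule sum.swap)
  also have "\<dots> = (\<Sum>a<k. \<Sum>b\<in>{a<..<k}. \<Sum>j | valid_idx k j. eta (j ! a) (j ! b) * S a b j * x j)"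
    by (intro sum.cong refl sum.swap)
  also have "\<dots> = 0" using * by simp
  finally show ?thesis .
qed

text \<open>Gram-Schmidt for a possibly dependent family: \<open>w\<close> is the part of the new
  vector orthogonal to the earlier ones. The form is Hermitian because the bilinear form has
  isotropic vectors over the complex numbers.\<close>

lemma orthogonal_decomposition:
  fixes e :: "'n \<Rightarrow> 'i \<Rightarrow> complex"
  assumes "finite N" "finite I"
  shows "\<exists>c z. (\<forall>j\<in>I. x j = (\<Sum>n\<in>N. c n * e n j) + z j) \<and> (\<forall>n\<in>N. (\<Sum>j\<in>I. z j * cnj (e n j)) = 0)"
  using assms(1)
proof (induction N arbitrary: x)
  case empty
  then show ?case by (auto intro!: exI[of _ x])
next
  case (insert n N)
  obtain c z where cz: "\<forall>j\<in>I. x j = (\<Sum>n\<in>N. c n * e n j) + z j" "\<forall>n\<in>N. (\<Sum>j\<in>I. z j * cnj (e n j)) = 0"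
    using insert.IH by blast
  obtain d w where dw: "\<forall>j\<in>I. e n j = (\<Sum>n\<in>N. d n * e n j) + w j" "\<forall>n\<in>N. (\<Sum>j\<in>I. w j * cnj (e n j)) = 0"
    using insert.IH by blast
  \<comment> \<open>If the new vector depends on the earlier ones, then \<open>w\<close> vanishes on
    \<open>I\<close> and the quotient is 0 by convention, so nothing is subtracted.\<close>
  define r where "r = (\<Sum>j\<in>I. z j * cnj (w j)) / (\<Sum>j\<in>I. w j * cnj (w j))"
  define z' where "z' = (\<lambda>j. z j - r * w j)"
  have z'N: "(\<Sum>j\<in>I. z' j * cnj (e m j)) = 0" if "m \<in> N" for m
  proof -
    have "(\<Sum>j\<in>I. z' j * cnj (e m j)) = (\<Sum>j\<in>I. z j * cnj (e m j)) - r * (\<Sum>j\<in>I. w j * cnj (e m j))"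
      by (simp add: z'_def left_diff_distrib sum_subtractf sum_distrib_left mult.assoc)
    then show ?thesis using cz dw that by simp
  qed
  have "(\<Sum>j\<in>I. z' j * cnj (w j)) = 0"
  proof (cases "(\<Sum>j\<in>I. w j * cnj (w j)) = 0")
    case True
    have "(\<Sum>j\<in>I. w j * cnj (w j)) = of_real (\<Sum>j\<in>I. (cmod (w j))\<^sup>2)"
      by (simp add: complex_norm_square del: of_real_power)
    then have "(\<Sum>j\<in>I. (cmod (w j))\<^sup>2) = 0" using True by (metis of_real_eq_0_iff)
    then have "\<forall>j\<in>I. w j = 0" using assms(2) by (subst (asm) sum_nonneg_eq_0_iff) auto
    then show ?thesis by simp
  next
    case False
    have "(\<Sum>j\<in>I. z' j * cnj (w j)) = (\<Sum>j\<in>I. z j * cnj (w j)) - r * (\<Sum>j\<in>I. w j * cnj (w j))"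
      by (simp add: z'_def left_diff_distrib sum_subtractf sum_distrib_left mult.assoc)
    then show ?thesis using False by (simp add: r_def)
  qed
  moreover have "(\<Sum>j\<in>I. z' j * cnj (e n j)) =
      (\<Sum>m\<in>N. cnj (d m) * (\<Sum>j\<in>I. z' j * cnj (e m j))) + (\<Sum>j\<in>I. z' j * cnj (w j))"
  proof -
    have "(\<Sum>j\<in>I. z' j * cnj (e n j)) = (\<Sum>j\<in>I. \<Sum>m\<in>N. z' j * cnj (d m) * cnj (e m j)) + (\<Sum>j\<in>I. z' j * cnj (w j))"
      unfolding sum.distrib[symmetric] using dw(1)
      by (intro sum.cong refl) (simp add: distrib_left sum_distrib_left mult.assoc)
    also have "(\<Sum>j\<in>I. \<Sum>m\<in>N. z' j * cnj (d m) * cnj (e m j)) = (\<Sum>m\<in>N. cnj (d m) * (\<Sum>j\<in>I. z' j * cnj (e m j)))"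
      by (subst sum.swap) (simp add: sum_distrib_left mult_ac)
    finally show ?thesis .
  qed
  ultimately have z'n: "(\<Sum>j\<in>I. z' j * cnj (e n j)) = 0" by (simp add: z'N)
  define c' where "c' m = (if m = n then r else c m - r * d m)" for m
  have "x j = (\<Sum>m\<in>insert n N. c' m * e m j) + z' j" if "j \<in> I" for j
  proof -
    have "(\<Sum>m\<in>insert n N. c' m * e m j) = r * e n j + (\<Sum>m\<in>N. (c m - r * d m) * e m j)"
      using insert.hyps by (simp add: c'_def) (intro sum.cong, auto)
    also have "(\<Sum>m\<in>N. (c m - r * d m) * e m j) = (\<Sum>m\<in>N. c m * e m j) - r * (\<Sum>m\<in>N. d m * e m j)"
      by (simp add: left_diff_distrib sum_subtractf sum_distrib_left mult.assoc)
    finally show ?thesis using cz(1) dw(1) that by (simp add: z'_def algebra_simps)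
  qed
  then show ?case using z'N z'n by (intro exI[of _ c'] exI[of _ z']) auto
qed

lemma ctraceless_decomposition:
  obtains z s S where "\<And>j. valid_idx k j \<Longrightarrow> x j = z j + s j" "ctraceless k z" "cpure_with k s S"
proof -
  \<comment> \<open>\<open>e (a, b, j0)\<close> is the metric in slots \<open>a\<close> and
    \<open>b\<close> times the indicator of agreement with \<open>j0\<close> in all other slots;
    setting both slots to 0 makes the comparison ignore them. Tensors in the span are pure traces,
    and orthogonality to the whole family is tracelessness.\<close>
  define e where "e = (\<lambda>(a, b, j0) j. if j[a := 0, b := 0] = j0[a := 0, b := 0] then eta (j ! a) (j ! b) else 0)"
  let ?N = "Sigma {..<k} (\<lambda>a. {a<..<k} \<times> {j. valid_idx k j})"
  have fin: "finite ?N" by auto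
  obtain c z where cz: "\<forall>j\<in>{j. valid_idx k j}. x j = (\<Sum>n\<in>?N. c n * e n j) + z j"
     "\<forall>n\<in>?N. (\<Sum>j | valid_idx k j. z j * cnj (e n j)) = 0"
    using orthogonal_decomposition[OF fin finite_valid_idx] by blast
  define S where "S a b j = (\<Sum>j0 | valid_idx k j0. if j[a := 0, b := 0] = j0[a := 0, b := 0] then c (a, b, j0) else 0)"
    for a b j
  have upd: "idx[a := i, b := j, a := 0, b := 0] = idx[a := 0, b := 0 :: nat]" for idx a b i j
    by (cases "a = b") (simp_all add: list_update_swap[of a b])
  have cp: "cpure_with k (\<lambda>j. \<Sum>n\<in>?N. c n * e n j) S"
    unfolding cpure_with_def
  proof (intro conjI allI impI)
    fix a b idx i j show "S a b (idx[a := i, b := j]) = S a b idx" unfolding S_def upd ..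
  next
    fix idx
    have "(\<Sum>n\<in>?N. c n * e n idx) = (\<Sum>a<k. \<Sum>(b, j0)\<in>{a<..<k} \<times> {j. valid_idx k j}. c (a, b, j0) * e (a, b, j0) idx)"
      by (subst sum.Sigma) (auto simp: case_prod_unfold)
    also have "\<dots> = (\<Sum>a<k. \<Sum>b\<in>{a<..<k}. \<Sum>j0 | valid_idx k j0. c (a, b, j0) * e (a, b, j0) idx)"
      by (simp add: sum.cartesian_product)
    also have "\<dots> = (\<Sum>a<k. \<Sum>b\<in>{a<..<k}. eta (idx ! a) (idx ! b) * S a b idx)"
      unfolding S_def sum_distrib_left by (intro sum.cong refl) (simp add: e_def)
    finally show "(\<Sum>n\<in>?N. c n * e n idx) = (\<Sum>a<k. \<Sum>b\<in>{a<..<k}. eta (idx ! a) (idx ! b) * S a b idx)" .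
  qed
  have "ctraceless k z"
    unfolding ctraceless_def
  proof (intro allI impI)
    fix a b j0 assume ab: "a < b \<and> b < k \<and> valid_idx k j0"
    let ?tr = "\<lambda>j. \<Sum>i<4. eta i i * z (j[a := i, b := i])"
    let ?J = "{j. valid_idx k j \<and> j[a := 0, b := 0] = j0[a := 0, b := 0]}"
    have "(a, b, j0) \<in> ?N" using ab by auto
    then have "(\<Sum>j | valid_idx k j. z j * cnj (e (a, b, j0) j)) = 0" using cz(2) by blast
    then have "0 = (\<Sum>j | valid_idx k j. \<Sum>i<4::nat. \<Sum>l<4::nat. z j * cnj (e (a, b, j0) j))"
      by (simp add: sum_4) (simp flip: sum_distrib_left)
    also have "\<dots> = (\<Sum>j | valid_idx k j. \<Sum>i<4. \<Sum>l<4. z (j[a := i, b := l]) * cnj (e (a, b, j0) (j[a := i, b := l])))"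
      by (rule sum_valid_idx_update2[symmetric]) (use ab in auto)
    also have "\<dots> = (\<Sum>j | valid_idx k j. if j[a := 0, b := 0] = j0[a := 0, b := 0] then ?tr j else 0)"
    proof (intro sum.cong refl)
      fix j assume "j \<in> {j. valid_idx k j}"
      then have j: "valid_idx k j" by simp
      have "cnj (e (a, b, j0) (j[a := i, b := l])) = (if j[a := 0, b := 0] = j0[a := 0, b := 0] then eta i l else 0)" for i l
        using nth_update2[OF j, of a b i l] ab by (auto simp: e_def upd eta_def)
      then show "(\<Sum>i<4. \<Sum>l<4. z (j[a := i, b := l]) * cnj (e (a, b, j0) (j[a := i, b := l]))) =
          (if j[a := 0, b := 0] = j0[a := 0, b := 0] then ?tr j else 0)"
        using sum_eta_diag_complex[of "\<lambda>i l. z (j[a := i, b := l])"] by (simp add: mult.commute)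
    qed
    also have "\<dots> = (\<Sum>j\<in>?J. ?tr j)"
      by (simp add: sum.If_cases Int_def)
    also have "\<dots> = (\<Sum>j\<in>?J. ?tr j0)"
    proof (rule sum.cong[OF refl])
      fix j assume "j \<in> ?J"
      then have "j[a := 0, b := 0] = j0[a := 0, b := 0]" by simp
      then have "j[a := 0, b := 0, a := i, b := i] = j0[a := 0, b := 0, a := i, b := i]" for i by simp
      moreover have "l[a := 0, b := 0, a := i, b := i] = l[a := i, b := i]" for i and l :: "nat list"
        using ab by (simp add: list_update_swap[of a b])
      ultimately show "?tr j = ?tr j0" by simp
    qed
    \<comment> \<open>The trace at \<open>j0\<close> is counted once for each member of its class
      \<open>?J\<close>; this class contains \<open>j0\<close>, so the factor can be
      cancelled.\<close>
    also have "\<dots> = of_nat (card ?J) * ?tr j0" by simp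
    finally have "of_nat (card ?J) * ?tr j0 = 0" by simp
    moreover have "card ?J \<noteq> 0"
      using ab finite_subset[of ?J "{j. valid_idx k j}"] by (auto simp: card_eq_0_iff)
    ultimately show "?tr j0 = 0" by simp
  qed
  then show ?thesis using that[of z "\<lambda>j. \<Sum>n\<in>?N. c n * e n j" S] cz(1) cp by (simp add: add.commute)
qed

lemma cnj_eta [simp]: "cnj (eta a b) = eta a b" by (simp add: eta_def)

lemma ctraceless_cnj: "ctraceless k z \<Longrightarrow> ctraceless k (\<lambda>j. cnj (z j))"
  unfolding ctraceless_def
  by (metis (no_types, lifting) cnj_eta complex_cnj_mult complex_cnj_zero cnj_sum sum.cong)

lemma cpure_cong: "cpure_with k s S \<Longrightarrow> (\<And>j. valid_idx k j \<Longrightarrow> s' j = s j) \<Longrightarrow> cpure_with k s' S"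
  unfolding cpure_with_def by simp

lemma cpure_cnj: "cpure_with k s S \<Longrightarrow> cpure_with k (\<lambda>j. cnj (s j)) (\<lambda>a b j. cnj (S a b j))"
  unfolding cpure_with_def by simp

text \<open>Decomposing the unit tensors gives one scalar matrix \<open>z\<close>; applied to
  \<open>t\<close> it yields the traceless part, and pairing with it shows uniqueness coefficient by
  coefficient. The complementary matrix is a pure trace, so by adjointness \<open>t - t0\<close> is
  a combination of traces of \<open>t\<close> and lies in every subspace containing them.\<close>

theorem traceless_part_mod:
  assumes t: "\<And>idx. \<not> valid_idx k idx \<Longrightarrow> t idx = 0" and W: "PV.subspace W"
    and tr: "\<And>a b idx. a < b \<Longrightarrow> b < k \<Longrightarrow> valid_idx k idx \<Longrightarrow>
      (\<Sum>i<4. smult (eta i i) (t (idx[a := i, b := i]))) \<in> W"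
    and i: "valid_idx k i"
  shows "t i - traceless_part k t i \<in> W"
proof -
  have "\<exists>z s S. (\<forall>j. valid_idx k j \<longrightarrow> (if j = i then 1 else 0) = z j + s j) \<and> ctraceless k z \<and> cpure_with k s S" for i
    using ctraceless_decomposition[of k "\<lambda>j. if j = i then 1 else 0"] by metis
  then obtain z s S where zs: "\<And>i j. valid_idx k j \<Longrightarrow> (if j = i then 1 else 0) = z i j + s i j"
    "\<And>i. ctraceless k (z i)" "\<And>i. cpure_with k (s i) (S i)" by metis
  \<comment> \<open>Traceless and pure trace tensors pair to zero, so pairing with \<open>z\<close>
    recovers the traceless component of any decomposition. Conjugation preserves both classes
    because the metric is real.\<close>
  have formula: "x i = (\<Sum>j | valid_idx k j. cnj (z i j) * v j)"
    if x: "ctraceless k x" and y: "cpure_with k (\<lambda>j. v j - x j) Y" and i: "valid_idx k i" for x v Y i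
  proof -
    have d: "(if j = i then 1 else 0) = cnj (z i j) + cnj (s i j)" if "valid_idx k j" for j
      using zs(1)[OF that, of i] by (metis complex_cnj_add complex_cnj_one complex_cnj_zero)
    have "x i = (\<Sum>j | valid_idx k j. (if j = i then 1 else 0) * x j)"
      using i by (simp add: if_distrib[of "\<lambda>c. c * _"] cong: if_cong)
    also have "\<dots> = (\<Sum>j | valid_idx k j. cnj (z i j) * x j) + (\<Sum>j | valid_idx k j. x j * cnj (s i j))"
      unfolding sum.distrib[symmetric] by (intro sum.cong refl) (simp only: mem_Collect_eq d, simp add: algebra_simps)
    also have "(\<Sum>j | valid_idx k j. x j * cnj (s i j)) = 0"
      by (rule ctraceless_cpure_orthogonal[OF x cpure_cnj[OF zs(3)]])
    also have "(\<Sum>j | valid_idx k j. cnj (z i j) * x j) =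
        (\<Sum>j | valid_idx k j. cnj (z i j) * v j) - (\<Sum>j | valid_idx k j. cnj (z i j) * (v j - x j))"
      by (simp add: right_diff_distrib sum_subtractf)
    also have "(\<Sum>j | valid_idx k j. cnj (z i j) * (v j - x j)) = 0"
      by (rule ctraceless_cpure_orthogonal[OF ctraceless_cnj[OF zs(2)] y])
    finally show ?thesis by simp
  qed
  \<comment> \<open>The projector is Hermitian. Its two forms are used differently: with
    \<open>z j i\<close> the traces of \<open>t0\<close> are evident, with
    \<open>cnj (z i j)\<close> the uniqueness formula applies.\<close>
  have z_sym: "z j i = cnj (z i j)" if ij: "valid_idx k i" "valid_idx k j" for i j
  proof -
    have "cpure_with k (\<lambda>l. (if l = j then 1 else 0) - z j l) (S j)"
      by (rule cpure_cong[OF zs(3)]) (simp only: zs(1) add_diff_cancel_left')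
    from formula[OF zs(2) this ij(1)] show ?thesis using ij by (simp add: if_distrib cong: if_cong)
  qed
  define t0 where "t0 i = (if valid_idx k i then \<Sum>j | valid_idx k j. smult (cnj (z i j)) (t j) else 0)" for i
  have t0z: "t0 i = (\<Sum>j | valid_idx k j. smult (z j i) (t j))" if "valid_idx k i" for i
    unfolding t0_def if_P[OF that] by (intro sum.cong refl) (use z_sym[OF that] in auto)
  have "traceless_part k t = t0"
    unfolding traceless_part_def
  proof (rule the_equality)
    have "traceless k t0"
      unfolding traceless_def
    proof (intro allI impI)
      fix a b idx assume ab: "a < b \<and> b < k \<and> valid_idx k idx"
      then have "(\<Sum>i<4. smult (eta i i) (t0 (idx[a := i, b := i]))) =
        (\<Sum>i<4. \<Sum>j | valid_idx k j. smult (eta i i * z j (idx[a := i, b := i])) (t j))"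
        by (intro sum.cong) (auto simp: t0z valid_idx_update PV.scale_sum_right)
      also have "\<dots> = (\<Sum>j | valid_idx k j. smult (\<Sum>i<4. eta i i * z j (idx[a := i, b := i])) (t j))"
        by (subst sum.swap) (simp add: PV.scale_sum_left)
      also have "\<dots> = 0" using zs(2) ab by (auto simp: ctraceless_def intro!: sum.neutral)
      finally show "(\<Sum>i<4. smult (eta i i) (t0 (idx[a := i, b := i]))) = 0" .
    qed
    moreover have "pure_trace k (\<lambda>idx. t idx - t0 idx)"
      unfolding pure_trace_def
    proof (intro exI conjI allI impI)
      let ?S = "\<lambda>a b idx. \<Sum>j | valid_idx k j. smult (S j a b idx) (t j)"
      fix a b and idx :: "nat list" and i j :: nat
      show "?S a b (idx[a := i, b := j]) = ?S a b idx"
        using zs(3) by (simp add: cpure_with_def)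
    next
      fix idx assume idx: "valid_idx k idx"
      have "t idx = (\<Sum>j | valid_idx k j. smult (if idx = j then 1 else 0) (t j))"
        using idx by (simp add: if_distrib[of "\<lambda>c. smult c _"] cong: if_cong)
      also have "\<dots> = (\<Sum>j | valid_idx k j. smult (z j idx) (t j)) + (\<Sum>j | valid_idx k j. smult (s j idx) (t j))"
        unfolding zs(1)[OF idx] by (simp add: PV.scale_left_distrib sum.distrib)
      finally have "t idx - t0 idx = (\<Sum>j | valid_idx k j. smult (s j idx) (t j))" using idx by (simp add: t0z)
      also have "\<dots> = (\<Sum>j | valid_idx k j. \<Sum>a<k. \<Sum>b\<in>{a<..<k}. smult (eta (idx ! a) (idx ! b)) (smult (S j a b idx) (t j)))"
        using zs(3) idx by (simp add: cpure_with_def PV.scale_sum_left)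
      also have "\<dots> = (\<Sum>a<k. \<Sum>b\<in>{a<..<k}. \<Sum>j | valid_idx k j. smult (eta (idx ! a) (idx ! b)) (smult (S j a b idx) (t j)))"
        by (subst sum.swap, intro sum.cong refl, rule sum.swap)
      finally show "t idx - t0 idx = (\<Sum>a<k. \<Sum>b\<in>{a<..<k}. smult (eta (idx ! a) (idx ! b))
          (\<Sum>j | valid_idx k j. smult (S j a b idx) (t j)))"
        by (simp add: PV.scale_sum_right)
    qed
    ultimately show "(\<forall>idx. \<not> valid_idx k idx \<longrightarrow> t0 idx = 0) \<and> traceless k t0 \<and> pure_trace k (\<lambda>idx. t idx - t0 idx)"
      by (simp add: t0_def)
  next
    fix t1 assume t1: "(\<forall>idx. \<not> valid_idx k idx \<longrightarrow> t1 idx = 0) \<and> traceless k t1 \<and> pure_trace k (\<lambda>idx. t idx - t1 idx)"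
    show "t1 = t0"
    proof
      fix i
      show "t1 i = t0 i"
      proof (cases "valid_idx k i")
        case True
        obtain Y where Y: "\<And>a b idx i j. Y a b (idx[a := i, b := j]) = Y a b idx"
          "\<And>idx. valid_idx k idx \<Longrightarrow> t idx - t1 idx = (\<Sum>a<k. \<Sum>b\<in>{a<..<k}. smult (eta (idx ! a) (idx ! b)) (Y a b idx))"
          using t1 unfolding pure_trace_def by auto
        show ?thesis
        proof (rule poly_mapping_eqI)
          fix m
          have "ctraceless k (\<lambda>j. lk (t1 j) m)"
            unfolding ctraceless_def
          proof (intro allI impI)
            fix a b idx assume "a < b \<and> b < k \<and> valid_idx k idx"
            then have "(\<Sum>i<4. smult (eta i i) (t1 (idx[a := i, b := i]))) = 0" using t1 unfolding traceless_def by blast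
            then have "lk (\<Sum>i<4. smult (eta i i) (t1 (idx[a := i, b := i]))) m = 0" by simp
            then show "(\<Sum>i<4. eta i i * lk (t1 (idx[a := i, b := i])) m) = 0" by (simp add: lookup_sum lookup_smult)
          qed
          moreover have "cpure_with k (\<lambda>j. lk (t j) m - lk (t1 j) m) (\<lambda>a b j. lk (Y a b j) m)"
            unfolding cpure_with_def using Y by (simp add: lookup_sum lookup_smult flip: lookup_minus)
          ultimately have "lk (t1 i) m = (\<Sum>j | valid_idx k j. cnj (z i j) * lk (t j) m)"
            by (rule formula[OF _ _ True])
          then show "lk (t1 i) m = lk (t0 i) m" using True by (simp add: t0_def lookup_sum lookup_smult)
        qed
      qed (use t1 in \<open>simp add: t0_def\<close>)
    qed
  qed
  \<comment> \<open>Here the pure trace tensor \<open>s i\<close> provides the coefficients in the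
    summation index, so that its metric factors contract the slots of \<open>t\<close>
    itself.\<close>
  moreover have "t i - t0 i = (\<Sum>a<k. \<Sum>b\<in>{a<..<k}. \<Sum>j | valid_idx k j. smult (eta (j ! a) (j ! b) * cnj (S i a b j)) (t j))"
  proof -
    have d: "(if j = i then 1 else 0) = cnj (z i j) + cnj (s i j)" if "valid_idx k j" for j
      using zs(1)[OF that, of i] by (metis complex_cnj_add complex_cnj_one complex_cnj_zero)
    have "t i = (\<Sum>j | valid_idx k j. smult (if j = i then 1 else 0) (t j))"
      using i by (simp add: if_distrib[of "\<lambda>c. smult c _"] cong: if_cong)
    also have "\<dots> = (\<Sum>j | valid_idx k j. smult (cnj (z i j)) (t j) + smult (cnj (s i j)) (t j))"
      by (intro sum.cong refl) (simp only: mem_Collect_eq d PV.scale_left_distrib)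
    finally have "t i - t0 i = (\<Sum>j | valid_idx k j. smult (cnj (s i j)) (t j))"
      using i by (simp add: t0_def sum.distrib)
    also have "\<dots> = (\<Sum>j | valid_idx k j. \<Sum>a<k. \<Sum>b\<in>{a<..<k}. smult (eta (j ! a) (j ! b) * cnj (S i a b j)) (t j))"
      using cpure_cnj[OF zs(3), of i] by (intro sum.cong refl) (simp add: cpure_with_def PV.scale_sum_left)
    also have "\<dots> = (\<Sum>a<k. \<Sum>b\<in>{a<..<k}. \<Sum>j | valid_idx k j. smult (eta (j ! a) (j ! b) * cnj (S i a b j)) (t j))"
      by (subst sum.swap, intro sum.cong refl, rule sum.swap)
    finally show ?thesis .
  qed
  moreover have "(\<Sum>a<k. \<Sum>b\<in>{a<..<k}. \<Sum>j | valid_idx k j. smult (eta (j ! a) (j ! b) * cnj (S i a b j)) (t j)) \<in> W"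
    using zs(3)[of i] by (intro PV.subspace_sum[OF W] eta_sum_in_subspace[OF W] tr) (auto simp: cpure_with_def)
  ultimately show ?thesis by simp
qed

subsection \<open>Traces of the jets of the curvature\<close>

definition lin_exact :: "poly set" where "lin_exact = dQ ` Lin"

lemma lin_exact_subspace: "PV.subspace lin_exact"
  unfolding PV.subspace_def lin_exact_def
proof (intro conjI allI ballI)
  show "0 \<in> dQ ` Lin" by (rule image_eqI[of _ _ 0]) auto
next
  fix x y assume "x \<in> dQ ` Lin" "y \<in> dQ ` Lin"
  then show "x + y \<in> dQ ` Lin" by (auto simp: dQ_add[symmetric] intro: LinF_intros)
next
  fix c x assume "x \<in> dQ ` Lin"
  then show "smult c x \<in> dQ ` Lin" by (auto simp: dQ_smult[symmetric] intro: LinF_intros)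
qed

lemmas lin_exact_0 = PV.subspace_0[OF lin_exact_subspace]
lemmas lin_exact_add = PV.subspace_add[OF lin_exact_subspace]
lemmas lin_exact_diff = PV.subspace_diff[OF lin_exact_subspace]
lemmas lin_exact_neg = PV.subspace_neg[OF lin_exact_subspace]
lemmas lin_exact_smult = PV.subspace_scale[OF lin_exact_subspace]
lemmas lin_exact_sum = PV.subspace_sum[OF lin_exact_subspace]
lemmas lin_exact_intros = lin_exact_0 lin_exact_add lin_exact_diff lin_exact_neg lin_exact_smult lin_exact_sum

lemma lin_exact_dmu: "x \<in> lin_exact \<Longrightarrow> i < 4 \<Longrightarrow> dmu i x \<in> lin_exact"
  unfolding lin_exact_def by (auto simp: dQ_dmu[symmetric] intro: dmu_LinF)

lemma lin_exact_foldr_dmu: "x \<in> lin_exact \<Longrightarrow> set ns \<subseteq> {..<4} \<Longrightarrow> foldr dmu ns x \<in> lin_exact"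
  by (induction ns) (auto intro: lin_exact_dmu)

lemma lin_exact_Ds: "x \<in> lin_exact \<Longrightarrow> Ds c x \<in> lin_exact"
  unfolding lin_exact_def by (auto simp: dQ_Ds[symmetric] intro: Ds_LinF)

lemma lin_exact_Lin: "x \<in> lin_exact \<Longrightarrow> x \<in> Lin"
  unfolding lin_exact_def by (auto intro: dQ_Lin)

lemma htr_Lin [simp]: "htr \<in> Lin"
  unfolding htr_def hjet_hh by (auto intro!: LinF_intros hh_Lin)

lemma hhat_Lin [simp]: "a < 4 \<Longrightarrow> b < 4 \<Longrightarrow> hhat a b \<in> Lin"
  unfolding hhat_def hjet_hh by (auto intro!: LinF_intros hh_Lin htr_Lin)

lemma hhat_sym: "hhat a b = hhat b a"
  by (simp add: hhat_def hjet_hh hh_sym eta_sym)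

lemma hhat_hh: "hhat a b = hh a b - smult (eta a b / 2) htr"
  by (simp add: hhat_def hjet_hh)

text \<open>Up to a constant this is the image of an antighost under \<open>dQ\<close>; all exact
  traces of the curvature arise from it.\<close>

definition hdiv :: "nat \<Rightarrow> poly" where
  "hdiv a = (\<Sum>i<4. smult (eta i i) (dmu i (hh a i)))"

lemma hdiv_lin_exact: "a < 4 \<Longrightarrow> hdiv a \<in> lin_exact"
  unfolding lin_exact_def
  by (rule image_eqI[of _ _ "smult (- \<i>) (jet0 (Ut a))"])
    (auto simp: dQ_smult dQ_Ut hdiv_def intro!: LinF_intros Ut_Lin simp del: PV.scale_minus_left)

lemma hdiv_Lin [simp]: "a < 4 \<Longrightarrow> hdiv a \<in> Lin"
  using hdiv_lin_exact lin_exact_Lin by blast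

lemma div_hhat:
  assumes "a < 4"
  shows "(\<Sum>i<4. smult (eta i i) (dmu i (hhat i a))) = hdiv a - smult (1/2) (dmu a htr)"
proof -
  have "(\<Sum>i<4. smult (eta i i) (dmu i (hhat i a))) = hdiv a - (\<Sum>i<4. smult (eta i i * eta i a / 2) (dmu i htr))"
    by (simp add: hhat_hh dmu_diff dmu_smult PV.scale_right_diff_distrib sum_subtractf hdiv_def hh_sym[of _ a])
  also have "(\<Sum>i<4. smult (eta i i * eta i a / 2) (dmu i htr)) = (\<Sum>i<4. if i = a then smult (1/2) (dmu a htr) else 0)"
    by (intro sum.cong refl) (auto simp: eta_def)
  finally show ?thesis using assms by simp
qed

text \<open>In four dimensions the trace of half the metric is 2, so passing to \<open>hhat\<close>
  turns the trace \<open>htr\<close> into its negative.\<close>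

lemma trace_hhat: "(\<Sum>i<4. smult (eta i i) (hhat i i)) = - htr"
proof (rule poly_mapping_eqI)
  fix m
  have "lk htr m = lk (hh 0 0) m - lk (hh 1 1) m - lk (hh 2 2) m - lk (hh 3 3) m"
    by (simp add: htr_def hjet_hh sum_4 eta_def lookup_add lookup_minus)
  then show "lk (\<Sum>i<4. smult (eta i i) (hhat i i)) m = lk (- htr) m"
    by (simp only: hhat_hh sum_4 lookup_add lookup_minus lookup_smult lookup_uminus) (simp add: eta_def)
qed

text \<open>The derivatives of \<open>hhat m n\<close> drop out by antisymmetry in \<open>r\<close>
  and \<open>s\<close>. What remains is the linearised Riemann tensor of the metric perturbation
  \<open>hhat\<close>.\<close>

lemma Riem_eq:
  assumes "m < 4" "n < 4" "r < 4" "s < 4"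
  shows "Riem m n r s = dmu r (dmu n (hhat m s)) - dmu r (dmu m (hhat n s))
    - dmu s (dmu n (hhat m r)) + dmu s (dmu m (hhat n r))"
  unfolding Riem_def Gamma_def using assms
  by (simp add: dmu_add dmu_diff dmu_commute[of "hhat m n" r s])

lemma Riem_Lin: "m < 4 \<Longrightarrow> n < 4 \<Longrightarrow> r < 4 \<Longrightarrow> s < 4 \<Longrightarrow> Riem m n r s \<in> Lin"
  by (simp add: Riem_eq) (intro LinF_intros dmu_LinF hhat_Lin; assumption)

lemma Riem_anti1: "m < 4 \<Longrightarrow> n < 4 \<Longrightarrow> r < 4 \<Longrightarrow> s < 4 \<Longrightarrow> Riem m n r s = - Riem n m r s"
  by (simp add: Riem_eq)

lemma Riem_anti2: "m < 4 \<Longrightarrow> n < 4 \<Longrightarrow> r < 4 \<Longrightarrow> s < 4 \<Longrightarrow> Riem m n r s = - Riem m n s r"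
  by (simp add: Riem_eq)

definition tr :: "(nat \<Rightarrow> poly) \<Rightarrow> poly" where
  "tr f = (\<Sum>i<4. smult (eta i i) (f i))"

lemma tr_add: "tr (\<lambda>i. f i + g i) = tr f + tr g"
  by (simp add: tr_def PV.scale_right_distrib sum.distrib)
lemma tr_diff: "tr (\<lambda>i. f i - g i) = tr f - tr g"
  by (simp add: tr_def PV.scale_right_diff_distrib sum_subtractf)
lemma tr_minus: "tr (\<lambda>i. - f i) = - tr f"
  by (simp add: tr_def sum_negf)
lemma tr_dmu: "tr (\<lambda>i. dmu j (f i)) = dmu j (tr f)"
  by (simp add: tr_def dmu_sum dmu_smult)
lemma tr_foldr: "tr (\<lambda>i. foldr dmu ns (f i)) = foldr dmu ns (tr f)"
  by (induction ns) (simp_all add: tr_dmu)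
lemma tr_cong: "(\<And>i. i < 4 \<Longrightarrow> f i = g i) \<Longrightarrow> tr f = tr g"
  by (simp add: tr_def)

lemma tr_box: "p \<in> Lin \<Longrightarrow> tr (\<lambda>i. dmu i (dmu i p)) = 0"
  unfolding tr_def by (rule wave_eta)

lemma tr_div: "a < 4 \<Longrightarrow> tr (\<lambda>i. dmu i (hhat i a)) = hdiv a - smult (1/2) (dmu a htr)"
  unfolding tr_def by (rule div_hhat)

text \<open>The wave equation removes the box term, and the second derivatives of \<open>htr\<close>
  cancel with the weights -1/2, 1 and -1/2; only derivatives of \<open>hdiv\<close> are
  left.\<close>

lemma Ricci_lin_exact:
  assumes "n < 4" "s < 4"
  shows "tr (\<lambda>i. Riem i n i s) \<in> lin_exact"
proof -
  have "tr (\<lambda>i. Riem i n i s) = tr (\<lambda>i. dmu n (dmu i (hhat i s)) - dmu i (dmu i (hhat n s))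
      - dmu s (dmu n (hhat i i)) + dmu s (dmu i (hhat i n)))"
    by (rule tr_cong) (use assms in \<open>simp add: Riem_eq dmu_commute[of _ _ n] hhat_sym[of n]\<close>)
  also have "\<dots> = dmu n (tr (\<lambda>i. dmu i (hhat i s))) - tr (\<lambda>i. dmu i (dmu i (hhat n s)))
      - dmu s (dmu n (tr (\<lambda>i. hhat i i))) + dmu s (tr (\<lambda>i. dmu i (hhat i n)))"
    by (simp only: tr_add tr_diff tr_dmu)
  also have "tr (\<lambda>i. hhat i i) = - htr" unfolding tr_def by (rule trace_hhat)
  also have "dmu n (tr (\<lambda>i. dmu i (hhat i s))) - tr (\<lambda>i. dmu i (dmu i (hhat n s)))
      - dmu s (dmu n (- htr)) + dmu s (tr (\<lambda>i. dmu i (hhat i n))) =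
      dmu n (hdiv s) + dmu s (hdiv n)"
  proof -
    have "x - smult (1/2) y - 0 + y + (z - smult (1/2) y) = x + z" for x y z :: poly
      by (rule poly_mapping_eqI) (simp only: lookup_add lookup_minus lookup_smult lookup_zero, simp)
    then show ?thesis using assms
      by (simp only: tr_div tr_box hhat_Lin dmu_diff dmu_smult dmu_minus dmu_commute[OF htr_Lin, of n s] diff_minus_eq_add)
  qed
  also have "\<dots> \<in> lin_exact" using assms by (intro lin_exact_intros lin_exact_dmu hdiv_lin_exact)
  finally show ?thesis .
qed

text \<open>The box terms vanish by the wave equation, and the trace terms are symmetric in
  \<open>r\<close> and \<open>s\<close>, hence cancel under the antisymmetrisation.\<close>

lemma Riem_div1_lin_exact:
  assumes "n < 4" "r < 4" "s < 4"
  shows "tr (\<lambda>i. dmu i (Riem i n r s)) \<in> lin_exact"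
proof -
  have c: "dmu i (dmu a (dmu b (hhat x y))) = dmu a (dmu b (dmu i (hhat x y)))"
    if "i < 4" "a < 4" "b < 4" "x < 4" "y < 4" for i a b x y
    using that by (simp add: dmu_commute[of _ i] dmu_LinF)
  have c2: "dmu i (dmu a (dmu i (hhat x y))) = dmu a (dmu i (dmu i (hhat x y)))"
    if "i < 4" "a < 4" "x < 4" "y < 4" for i a x y
    using that by (simp add: dmu_commute[of _ i a] dmu_LinF)
  have swap: "dmu r (dmu n (dmu s htr)) = dmu s (dmu n (dmu r htr))"
    using assms by (metis dmu_commute dmu_LinF htr_Lin)
  have "tr (\<lambda>i. dmu i (Riem i n r s)) = tr (\<lambda>i. dmu r (dmu n (dmu i (hhat i s))) - dmu r (dmu i (dmu i (hhat n s)))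
      - dmu s (dmu n (dmu i (hhat i r))) + dmu s (dmu i (dmu i (hhat n r))))"
    by (rule tr_cong) (use assms in \<open>simp add: Riem_eq dmu_add dmu_diff c[of _ r n] c[of _ s n] c2[of _ r] c2[of _ s]\<close>)
  also have "\<dots> = dmu r (dmu n (tr (\<lambda>i. dmu i (hhat i s)))) - dmu r (tr (\<lambda>i. dmu i (dmu i (hhat n s))))
      - dmu s (dmu n (tr (\<lambda>i. dmu i (hhat i r)))) + dmu s (tr (\<lambda>i. dmu i (dmu i (hhat n r))))"
    by (simp only: tr_add tr_diff tr_dmu)
  also have "\<dots> = dmu r (dmu n (hdiv s)) - dmu s (dmu n (hdiv r))"
    using assms by (simp add: tr_div tr_box dmu_diff dmu_smult swap)
  also have "\<dots> \<in> lin_exact" using assms by (intro lin_exact_intros lin_exact_dmu hdiv_lin_exact)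
  finally show ?thesis .
qed

lemma Riem_div2_lin_exact:
  assumes "m < 4" "n < 4" "s < 4"
  shows "tr (\<lambda>i. dmu i (Riem m n i s)) \<in> lin_exact"
proof -
  have c: "dmu i (dmu a (dmu b (hhat x y))) = dmu a (dmu b (dmu i (hhat x y)))"
    if "i < 4" "a < 4" "b < 4" "x < 4" "y < 4" for i a b x y
    using that by (simp add: dmu_commute[of _ i] dmu_LinF)
  have c2: "dmu i (dmu i (dmu a (hhat x y))) = dmu a (dmu i (dmu i (hhat x y)))"
    if "i < 4" "a < 4" "x < 4" "y < 4" for i a x y
    using that by (simp add: dmu_commute[of _ i a] dmu_LinF)
  have "tr (\<lambda>i. dmu i (Riem m n i s)) = tr (\<lambda>i. dmu n (dmu i (dmu i (hhat m s))) - dmu m (dmu i (dmu i (hhat n s)))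
      - dmu s (dmu n (dmu i (hhat i m))) + dmu s (dmu m (dmu i (hhat i n))))"
    by (rule tr_cong) (use assms in \<open>simp add: Riem_eq dmu_add dmu_diff c[of _ s n] c[of _ s m] c2[of _ n] c2[of _ m] hhat_sym[of _ m] hhat_sym[of _ n]\<close>)
  also have "\<dots> = dmu n (tr (\<lambda>i. dmu i (dmu i (hhat m s)))) - dmu m (tr (\<lambda>i. dmu i (dmu i (hhat n s))))
      - dmu s (dmu n (tr (\<lambda>i. dmu i (hhat i m)))) + dmu s (dmu m (tr (\<lambda>i. dmu i (hhat i n))))"
    by (simp only: tr_add tr_diff tr_dmu)
  also have "\<dots> = dmu s (dmu m (hdiv n)) - dmu s (dmu n (hdiv m))"
    using assms by (simp add: tr_div tr_box dmu_diff dmu_smult dmu_commute[OF htr_Lin, of m n])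
  also have "\<dots> \<in> lin_exact" using assms by (intro lin_exact_intros lin_exact_dmu hdiv_lin_exact)
  finally show ?thesis .
qed

lemma dmu_foldr: "p \<in> Lin \<Longrightarrow> i < 4 \<Longrightarrow> set ns \<subseteq> {..<4} \<Longrightarrow> dmu i (foldr dmu ns p) = foldr dmu ns (dmu i p)"
  by (induction ns) (auto simp: dmu_commute[of _ i] foldr_dmu_LinF)

lemma foldr_dmu_update:
  assumes "p \<in> Lin" "i < 4" "set ns \<subseteq> {..<4}" "j < length ns"
  shows "foldr dmu (ns[j := i]) p = foldr dmu (take j ns @ drop (Suc j) ns) (dmu i p)"
proof -
  have "set (drop (Suc j) ns) \<subseteq> {..<4}" using assms(3) set_drop_subset[of "Suc j" ns] by blast
  then show ?thesis using assms by (simp add: upd_conv_take_nth_drop dmu_foldr)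
qed

text \<open>Two curvature slots give 0 or, up to sign, the Ricci tensor; a curvature slot and a
  derivative slot give a divergence of the curvature; two derivative slots give the wave
  operator.\<close>

lemma RD_trace_lin_exact:
  assumes ab: "a < b" "b < 4 + n" and idx: "valid_idx (4 + n) idx"
  shows "tr (\<lambda>i. RD (idx[a := i, b := i])) \<in> lin_exact"
proof -
  obtain x0 x1 x2 x3 ns where idx_eq: "idx = x0 # x1 # x2 # x3 # ns"
    using idx by (auto simp: valid_idx_def length_Suc_conv numeral_eq_Suc)
  have x: "x0 < 4" "x1 < 4" "x2 < 4" "x3 < 4" and ns: "set ns \<subseteq> {..<4}" "length ns = n"
    using idx by (auto simp: idx_eq valid_idx_def)
  have RD: "RD (y0 # y1 # y2 # y3 # ms) = foldr dmu ms (Riem y0 y1 y2 y3)" for y0 y1 y2 y3 ms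
    by (simp add: RD_def numeral_eq_Suc One_nat_def)
  have tr0: "tr (\<lambda>i. Riem i i r s) = 0" "tr (\<lambda>i. Riem r s i i) = 0" if "r < 4" "s < 4" for r s
  proof -
    have "tr (\<lambda>i. Riem i i r s) = tr (\<lambda>i. 0)" "tr (\<lambda>i. Riem r s i i) = tr (\<lambda>i. 0)"
      using that by (auto intro!: tr_cong simp: Riem_eq)
    then show "tr (\<lambda>i. Riem i i r s) = 0" "tr (\<lambda>i. Riem r s i i) = 0" by (simp_all add: tr_def)
  qed
  have R03: "tr (\<lambda>i. Riem i r s i) \<in> lin_exact" if "r < 4" "s < 4" for r s
  proof -
    have "tr (\<lambda>i. Riem i r s i) = - tr (\<lambda>i. Riem i r i s)"
      unfolding tr_minus[symmetric] using that by (intro tr_cong Riem_anti2)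
    then show ?thesis using lin_exact_neg[OF Ricci_lin_exact] that by simp
  qed
  have R12: "tr (\<lambda>i. Riem r i i s) \<in> lin_exact" if "r < 4" "s < 4" for r s
  proof -
    have "tr (\<lambda>i. Riem r i i s) = - tr (\<lambda>i. Riem i r i s)"
      unfolding tr_minus[symmetric] using that by (intro tr_cong Riem_anti1)
    then show ?thesis using lin_exact_neg[OF Ricci_lin_exact] that by simp
  qed
  have R13: "tr (\<lambda>i. Riem r i s i) \<in> lin_exact" if "r < 4" "s < 4" for r s
  proof -
    have "tr (\<lambda>i. Riem r i s i) = - tr (\<lambda>i. Riem r i i s)"
      unfolding tr_minus[symmetric] using that by (intro tr_cong Riem_anti2)
    then show ?thesis using lin_exact_neg[OF R12] that by simp
  qed
  have D1: "tr (\<lambda>i. dmu i (Riem r i s t)) \<in> lin_exact" if "r < 4" "s < 4" "t < 4" for r s t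
  proof -
    have "tr (\<lambda>i. dmu i (Riem r i s t)) = - tr (\<lambda>i. dmu i (Riem i r s t))"
      unfolding tr_minus[symmetric] dmu_minus[symmetric] using that by (intro tr_cong arg_cong[of _ _ "dmu _"] Riem_anti1)
    then show ?thesis using lin_exact_neg[OF Riem_div1_lin_exact] that by simp
  qed
  have D3: "tr (\<lambda>i. dmu i (Riem r s t i)) \<in> lin_exact" if "r < 4" "s < 4" "t < 4" for r s t
  proof -
    have "tr (\<lambda>i. dmu i (Riem r s t i)) = - tr (\<lambda>i. dmu i (Riem r s i t))"
      unfolding tr_minus[symmetric] dmu_minus[symmetric] using that by (intro tr_cong arg_cong[of _ _ "dmu _"] Riem_anti2)
    then show ?thesis using lin_exact_neg[OF Riem_div2_lin_exact] that by simp
  qed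
  have RL: "Riem y0 y1 y2 y3 \<in> Lin" if "y0 < 4" "y1 < 4" "y2 < 4" "y3 < 4" for y0 y1 y2 y3
    using that by (rule Riem_Lin)
  let ?rest = "\<lambda>j. take j ns @ drop (Suc j) ns"
  have rest: "set (?rest j) \<subseteq> {..<4}" for j
    using ns(1) set_take_subset[of j ns] set_drop_subset[of "Suc j" ns] by auto
  consider "b < 4" | "a < 4" "4 \<le> b" | "4 \<le> a" by linarith
  then show ?thesis
  proof cases
    case 1
    then have "(a, b) \<in> {(0, 1), (0, 2), (0, 3), (1, 2), (1, 3), (2, 3)}" using ab(1) by auto
    then show ?thesis
      using x ns Ricci_lin_exact R03 R12 R13
      by (elim insertE emptyE; simp add: idx_eq RD tr_foldr lin_exact_foldr_dmu tr0 lin_exact_0 numeral_eq_Suc One_nat_def)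
  next
    case 2
    define j where "j = b - 4"
    have j: "j < length ns" using 2 ab ns by (simp add: j_def)
    have upd: "idx[a := i, b := i] = ([x0, x1, x2, x3][a := i]) @ ns[j := i]" for i
    proof -
      have "(xs @ ns)[a := i, b := i] = xs[a := i] @ ns[j := i]" if "length xs = 4" for xs
        using 2 that by (simp add: list_update_append j_def)
      from this[of "[x0, x1, x2, x3]"] show ?thesis by (simp add: idx_eq)
    qed
    have "a = 0 \<or> a = 1 \<or> a = 2 \<or> a = 3" using 2 by auto
    then have "tr (\<lambda>i. RD (idx[a := i, b := i])) \<in> lin_exact"
    proof (elim disjE)
      assume a: "a = 0"
      have "tr (\<lambda>i. RD (idx[a := i, b := i])) = tr (\<lambda>i. foldr dmu (?rest j) (dmu i (Riem i x1 x2 x3)))"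
        by (rule tr_cong) (use x ns j a in \<open>simp add: upd[unfolded a] RD foldr_dmu_update RL\<close>)
      then show ?thesis using x rest by (simp only: tr_foldr) (intro lin_exact_foldr_dmu Riem_div1_lin_exact)
    next
      assume a: "a = 1"
      have "tr (\<lambda>i. RD (idx[a := i, b := i])) = tr (\<lambda>i. foldr dmu (?rest j) (dmu i (Riem x0 i x2 x3)))"
        by (rule tr_cong) (use x ns j a in \<open>simp add: upd[unfolded a One_nat_def] RD foldr_dmu_update RL One_nat_def\<close>)
      then show ?thesis using x rest by (simp only: tr_foldr) (intro lin_exact_foldr_dmu D1)
    next
      assume a: "a = 2"
      have "tr (\<lambda>i. RD (idx[a := i, b := i])) = tr (\<lambda>i. foldr dmu (?rest j) (dmu i (Riem x0 x1 i x3)))"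
        by (rule tr_cong) (use x ns j a in \<open>simp add: upd[unfolded a numeral_2_eq_2] RD foldr_dmu_update RL numeral_2_eq_2\<close>)
      then show ?thesis using x rest by (simp only: tr_foldr) (intro lin_exact_foldr_dmu Riem_div2_lin_exact)
    next
      assume a: "a = 3"
      have "tr (\<lambda>i. RD (idx[a := i, b := i])) = tr (\<lambda>i. foldr dmu (?rest j) (dmu i (Riem x0 x1 x2 i)))"
        by (rule tr_cong) (use x ns j a in \<open>simp add: upd[unfolded a numeral_3_eq_3] RD foldr_dmu_update RL numeral_3_eq_3\<close>)
      then show ?thesis using x rest by (simp only: tr_foldr) (intro lin_exact_foldr_dmu D3)
    qed
    then show ?thesis .
  next
    case 3
    define j where "j = b - 4"
    define l where "l = a - 4"
    have lj: "l < j" "j < length ns" using 3 ab ns by (simp_all add: j_def l_def)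
    have upd: "idx[a := i, b := i] = [x0, x1, x2, x3] @ ns[l := i, j := i]" for i
    proof -
      have "(xs @ ns)[a := i, b := i] = xs @ ns[l := i, j := i]" if "length xs = 4" for xs
        using 3 ab that by (simp add: list_update_append j_def l_def)
      from this[of "[x0, x1, x2, x3]"] show ?thesis by (simp add: idx_eq)
    qed
    \<comment> \<open>The later slot \<open>j\<close> is removed first, so that slot
      \<open>l\<close> keeps its position.\<close>
    have r: "take j (ns[l := i]) @ drop (Suc j) (ns[l := i]) = (?rest j)[l := i]" for i
      using lj by (simp add: take_update_swap list_update_append)
    have s: "set (ns[l := i]) \<subseteq> {..<4}" if "i < 4" for i
      using ns(1) that set_update_subset_insert[of ns l i] by auto
    have lr: "l < length (?rest j)" using lj by simp
    let ?rr = "take l (?rest j) @ drop (Suc l) (?rest j)"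
    have eq: "foldr dmu (ns[l := i, j := i]) p = foldr dmu ?rr (dmu i (dmu i p))" if "i < 4" "p \<in> Lin" for i p
    proof -
      have "foldr dmu (ns[l := i, j := i]) p = foldr dmu ((?rest j)[l := i]) (dmu i p)"
        unfolding r[symmetric] by (rule foldr_dmu_update) (use that s lj in auto)
      also have "\<dots> = foldr dmu ?rr (dmu i (dmu i p))"
        by (rule foldr_dmu_update[OF dmu_LinF[OF that(2,1)] that(1) rest lr])
      finally show ?thesis .
    qed
    have "tr (\<lambda>i. RD (idx[a := i, b := i])) = tr (\<lambda>i. foldr dmu ?rr (dmu i (dmu i (Riem x0 x1 x2 x3))))"
      by (rule tr_cong) (use x in \<open>simp add: upd RD eq RL\<close>)
    also have "\<dots> = foldr dmu ?rr 0" using x by (simp only: tr_foldr tr_box RL)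
    also have "foldr dmu ms 0 = 0" for ms by (induction ms) simp_all
    finally show ?thesis by (simp add: lin_exact_0)
  qed
qed

lemma R0_RD:
  assumes "valid_idx (4 + n) idx"
  shows "RD idx - R0 n idx \<in> lin_exact"
proof -
  let ?t = "\<lambda>idx. if valid_idx (4 + n) idx then RD idx else 0"
  have "?t idx - traceless_part (4 + n) ?t idx \<in> lin_exact"
  proof (rule traceless_part_mod[OF _ lin_exact_subspace _ assms])
    fix a b idx assume *: "a < b" "b < 4 + n" "valid_idx (4 + n) idx"
    have "(\<Sum>i<4. smult (eta i i) (?t (idx[a := i, b := i]))) = tr (\<lambda>i. RD (idx[a := i, b := i]))"
      unfolding tr_def by (intro sum.cong refl) (simp add: valid_idx_update *)
    then show "(\<Sum>i<4. smult (eta i i) (?t (idx[a := i, b := i]))) \<in> lin_exact"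
      using RD_trace_lin_exact[OF *] by simp
  qed simp
  then show ?thesis using assms by (simp add: R0_def)
qed

subsection \<open>Symbols of linear elements\<close>

declare single_numeral [simp del] single_one [simp del]

type_synonym sym = "(nat \<Rightarrow>\<^sub>0 nat) \<Rightarrow>\<^sub>0 complex"

text \<open>A symbol is read as a differential operator with constant coefficients: on linear
  elements \<open>xi i\<close> acts as \<open>dmu i\<close>, and the commutative product of symbols
  is composition.\<close>

definition act :: "sym \<Rightarrow> poly \<Rightarrow> poly" where
  "act s x = lext (\<lambda>c a. smult a (Ds (lk c) x)) s"

definition xi :: "nat \<Rightarrow> sym" where "xi i = sg (sg i 1) 1"

definition sym_const :: "complex \<Rightarrow> sym" where "sym_const a = sg 0 a"

definition xi2 :: sym where "xi2 = (\<Sum>i<4. sym_const (eta i i) * (xi i * xi i))"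

lemma act_add_left: "act (s + t) x = act s x + act t x"
  unfolding act_def by (rule lext_add) (auto simp: PV.scale_left_distrib)

lemma act_single: "act (sg c a) x = smult a (Ds (lk c) x)"
  by (simp add: act_def)

lemmas act_0_left [simp] = additive_0[of "\<lambda>s. act s x" for x, OF act_add_left]
lemmas act_sum_left = additive_sum[of "\<lambda>s. act s x" for x, OF act_add_left]
lemmas act_diff_left = additive_diff[of "\<lambda>s. act s x" for x, OF act_add_left]
lemmas act_minus_left = additive_minus[of "\<lambda>s. act s x" for x, OF act_add_left]

lemma act_add_right: "act s (x + y) = act s x + act s y"
  by (simp add: act_def lext_def Ds_add PV.scale_right_distrib sum.distrib)

lemmas act_0_right [simp] = additive_0[of "act s" for s, OF act_add_right]
lemmas act_sum_right = additive_sum[of "act s" for s, OF act_add_right]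
lemmas act_diff_right = additive_diff[of "act s" for s, OF act_add_right]
lemmas act_minus_right = additive_minus[of "act s" for s, OF act_add_right]

lemma act_smult_right: "act s (smult a x) = smult a (act s x)"
  by (simp add: act_def lext_def Ds_smult PV.scale_sum_right mult.commute)

lemma act_sym_const: "act (sym_const a * s) x = smult a (act s x)"
proof (induction s rule: poly_mapping_induct_add)
  case (single c b) then show ?case by (simp add: sym_const_def mult_single act_single)
qed (simp_all add: act_add_left distrib_left PV.scale_right_distrib)

lemma act_LinF: "x \<in> LinF X \<Longrightarrow> act s x \<in> LinF X"
  unfolding act_def lext_def by (intro LinF_intros Ds_LinF)

lemma act_xi:
  assumes "x \<in> Lin" "i < 4"
  shows "act (xi i * s) x = act s (dmu i x)"
proof (induction s rule: poly_mapping_induct_add)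
  case (single c b)
  have "lk (sg i 1 + c) = (lk c)(i := Suc (lk c i))"
    by (rule ext) (simp add: lookup_add lookup_single)
  then show ?case using assms by (simp add: xi_def mult_single act_single Ds_Suc dmu_Ds)
qed (simp_all add: act_add_left distrib_left)

lemma dQ_act: "x \<in> Lin \<Longrightarrow> dQ (act s x) = act s (dQ x)"
  by (simp add: act_def lext_def dQ_sum dQ_smult dQ_Ds)

lemma act_lin_exact: "x \<in> lin_exact \<Longrightarrow> act s x \<in> lin_exact"
  unfolding act_def lext_def by (intro lin_exact_sum lin_exact_smult lin_exact_Ds)

lemma act_xi2:
  assumes "x \<in> Lin"
  shows "act (xi2 * s) x = 0"
proof -
  have "act (xi2 * s) x = (\<Sum>i<4. smult (eta i i) (act s (dmu i (dmu i x))))"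
    unfolding xi2_def sum_distrib_right act_sum_left
    by (intro sum.cong refl) (simp add: mult.assoc act_sym_const act_xi assms dmu_LinF)
  also have "\<dots> = act s (\<Sum>i<4. smult (eta i i) (dmu i (dmu i x)))"
    by (simp add: act_sum_right act_smult_right)
  finally show ?thesis using wave_eta[OF assms] by simp
qed

text \<open>The type of symbols has a variable for every natural number; only \<open>\<xi>\<^sub>0, \<dots>, \<xi>\<^sub>3\<close> act
  as derivatives.\<close>

definition S4 :: "sym set" where "S4 = {s. \<forall>c\<in>ks s. ks c \<subseteq> {..<4}}"

text \<open>These are the normal forms modulo \<open>xi2\<close> that match the chosen basis of
  jets, in which a time derivative occurs at most once.\<close>

definition reduced :: "sym set" where "reduced = {s \<in> S4. \<forall>c\<in>ks s. lk c 0 \<le> 1}"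

lemma S4_0 [simp]: "0 \<in> S4" by (simp add: S4_def)
lemma S4_add: "s \<in> S4 \<Longrightarrow> t \<in> S4 \<Longrightarrow> s + t \<in> S4"
  using keys_add[of s t] by (auto simp: S4_def)
lemma S4_minus: "s \<in> S4 \<Longrightarrow> - s \<in> S4" by (simp add: S4_def)
lemma S4_diff: "s \<in> S4 \<Longrightarrow> t \<in> S4 \<Longrightarrow> s - t \<in> S4"
  using S4_add[of s "-t"] S4_minus[of t] by simp
lemma S4_sum: "(\<And>i. i \<in> A \<Longrightarrow> f i \<in> S4) \<Longrightarrow> sum f A \<in> S4"
  by (induction A rule: infinite_finite_induct) (auto intro: S4_add)
lemma S4_mult:
  assumes "s \<in> S4" "t \<in> S4" shows "s * t \<in> S4"
proof -
  have "ks (a + b) \<subseteq> {..<4}" if "a \<in> ks s" "b \<in> ks t" for a b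
    using assms that keys_add[of a b] unfolding S4_def by blast
  then show ?thesis using keys_mult[of s t] unfolding S4_def by blast
qed
lemma S4_sym_const: "sym_const a \<in> S4" by (auto simp: S4_def sym_const_def)
lemma S4_xi: "i < 4 \<Longrightarrow> xi i \<in> S4" by (auto simp: S4_def xi_def)
lemmas S4_intros = S4_0 S4_add S4_diff S4_sum S4_mult S4_sym_const S4_xi

lemma reduced_0 [simp]: "0 \<in> reduced" by (simp add: reduced_def)
lemma reduced_add: "s \<in> reduced \<Longrightarrow> t \<in> reduced \<Longrightarrow> s + t \<in> reduced"
  using keys_add[of s t] by (auto simp: reduced_def intro: S4_add)
lemma reduced_sym_const: "s \<in> reduced \<Longrightarrow> sym_const a * s \<in> reduced"
proof -
  assume s: "s \<in> reduced"
  then have "sym_const a * s \<in> S4" by (auto simp: reduced_def intro: S4_intros)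
  moreover have "lk c 0 \<le> 1" if "c \<in> ks (sym_const a * s)" for c
    using s that keys_mult[of "sym_const a" s] by (auto simp: reduced_def sym_const_def split: if_splits)
  ultimately show ?thesis by (simp add: reduced_def)
qed
lemma reduced_xi: "s \<in> reduced \<Longrightarrow> 0 < i \<Longrightarrow> i < 4 \<Longrightarrow> xi i * s \<in> reduced"
proof -
  assume s: "s \<in> reduced" and i: "0 < i" "i < 4"
  then have "xi i * s \<in> S4" by (auto simp: reduced_def intro: S4_intros)
  moreover have "lk c 0 \<le> 1" if "c \<in> ks (xi i * s)" for c
    using s i that keys_mult[of "xi i" s] by (auto simp: reduced_def xi_def lookup_add lookup_single)
  ultimately show ?thesis by (simp add: reduced_def)
qed

lemma sym_const_add: "sym_const (a + b) = sym_const a + sym_const b" by (simp add: sym_const_def single_add)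
lemma sym_const_1 [simp]: "sym_const 1 = 1" by (simp add: sym_const_def single_one)
lemma sym_const_0 [simp]: "sym_const 0 = 0" by (simp add: sym_const_def)
lemma sym_const_minus: "sym_const (- a) = - sym_const a" by (simp add: sym_const_def single_uminus)

lemma xi2_expand: "xi2 = xi 0 * xi 0 - xi 1 * xi 1 - xi 2 * xi 2 - xi 3 * xi 3"
  by (simp add: xi2_def sum_4 eta_def sym_const_minus)

lemma xi_xi_single: "xi i * xi i * sg c a = sg (sg i 2 + c) a"
  by (simp add: xi_def mult_single flip: single_add add.assoc)

text \<open>Modulo \<open>xi2\<close> the square of \<open>xi 0\<close> may be traded for the sum of
  the other three squares, which lowers the exponent of \<open>xi 0\<close> by 2.\<close>

lemma reduction_single:
  assumes "ks c \<subseteq> {..<4}"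
  shows "\<exists>g. \<exists>r\<in>reduced. sg c a = xi2 * g + r"
  using assms
proof (induction "lk c 0" arbitrary: c rule: less_induct)
  case less
  show ?case
  proof (cases "lk c 0 \<le> 1")
    case True
    then have "sg c a \<in> reduced" using less.prems by (auto simp: reduced_def S4_def)
    then show ?thesis by (intro exI[of _ 0] bexI[of _ "sg c a"]) auto
  next
    case False
    define d where "d = c - sg 0 2"
    have c: "c = sg 0 2 + d"
      using False by (intro poly_mapping_eqI) (auto simp: d_def lookup_add lookup_minus lookup_single when_def)
    have d0: "lk (sg i 2 + d) 0 < lk c 0" if "i > 0" for i
      using that unfolding c by (simp add: lookup_add lookup_single)
    have dk: "ks (sg i 2 + d) \<subseteq> {..<4}" if "i < 4" for i
    proof -
      have "ks (sg i 2 + d) \<subseteq> insert i (ks c)"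
        by (auto simp: in_keys_iff d_def lookup_add lookup_minus lookup_single when_def split: if_splits)
      then show ?thesis using that less.prems by blast
    qed
    obtain g1 r1 where 1: "r1 \<in> reduced" "sg (sg 1 2 + d) a = xi2 * g1 + r1"
      using less.hyps[OF d0 dk, of 1] by auto
    obtain g2 r2 where 2: "r2 \<in> reduced" "sg (sg 2 2 + d) a = xi2 * g2 + r2"
      using less.hyps[OF d0 dk, of 2] by auto
    obtain g3 r3 where 3: "r3 \<in> reduced" "sg (sg 3 2 + d) a = xi2 * g3 + r3"
      using less.hyps[OF d0 dk, of 3] by auto
    have "sg c a = xi2 * sg d a + sg (sg 1 2 + d) a + sg (sg 2 2 + d) a + sg (sg 3 2 + d) a"
      unfolding xi2_expand c by (simp only: left_diff_distrib xi_xi_single) simp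
    also have "\<dots> = xi2 * (sg d a + g1 + g2 + g3) + (r1 + r2 + r3)"
      unfolding 1 2 3 by (simp add: algebra_simps)
    finally show ?thesis using 1 2 3 reduced_add by blast
  qed
qed

lemma reduction:
  assumes "s \<in> S4"
  obtains g r where "r \<in> reduced" "s = xi2 * g + r"
proof -
  have "\<exists>g. \<exists>r\<in>reduced. s = xi2 * g + r"
  proof (induction s rule: poly_mapping_induct_add)
    case zero then show ?case by (intro exI[of _ 0] bexI[of _ 0]) auto
  next
    case (single c a) then show ?case using assms by (intro reduction_single) (auto simp: S4_def)
  next
    case (add s t)
    then obtain g r g' r' where "s = xi2 * g + r" "t = xi2 * g' + r'" "r \<in> reduced" "r' \<in> reduced" by blast
    then have "s + t = xi2 * (g + g') + (r + r')" "r + r' \<in> reduced" by (auto simp: distrib_left intro: reduced_add)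
    then show ?case by blast
  qed
  then show ?thesis using that by blast
qed

definition exps :: "(nat \<Rightarrow>\<^sub>0 nat) \<Rightarrow> nat list" where "exps c = [lk c 0, lk c 1, lk c 2, lk c 3]"

lemma exps_inj:
  assumes "ks c \<subseteq> {..<4}" "ks d \<subseteq> {..<4}" "exps c = exps d"
  shows "c = d"
proof (rule poly_mapping_eqI)
  fix i
  show "lk c i = lk d i"
  proof (cases "i < 4")
    case True then show ?thesis using less_4_cases[OF True] assms(3) by (auto simp: exps_def)
  next
    case False
    then have "i \<notin> ks c" "i \<notin> ks d" using assms by auto
    then show ?thesis by (simp add: in_keys_iff)
  qed
qed

text \<open>A reduced symbol acts on an undifferentiated field without any substitution by the wave
  equation, so its coefficients reappear as coefficients of distinct jet variables.\<close>

lemma lookup_act_jet0: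
  assumes s: "s \<in> reduced" and d: "ks d \<subseteq> {..<4}"
  shows "lk (act s (jet0 f)) (sg (J f' (exps d)) 1) = (if f = f' then lk s d else 0)"
proof -
  have "act s (jet0 f) = (\<Sum>c\<in>ks s. smult (lk s c) (var (J f (exps c))))"
    unfolding act_def lext_def using s by (intro sum.cong refl) (auto simp: Ds_jet0 exps_def reduced_def)
  then have "lk (act s (jet0 f)) (sg (J f' (exps d)) 1) = (\<Sum>c\<in>ks s. lk s c * (if f = f' \<and> exps c = exps d then 1 else 0))"
    by (simp add: lookup_sum lookup_smult var_def mon_poly_def lookup_single when_def)
      (intro sum.cong refl, auto dest: arg_cong[of _ _ ks])
  also have "\<dots> = (\<Sum>c\<in>ks s. if c = d then (if f = f' then lk s d else 0) else 0)"
    using exps_inj[OF _ d] s by (intro sum.cong refl) (auto simp: reduced_def S4_def)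
  also have "\<dots> = (if f = f' then lk s d else 0)" by (auto simp: in_keys_iff)
  finally show ?thesis .
qed

lemma reduced_eqI:
  assumes "s \<in> S4" "\<And>d. ks d \<subseteq> {..<4} \<Longrightarrow> lk s d = 0"
  shows "s = 0"
proof (rule poly_mapping_eqI)
  fix d show "lk s d = lk 0 d"
  proof (cases "ks d \<subseteq> {..<4}")
    case False
    then have "d \<notin> ks s" using assms(1) unfolding S4_def by blast
    then show ?thesis by (simp add: in_keys_iff)
  qed (use assms(2) in simp)
qed

text \<open>Uniqueness of normal forms is borrowed from the jets: on a ghost a multiple of
  \<open>xi2\<close> acts as 0 by the wave equation, whereas the coefficients of a reduced symbol
  can be read off from its action.\<close>

lemma reduced_xi2:
  assumes "r \<in> reduced" "r = xi2 * g"
  shows "r = 0"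
proof (rule reduced_eqI)
  fix d :: "nat \<Rightarrow>\<^sub>0 nat" assume d: "ks d \<subseteq> {..<4}"
  have "act r (jet0 (U 0)) = 0" unfolding assms(2) by (rule act_xi2) (simp add: U_Lin)
  then show "lk r d = 0" using lookup_act_jet0[OF assms(1) d, of "U 0" "U 0"] by simp
qed (use assms in \<open>simp add: reduced_def\<close>)

lemma independent_U:
  assumes t: "\<And>a. a < 4 \<Longrightarrow> t a \<in> S4" and 0: "(\<Sum>a<4. act (t a) (jet0 (U a))) = 0" and a: "a < 4"
  obtains g where "t a = xi2 * g"
proof -
  have "\<exists>g r. a < 4 \<longrightarrow> r \<in> reduced \<and> t a = xi2 * g + r" for a using reduction[OF t, of a] by metis
  then obtain g r where gr: "\<And>a. a < 4 \<Longrightarrow> r a \<in> reduced" "\<And>a. a < 4 \<Longrightarrow> t a = xi2 * g a + r a" by metis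
  have "(\<Sum>a<4. act (t a) (jet0 (U a))) = (\<Sum>a<4. act (r a) (jet0 (U a)))"
    by (intro sum.cong refl) (simp add: gr act_add_left act_xi2 U_Lin)
  then have z: "(\<Sum>a<4. act (r a) (jet0 (U a))) = 0" using 0 by simp
  have "r a = 0"
  proof (rule reduced_eqI)
    fix d :: "nat \<Rightarrow>\<^sub>0 nat" assume d: "ks d \<subseteq> {..<4}"
    have "0 = lk (\<Sum>b<4. act (r b) (jet0 (U b))) (sg (J (U a) (exps d)) 1)" by (simp add: z)
    also have "\<dots> = (\<Sum>b<4. if b = a then lk (r a) d else 0)"
      unfolding lookup_sum by (intro sum.cong refl) (auto simp: lookup_act_jet0 gr d)
    finally show "lk (r a) d = 0" using a by simp
  qed (use gr a in \<open>simp add: reduced_def\<close>)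
  then have "t a = xi2 * g a" using gr(2)[OF a] by simp
  then show ?thesis by (rule that)
qed

text \<open>Since \<open>hh\<close> is symmetric, only the symmetrised symbols are determined by the
  sum. On the diagonal the two index pairs coincide, and the coefficient vanishes before it is
  doubled.\<close>

lemma independent_hh:
  assumes t: "\<And>a b. a < 4 \<Longrightarrow> b < 4 \<Longrightarrow> t a b \<in> S4" and 0: "(\<Sum>a<4. \<Sum>b<4. act (t a b) (hh a b)) = 0"
    and ab: "a < 4" "b < 4"
  obtains g where "t a b + t b a = xi2 * g"
proof -
  have "\<exists>g r. a < 4 \<and> b < 4 \<longrightarrow> r \<in> reduced \<and> t a b = xi2 * g + r" for a b using reduction[OF t, of a b] by metis
  then obtain g r where gr: "\<And>a b. a < 4 \<Longrightarrow> b < 4 \<Longrightarrow> r a b \<in> reduced"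
    "\<And>a b. a < 4 \<Longrightarrow> b < 4 \<Longrightarrow> t a b = xi2 * g a b + r a b" by metis
  have "(\<Sum>a<4. \<Sum>b<4. act (t a b) (hh a b)) = (\<Sum>a<4. \<Sum>b<4. act (r a b) (hh a b))"
    by (intro sum.cong refl) (simp add: gr act_add_left act_xi2 hh_Lin)
  then have z: "(\<Sum>a<4. \<Sum>b<4. act (r a b) (hh a b)) = 0" using 0 by simp
  have "r a b + r b a = 0"
  proof (rule reduced_eqI)
    fix d :: "nat \<Rightarrow>\<^sub>0 nat" assume d: "ks d \<subseteq> {..<4}"
    have "0 = lk (\<Sum>a'<4. \<Sum>b'<4. act (r a' b') (hh a' b')) (sg (J (H (min a b) (max a b)) (exps d)) 1)" by (simp add: z)
    also have "\<dots> = (\<Sum>a'<4. \<Sum>b'<4. if min a' b' = min a b \<and> max a' b' = max a b then lk (r a' b') d else 0)"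
      unfolding lookup_sum hh_def by (intro sum.cong refl) (auto simp: lookup_act_jet0 gr d)
    also have "\<dots> = (\<Sum>a'<4. \<Sum>b'<4. if a' = a \<and> b' = b \<or> a' = b \<and> b' = a then lk (r a' b') d else 0)"
      by (intro sum.cong refl if_cong) (auto simp: min_def max_def split: if_splits)
    also have "\<dots> = lk (r a b) d + (if a = b then 0 else lk (r b a) d)"
      using less_4_cases[OF ab(1)] less_4_cases[OF ab(2)] by (elim disjE) (simp_all add: sum_4)
    finally show "lk (r a b + r b a) d = 0" by (auto simp: lookup_add split: if_splits)
  qed (use gr ab in \<open>auto simp: reduced_def intro: S4_add\<close>)
  then have "t a b + t b a = xi2 * (g a b + g b a)"
    using ab by (simp add: gr distrib_left add_eq_0_iff)
  then show ?thesis using that by blast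
qed

lemma symbol_representation:
  assumes "v \<in> Lin"
  shows "\<exists>k t s. (\<forall>a b. k a b \<in> reduced) \<and> (\<forall>a. t a \<in> reduced) \<and> (\<forall>a. s a \<in> reduced) \<and>
    v = (\<Sum>a<4. \<Sum>b<4. act (k a b) (hh a b)) + (\<Sum>a<4. act (t a) (jet0 (U a))) + (\<Sum>a<4. act (s a) (jet0 (Ut a)))"
  using assms
proof (induction rule: LinF_induct)
  case zero
  show ?case by (intro exI[of _ "\<lambda>_ _. 0"] exI[of _ "\<lambda>_. 0"]) simp
next
  case (var f c)
  obtain x y z w where c: "c = [x, y, z, w]" using var(2) list_4[of c] by auto
  define m :: "nat \<Rightarrow>\<^sub>0 nat" where "m = sg 0 x + sg 1 y + sg 2 z + sg 3 w"
  have m: "lk m 0 = x" "lk m 1 = y" "lk m 2 = z" "lk m 3 = w" by (simp_all add: m_def lookup_add lookup_single)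
  have km: "ks m \<subseteq> {..<4}" by (auto simp: m_def in_keys_iff lookup_add lookup_single when_def split: if_splits)
  have red: "sg m 1 \<in> reduced" using km m var(2) c by (auto simp: reduced_def S4_def)
  have a: "act (sg m 1) (jet0 f) = var (J f c)" using var(2) c m by (simp add: act_single Ds_jet0)
  show ?case
  proof (cases f)
    case (H a b)
    then have ab: "a \<le> b" "a < 4" "b < 4" using var(2) by auto
    have "(\<Sum>a'<4. \<Sum>b'<4. act (if a' = a \<and> b' = b then sg m 1 else 0) (hh a' b')) =
      (\<Sum>a'<4. if a' = a then (\<Sum>b'<4. if b' = b then act (sg m 1) (hh a b) else 0) else 0)"
      using ab by (intro sum.cong refl) (auto simp: if_distrib[of "\<lambda>s. act s _"] cong: if_cong)
    also have "\<dots> = var (J f c)" using ab a H by (simp add: hh_def min_def max_def)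
    finally show ?thesis using red
      by (intro exI[of _ "\<lambda>a' b'. if a' = a \<and> b' = b then sg m 1 else 0"] exI[of _ "\<lambda>_. 0"]) simp
  next
    case (U a)
    then have "a < 4" using var(2) by auto
    have "(\<Sum>a'<4. act (if a' = a then sg m 1 else 0) (jet0 (U a'))) = (\<Sum>a'<4. if a' = a then act (sg m 1) (jet0 (U a)) else 0)"
      by (intro sum.cong refl) auto
    also have "\<dots> = var (J f c)" using a U \<open>a < 4\<close> by simp
    finally show ?thesis using red
      by (intro exI[of _ "\<lambda>_ _. 0"] exI[of _ "\<lambda>a'. if a' = a then sg m 1 else 0"] exI[of _ "\<lambda>_. 0"]) simp
  next
    case (Ut a)
    then have "a < 4" using var(2) by auto
    have "(\<Sum>a'<4. act (if a' = a then sg m 1 else 0) (jet0 (Ut a'))) = (\<Sum>a'<4. if a' = a then act (sg m 1) (jet0 (Ut a)) else 0)"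
      by (intro sum.cong refl) auto
    also have "\<dots> = var (J f c)" using a Ut \<open>a < 4\<close> by simp
    finally show ?thesis using red
      by (intro exI[of _ "\<lambda>_ _. 0"] exI[of _ "\<lambda>_. 0"] exI[of _ "\<lambda>a'. if a' = a then sg m 1 else 0"]) simp
  qed
next
  case (smult c p)
  then obtain k t s where *: "\<forall>a b. k a b \<in> reduced" "\<forall>a. t a \<in> reduced" "\<forall>a. s a \<in> reduced"
    "p = (\<Sum>a<4. \<Sum>b<4. act (k a b) (hh a b)) + (\<Sum>a<4. act (t a) (jet0 (U a))) + (\<Sum>a<4. act (s a) (jet0 (Ut a)))" by blast
  show ?case
    by (intro exI[of _ "\<lambda>a b. sym_const c * k a b"] exI[of _ "\<lambda>a. sym_const c * t a"] exI[of _ "\<lambda>a. sym_const c * s a"])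
      (simp add: * reduced_sym_const act_sym_const PV.scale_sum_right PV.scale_right_distrib)
next
  case (add p p')
  then obtain k t s k' t' s' where *: "\<forall>a b. k a b \<in> reduced" "\<forall>a. t a \<in> reduced" "\<forall>a. s a \<in> reduced"
    "p = (\<Sum>a<4. \<Sum>b<4. act (k a b) (hh a b)) + (\<Sum>a<4. act (t a) (jet0 (U a))) + (\<Sum>a<4. act (s a) (jet0 (Ut a)))"
    "\<forall>a b. k' a b \<in> reduced" "\<forall>a. t' a \<in> reduced" "\<forall>a. s' a \<in> reduced"
    "p' = (\<Sum>a<4. \<Sum>b<4. act (k' a b) (hh a b)) + (\<Sum>a<4. act (t' a) (jet0 (U a))) + (\<Sum>a<4. act (s' a) (jet0 (Ut a)))"
    by blast
  show ?case
    by (intro exI[of _ "\<lambda>a b. k a b + k' a b"] exI[of _ "\<lambda>a. t a + t' a"] exI[of _ "\<lambda>a. s a + s' a"])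
      (simp add: * reduced_add act_add_left sum.distrib)
qed

section \<open>The Koszul homotopy on symbols\<close>

definition pd :: "nat \<Rightarrow> sym \<Rightarrow> sym" where
  "pd i s = lext (\<lambda>c a. sg (c - sg i 1) (of_nat (lk c i) * a)) s"

definition deg4 :: "(nat \<Rightarrow>\<^sub>0 nat) \<Rightarrow> nat" where "deg4 c = (\<Sum>i<4. lk c i)"

text \<open>Weights depending on the degree let the homotopy divide by degree-dependent constants
  without splitting a symbol into homogeneous parts.\<close>

definition wscale :: "(nat \<Rightarrow> complex) \<Rightarrow> sym \<Rightarrow> sym" where
  "wscale w s = lext (\<lambda>c a. sg c (w (deg4 c) * a)) s"

lemma pd_add: "pd i (s + t) = pd i s + pd i t"
  unfolding pd_def by (rule lext_add) (auto simp: single_add[symmetric] distrib_left)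
lemma wscale_add: "wscale w (s + t) = wscale w s + wscale w t"
  unfolding wscale_def by (rule lext_add) (auto simp: single_add[symmetric] distrib_left)

lemma pd_single: "pd i (sg c a) = sg (c - sg i 1) (of_nat (lk c i) * a)" by (simp add: pd_def)
lemma wscale_single: "wscale w (sg c a) = sg c (w (deg4 c) * a)" by (simp add: wscale_def)

lemmas pd_0 [simp] = additive_0[of "pd i" for i, OF pd_add]
lemmas pd_sum = additive_sum[of "pd i" for i, OF pd_add]
lemmas wscale_0 [simp] = additive_0[of "wscale i" for i, OF wscale_add]
lemmas wscale_sum = additive_sum[of "wscale i" for i, OF wscale_add]
lemmas wscale_minus = additive_minus[of "wscale i" for i, OF wscale_add]
lemmas pd_minus = additive_minus[of "pd i" for i, OF pd_add]

lemma pd_xi: "pd i (xi j * s) = (if i = j then s else 0) + xi j * pd i s"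
proof (induction s rule: poly_mapping_induct_add)
  case (single c a)
  show ?case
  proof (cases "i = j")
    case True
    show ?thesis
    proof (cases "lk c i = 0")
      case True then show ?thesis using \<open>i = j\<close> by (simp add: xi_def mult_single pd_single lookup_add)
    next
      case False
      then have "sg i 1 + (c - sg i 1) = c"
        by (intro poly_mapping_eqI) (auto simp: lookup_add lookup_minus lookup_single when_def)
      then show ?thesis using \<open>i = j\<close>
        by (simp add: xi_def mult_single pd_single lookup_add distrib_right single_add)
    qed
  next
    case False
    then have "lk (sg j 1 + c) i = lk c i" by (simp add: lookup_add lookup_single)
    moreover have "lk c i \<noteq> 0 \<Longrightarrow> sg j 1 + c - sg i 1 = sg j 1 + (c - sg i 1)"
      using False by (intro poly_mapping_eqI) (auto simp: lookup_add lookup_minus lookup_single when_def)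
    ultimately show ?thesis using False
      by (cases "lk c i = 0") (simp_all add: xi_def mult_single pd_single)
  qed
qed (simp_all add: pd_add distrib_left)

lemma euler: "(\<Sum>i<4. xi i * pd i s) = wscale of_nat s"
proof (induction s rule: poly_mapping_induct_add)
  case (single c a)
  have "xi i * pd i (sg c a) = sg c (of_nat (lk c i) * a)" for i
  proof (cases "lk c i = 0")
    case False
    then have "sg i 1 + (c - sg i 1) = c"
      by (intro poly_mapping_eqI) (auto simp: lookup_add lookup_minus lookup_single when_def)
    then show ?thesis by (simp add: xi_def mult_single pd_single)
  qed (simp add: pd_single)
  then show ?case
    by (simp add: wscale_single deg4_def sum_4 single_add distrib_right)
qed (simp_all add: pd_add distrib_left sum.distrib wscale_add)

lemma wscale_xi: "i < 4 \<Longrightarrow> wscale w (xi i * s) = xi i * wscale (\<lambda>n. w (Suc n)) s"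
proof (induction s rule: poly_mapping_induct_add)
  case (single c a)
  have "deg4 (sg i 1 + c) = Suc (deg4 c)"
    using less_4_cases[OF single(2)] by (elim disjE) (simp_all add: deg4_def sum_4 lookup_add lookup_single)
  then show ?case by (simp add: xi_def mult_single wscale_single)
qed (simp_all add: wscale_add distrib_left)

lemma wscale_wscale: "wscale w (wscale v s) = wscale (\<lambda>n. w n * v n) s"
  by (induction s rule: poly_mapping_induct_add) (simp_all add: wscale_single wscale_add mult.assoc)

lemma wscale_1: "wscale (\<lambda>_. 1) s = s"
  by (induction s rule: poly_mapping_induct_add) (simp_all add: wscale_single wscale_add)

lemma wscale_plus_1: "wscale of_nat s + s = wscale (\<lambda>n. of_nat n + 1) s"
proof (induction s rule: poly_mapping_induct_add)
  case (single c a) then show ?case by (simp add: wscale_single distrib_right flip: single_add)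
next
  case (add p q)
  have "wscale of_nat (p + q) + (p + q) = (wscale of_nat p + p) + (wscale of_nat q + q)"
    by (simp add: wscale_add add_ac)
  then show ?case by (simp only: add wscale_add)
qed simp

text \<open>The Koszul homotopy. For \<open>f\<close> of degree \<open>d\<close> the derivatives
  have degree \<open>n = d - 1\<close>, so the weight is \<open>1 / (d + 1)\<close>, the inverse of
  the factor that arises in \<open>koszul\<close>.\<close>

definition curl :: "(nat \<Rightarrow> sym) \<Rightarrow> nat \<Rightarrow> nat \<Rightarrow> sym" where
  "curl f r m = wscale (\<lambda>n. 1 / (of_nat n + 2)) (pd r (f m) - pd m (f r))"

lemma curl_anti: "curl f r m = - curl f m r"
  unfolding curl_def wscale_minus[symmetric] by simp

lemma curl_minus: "curl (\<lambda>m. - f m) r m = - curl f r m"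
  unfolding curl_def wscale_minus[symmetric] by (simp add: pd_minus)

text \<open>In the contraction of \<open>xi\<close> with the unweighted curl, Euler's identity gives
  \<open>d\<close> times \<open>f m\<close>, and differentiating the divergence condition gives one
  more \<open>f m\<close>; \<open>curl\<close> divides by \<open>d + 1\<close>. No metric enters
  because \<open>f\<close> carries upper indices.\<close>

lemma koszul:
  assumes 0: "(\<Sum>r<4. xi r * f r) = 0" and m: "m < 4"
  shows "f m = (\<Sum>r<4. xi r * curl f r m)"
proof -
  have "(\<Sum>r<4. xi r * pd m (f r)) = (\<Sum>r<4. pd m (xi r * f r) - (if m = r then f r else 0))"
    by (simp add: pd_xi)
  also have "\<dots> = pd m (\<Sum>r<4. xi r * f r) - f m" using m by (simp add: sum_subtractf pd_sum)
  finally have 1: "(\<Sum>r<4. xi r * pd m (f r)) = - f m" by (simp add: 0)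
  let ?w = "\<lambda>n. 1 / (of_nat n + 1) :: complex"
  have "(\<Sum>r<4. xi r * curl f r m) = (\<Sum>r<4. wscale ?w (xi r * (pd r (f m) - pd m (f r))))"
    by (intro sum.cong refl) (simp add: wscale_xi curl_def add.commute)
  also have "\<dots> = wscale ?w (\<Sum>r<4. xi r * (pd r (f m) - pd m (f r)))" by (simp add: wscale_sum)
  also have "(\<Sum>r<4. xi r * (pd r (f m) - pd m (f r))) = wscale of_nat (f m) + f m"
    by (simp add: right_diff_distrib sum_subtractf euler 1)
  also have "wscale ?w (wscale of_nat (f m) + f m) = f m"
  proof -
    have "(of_nat n + 1 :: complex) \<noteq> 0" for n by (metis of_nat_Suc of_nat_neq_0 add.commute)
    then show ?thesis by (simp add: wscale_plus_1 wscale_wscale wscale_1)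
  qed
  finally show ?thesis by simp
qed

text \<open>The homotopy is applied to the first index and then to the second. The intermediate curl
  stays divergence-free in the second index: its two terms contribute \<open>- f m r\<close> and
  \<open>- f r m\<close>, which cancel by symmetry.\<close>

lemma double_curl:
  assumes sym: "\<And>a b. f a b = f b a" and 0: "\<And>b. b < 4 \<Longrightarrow> (\<Sum>a<4. xi a * f a b) = 0"
  obtains F where "\<And>r m s n. F r m s n = - F m r s n" "\<And>r m s n. F r m s n = - F r m n s"
    "\<And>m n. m < 4 \<Longrightarrow> n < 4 \<Longrightarrow> f m n = (\<Sum>r<4. \<Sum>s<4. xi r * (xi s * F r m s n))"
proof -
  define A where "A r m n = curl (\<lambda>a. f a n) r m" for r m n
  define F where "F r m s n = curl (A r m) s n" for r m s n
  have A: "f m n = (\<Sum>r<4. xi r * A r m n)" if "m < 4" "n < 4" for m n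
    unfolding A_def by (rule koszul) (use that 0 in auto)
  have z: "(\<Sum>n<4. xi n * A r m n) = 0" if "r < 4" "m < 4" for r m
  proof -
    let ?w = "\<lambda>n. 1 / (of_nat n + 1) :: complex"
    have p: "(\<Sum>n<4. xi n * pd r (f m n)) = - f m r" if "r < 4" "m < 4" for r m
    proof -
      have "(\<Sum>n<4. xi n * pd r (f m n)) = (\<Sum>n<4. pd r (xi n * f m n) - (if r = n then f m n else 0))"
        by (simp add: pd_xi)
      also have "\<dots> = pd r (\<Sum>n<4. xi n * f n m) - f m r" using that by (simp add: sum_subtractf pd_sum sym[of m])
      finally show ?thesis using 0[OF that(2)] by simp
    qed
    have "(\<Sum>n<4. xi n * A r m n) = (\<Sum>n<4. wscale ?w (xi n * (pd r (f m n) - pd m (f r n))))"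
      by (intro sum.cong refl) (simp add: wscale_xi A_def curl_def add.commute)
    also have "\<dots> = wscale ?w ((\<Sum>n<4. xi n * pd r (f m n)) - (\<Sum>n<4. xi n * pd m (f r n)))"
      by (simp add: right_diff_distrib sum_subtractf flip: wscale_sum)
    also have "\<dots> = 0" using that by (simp add: p sym[of m r])
    finally show ?thesis .
  qed
  show ?thesis
  proof (rule that[of F])
    fix r m s n
    have "A r m = (\<lambda>n. - A m r n)" by (rule ext) (simp add: A_def curl_anti[of _ r m])
    then show "F r m s n = - F m r s n" by (simp add: F_def curl_minus)
    show "F r m s n = - F r m n s" unfolding F_def by (rule curl_anti)
  next
    fix m n :: nat assume mn: "m < 4" "n < 4"
    have "A r m n = (\<Sum>s<4. xi s * F r m s n)" if "r < 4" for r
      unfolding F_def by (rule koszul[OF z[OF that mn(1)] mn(2)])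
    then show "f m n = (\<Sum>r<4. \<Sum>s<4. xi r * (xi s * F r m s n))"
      using A[OF mn] by (simp add: sum_distrib_left)
  qed
qed

subsection \<open>The cohomology of linear elements\<close>

definition represented :: "poly set" where
  "represented = {w + b | w b. w \<in> PV.span R0_u_gens \<and> b \<in> lin_exact}"

lemma represented_subspace: "PV.subspace represented"
  unfolding represented_def by (rule PV.subspace_sums[OF PV.subspace_span lin_exact_subspace])

lemmas represented_add = PV.subspace_add[OF represented_subspace]
lemmas represented_smult = PV.subspace_scale[OF represented_subspace]
lemmas represented_sum = PV.subspace_sum[OF represented_subspace]

lemma represented_gen: "x \<in> R0_u_gens \<Longrightarrow> x \<in> represented"
  unfolding represented_def using PV.span_base lin_exact_0 by (metis (mono_tags, lifting) add.right_neutral mem_Collect_eq)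

lemma represented_lin_exact: "x \<in> lin_exact \<Longrightarrow> x \<in> represented"
  unfolding represented_def using PV.span_zero by (metis (mono_tags, lifting) add.left_neutral mem_Collect_eq)

lemma Ds_foldr: "\<exists>ns. set ns \<subseteq> {..<4} \<and> (\<forall>p. Ds c p = foldr dmu ns p)"
  by (rule exI[of _ "replicate (c 0) 0 @ replicate (c 1) 1 @ replicate (c 2) 2 @ replicate (c 3) 3"])
    (auto simp: Ds_def foldr_replicate)

section \<open>Jets of the ghosts\<close>

definition udiv :: poly where "udiv = (\<Sum>i<4. smult (eta i i) (dmu i (jet0 (U i))))"

lemma dQ_htr: "dQ htr = smult \<i> udiv"
proof -
  have e2: "(\<Sum>a<4. eta a a * eta a a) = 4" by (simp add: sum_4 eta_def)
  have "dQ htr = (\<Sum>a<4. smult (eta a a) (smult (- \<i> / 2) (dmu a (jet0 (U a)) + dmu a (jet0 (U a)) - smult (eta a a) udiv)))"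
    unfolding htr_def hjet_hh foldr_Nil id_apply
    by (simp only: dQ_sum dQ_smult) (intro sum.cong refl, simp only: dQ_hh lessThan_iff udiv_def)
  also have "\<dots> = smult (- \<i>) udiv - smult (- \<i> / 2 * (\<Sum>a<4. eta a a * eta a a)) udiv"
    by (rule poly_mapping_eqI)
      (simp only: udiv_def lookup_sum lookup_smult lookup_add lookup_minus sum_4, simp add: eta_def algebra_simps)
  also have "\<dots> = smult \<i> udiv"
    unfolding e2 by (rule poly_mapping_eqI) (simp add: lookup_smult lookup_minus)
  finally show ?thesis .
qed

text \<open>The metric term in \<open>dQ_hh\<close> is compensated by the variation of the trace, so
  that a symbol applied to \<open>hhat\<close> is tested for closedness by its divergence.\<close>

lemma dQ_hhat:
  assumes "a < 4" "b < 4"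
  shows "dQ (hhat a b) = smult (- \<i> / 2) (dmu a (jet0 (U b)) + dmu b (jet0 (U a)))"
  unfolding hhat_hh dQ_diff dQ_smult dQ_htr dQ_hh[OF assms, folded udiv_def]
  by (rule poly_mapping_eqI) (simp add: lookup_smult lookup_minus lookup_add algebra_simps)

lemma killing_lin_exact:
  assumes "a < 4" "b < 4"
  shows "dmu a (jet0 (U b)) + dmu b (jet0 (U a)) \<in> lin_exact"
proof -
  have "dmu a (jet0 (U b)) + dmu b (jet0 (U a)) = dQ (smult (2 * \<i>) (hhat a b))"
    unfolding dQ_smult dQ_hhat[OF assms] by simp
  moreover have "smult (2 * \<i>) (hhat a b) \<in> Lin" using assms by (intro LinF_smult hhat_Lin)
  ultimately show ?thesis unfolding lin_exact_def by (metis imageI)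
qed

text \<open>The antisymmetric part of the gradient of the ghost is \<open>uu\<close>, and the
  symmetric part is exact.\<close>

lemma U_first_represented:
  assumes "a < 4" "b < 4"
  shows "dmu a (jet0 (U b)) \<in> represented"
proof -
  have "uu a b \<in> R0_u_gens" using assms by (auto simp: R0_u_gens_def)
  moreover have "uu a b = smult (1/2) (dmu a (jet0 (U b)) - dmu b (jet0 (U a)))"
    by (simp add: uu_def jet_def)
  then have "dmu a (jet0 (U b)) = uu a b + smult (1/2) (dmu a (jet0 (U b)) + dmu b (jet0 (U a)))"
    by (intro poly_mapping_eqI) (simp only: lookup_smult lookup_add lookup_minus, simp add: field_simps)
  ultimately show ?thesis using killing_lin_exact[OF assms] by (metis represented_add represented_gen represented_lin_exact lin_exact_smult)
qed

text \<open>The second derivatives are symmetric in the first two indices and, modulo exact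
  elements, antisymmetric in the last two; these symmetries force zero. The alternating sum of three
  terms is the one that solves for Christoffel symbols.\<close>

lemma U_second_lin_exact:
  assumes "a < 4" "b < 4" "c < 4"
  shows "dmu a (dmu b (jet0 (U c))) \<in> lin_exact"
proof -
  let ?X = "\<lambda>a b c. dmu a (dmu b (jet0 (U c)))"
  have k: "?X a b c + ?X a c b \<in> lin_exact" if "a < 4" "b < 4" "c < 4" for a b c
    using lin_exact_dmu[OF killing_lin_exact[OF that(2,3)] that(1)] by (simp add: dmu_add)
  have s: "?X a b c = ?X b a c" if "a < 4" "b < 4" "c < 4" for a b c
    using that by (simp add: dmu_commute[of _ a b] U_Lin)
  have "smult (1/2) ((?X a b c + ?X a c b) - (?X c a b + ?X c b a) + (?X b c a + ?X b a c)) \<in> lin_exact"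
    using assms by (intro lin_exact_smult[OF lin_exact_add[OF lin_exact_diff[OF k k] k]])
  moreover have "smult (1/2) ((?X a b c + ?X a c b) - (?X c a b + ?X c b a) + (?X b c a + ?X b a c)) = ?X a b c"
    unfolding s[OF assms(3,1,2)] s[OF assms(3,2,1)] s[OF assms(2,1,3)]
    by (rule poly_mapping_eqI) (simp only: lookup_smult lookup_add lookup_minus, simp)
  ultimately show ?thesis by simp
qed

lemma U_represented:
  assumes "a < 4"
  shows "Ds c (jet0 (U a)) \<in> represented"
proof -
  obtain ns where ns: "set ns \<subseteq> {..<4}" "\<And>p. Ds c p = foldr dmu ns p" using Ds_foldr by blast
  have "foldr dmu ns (jet0 (U a)) \<in> represented"
  proof (cases ns)
    case Nil
    have "jet (U a) [] \<in> R0_u_gens" using assms by (auto simp: R0_u_gens_def)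
    then show ?thesis using represented_gen Nil by (simp add: jet_def)
  next
    case (Cons i ms)
    show ?thesis
    proof (cases ms)
      case Nil then show ?thesis using Cons ns U_first_represented assms by simp
    next
      case (Cons j ls)
      then have ij: "i < 4" "j < 4" "set ls \<subseteq> {..<4}" using ns \<open>ns = i # ms\<close> by auto
      have "foldr dmu ns (jet0 (U a)) = foldr dmu ls (dmu i (dmu j (jet0 (U a))))"
        using ij assms by (simp add: \<open>ns = i # ms\<close> Cons dmu_foldr U_Lin dmu_LinF)
      also have "\<dots> \<in> lin_exact" using ij assms by (intro lin_exact_foldr_dmu U_second_lin_exact)
      finally show ?thesis by (rule represented_lin_exact)
    qed
  qed
  then show ?thesis by (simp add: ns)
qed

lemma act_U_represented: "a < 4 \<Longrightarrow> act s (jet0 (U a)) \<in> represented"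
  unfolding act_def lext_def by (intro represented_sum represented_smult U_represented)

section \<open>Injectivity of the differential on antighosts\<close>

lemma single_eq_0_iff: "sg k c = 0 \<longleftrightarrow> c = 0"
  by (metis lookup_single_eq lookup_zero single_zero)

text \<open>The diagonal entries with \<open>a > 0\<close> come first: multiplication by
  \<open>xi a\<close> preserves normal forms, so divisibility by \<open>xi2\<close> means vanishing.
  Since \<open>xi 0 * s 0\<close> may fail to be reduced, \<open>s 0\<close> is obtained from the
  entry with indices 0 and 1, once \<open>s 1 = 0\<close> is known.\<close>

lemma antighost_injective:
  assumes s: "\<And>a. s a \<in> reduced" and 0: "dQ (\<Sum>a<4. act (s a) (jet0 (Ut a))) = 0" and a: "a < 4"
  shows "s a = 0"
proof -
  let ?m = "\<lambda>a b. sym_const (eta b b) * (xi b * s a)"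
  have S4s: "s a \<in> S4" for a using s by (auto simp: reduced_def)
  have "dQ (\<Sum>a<4. act (s a) (jet0 (Ut a))) = (\<Sum>a<4. act (s a) (smult \<i> (\<Sum>\<nu><4. smult (eta \<nu> \<nu>) (dmu \<nu> (hh a \<nu>)))))"
    unfolding dQ_sum by (intro sum.cong refl) (simp only: dQ_act Ut_Lin dQ_Ut lessThan_iff)
  also have "\<dots> = smult \<i> (\<Sum>a<4. \<Sum>b<4. act (?m a b) (hh a b))"
    by (simp add: act_smult_right act_sum_right act_sym_const act_xi hh_Lin PV.scale_sum_right)
  finally have z: "(\<Sum>a<4. \<Sum>b<4. act (?m a b) (hh a b)) = 0" using 0 by simp
  have m: "?m a b \<in> S4" if "a < 4" "b < 4" for a b using that S4s by (intro S4_intros)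
  have cancel: "s a = 0" if i: "0 < i" "i < 4" and e: "sym_const c * (xi i * s a) = xi2 * g" and c: "c \<noteq> 0" for a i c g
  proof -
    have "sym_const c * (xi i * s a) = 0" using reduced_xi2[OF _ e] reduced_sym_const reduced_xi s i by blast
    moreover have "sym_const c \<noteq> 0" "xi i \<noteq> 0" using c by (simp_all add: sym_const_def xi_def single_eq_0_iff)
    ultimately show ?thesis by simp
  qed
  have pos: "s a = 0" if pa: "0 < a" "a < 4" for a
  proof -
    obtain g where "?m a a + ?m a a = xi2 * g" by (rule independent_hh[OF m z pa(2,2)])
    then have "sym_const (2 * eta a a) * (xi a * s a) = xi2 * g" by (simp only: mult_2 sym_const_add distrib_right)
    then show ?thesis using that by (intro cancel[of a]) (auto simp: eta_def)
  qed
  have "s 0 = 0"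
  proof -
    obtain g where "?m 0 1 + ?m 1 0 = xi2 * g" by (rule independent_hh[OF m z, of 0 1]) auto
    then have "sym_const (eta 1 1) * (xi 1 * s 0) = xi2 * g" using pos[of 1] by simp
    then show ?thesis by (intro cancel[of 1]) (auto simp: eta_def)
  qed
  then show ?thesis using pos a by (cases "a = 0") auto
qed

section \<open>Jets of the graviton\<close>

lemma act_Riem_represented:
  assumes "m < 4" "n < 4" "r < 4" "s < 4"
  shows "act f (Riem m n r s) \<in> represented"
proof -
  have "Ds c (Riem m n r s) \<in> represented" for c
  proof -
    obtain ns where ns: "set ns \<subseteq> {..<4}" "\<And>p. Ds c p = foldr dmu ns p" using Ds_foldr by blast
    let ?idx = "m # n # r # s # ns"
    have v: "valid_idx (4 + length ns) ?idx" using ns assms by (auto simp: valid_idx_def)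
    then have "R0 (length ns) ?idx \<in> R0_u_gens" by (auto simp: R0_u_gens_def)
    moreover have "RD ?idx = (RD ?idx - R0 (length ns) ?idx) + R0 (length ns) ?idx" by simp
    ultimately have "RD ?idx \<in> represented" using R0_RD[OF v] by (metis represented_add represented_gen represented_lin_exact)
    then show ?thesis by (simp add: ns RD_def numeral_eq_Suc One_nat_def)
  qed
  then show ?thesis unfolding act_def lext_def by (intro represented_sum represented_smult)
qed

text \<open>In four dimensions trace reversal is an involution.\<close>

lemma hh_hhat:
  "hh a b = hhat a b - smult (eta a b / 2) (\<Sum>c<4. smult (eta c c) (hhat c c))"
  unfolding trace_hhat by (simp add: hhat_hh)

text \<open>The two antisymmetries of \<open>F\<close> act on the second derivatives of
  \<open>hhat\<close> that it is paired with. After renaming indices the four terms of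
  \<open>Riem\<close> contribute equally, whence the factor 1/4.\<close>

lemma divergence_free_represented:
  assumes sym: "\<And>a b. f a b = f b a" and 0: "\<And>b. b < 4 \<Longrightarrow> (\<Sum>a<4. xi a * f a b) = 0"
  shows "(\<Sum>a<4. \<Sum>b<4. act (f a b) (hhat a b)) \<in> represented"
proof -
  obtain F where F: "\<And>r m s n. F r m s n = - F m r s n" "\<And>r m s n. F r m s n = - F r m n s"
    "\<And>m n. m < 4 \<Longrightarrow> n < 4 \<Longrightarrow> f m n = (\<Sum>r<4. \<Sum>s<4. xi r * (xi s * F r m s n))"
    using double_curl[OF sym 0] by blast
  define X where "X r m s n = dmu s (dmu r (hhat m n))" for r m s n
  define S where "S G = (\<Sum>r<4. \<Sum>m<4. \<Sum>s<4. \<Sum>n<4. G r m s n :: poly)" for G :: "nat \<Rightarrow> nat \<Rightarrow> nat \<Rightarrow> nat \<Rightarrow> poly"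
  have swap1: "S G = S (\<lambda>r m s n. G m r s n)" for G
    unfolding S_def by (rule sum.swap)
  have swap2: "S G = S (\<lambda>r m s n. G r m n s)" for G
    unfolding S_def by (intro sum.cong refl sum.swap)
  have S_cong: "S G = S G'" if "\<And>r m s n. r < 4 \<Longrightarrow> m < 4 \<Longrightarrow> s < 4 \<Longrightarrow> n < 4 \<Longrightarrow> G r m s n = G' r m s n" for G G'
    unfolding S_def using that by simp
  have S_minus: "S (\<lambda>r m s n. - G r m s n) = - S G" for G
    unfolding S_def by (simp add: sum_negf)
  let ?T = "S (\<lambda>r m s n. act (F r m s n) (X r m s n))"
  have "(\<Sum>m<4. \<Sum>n<4. act (f m n) (hhat m n)) = (\<Sum>m<4. \<Sum>n<4. \<Sum>r<4. \<Sum>s<4. act (F r m s n) (X r m s n))"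
    by (intro sum.cong refl)
      (simp add: F(3) act_sum_left act_xi X_def dmu_LinF)
  also have "\<dots> = ?T"
  proof -
    have "(\<Sum>m<4. \<Sum>n<4. \<Sum>r<4. \<Sum>s<4. act (F r m s n) (X r m s n)) = (\<Sum>m<4. \<Sum>r<4. \<Sum>n<4. \<Sum>s<4. act (F r m s n) (X r m s n))"
      by (intro sum.cong refl sum.swap)
    also have "\<dots> = (\<Sum>r<4. \<Sum>m<4. \<Sum>n<4. \<Sum>s<4. act (F r m s n) (X r m s n))" by (rule sum.swap)
    also have "\<dots> = ?T" unfolding S_def by (intro sum.cong refl sum.swap)
    finally show ?thesis .
  qed
  finally have T: "(\<Sum>m<4. \<Sum>n<4. act (f m n) (hhat m n)) = ?T" .
  have T1: "S (\<lambda>r m s n. act (F r m s n) (X m r s n)) = - ?T"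
  proof -
    have "S (\<lambda>r m s n. act (F r m s n) (X m r s n)) = S (\<lambda>r m s n. act (F m r s n) (X r m s n))" by (rule swap1)
    also have "\<dots> = S (\<lambda>r m s n. - act (F r m s n) (X r m s n))"
      by (rule S_cong) (subst F(1), simp add: act_minus_left)
    finally show ?thesis by (simp only: S_minus)
  qed
  have T2: "S (\<lambda>r m s n. act (F r m s n) (X r m n s)) = - ?T"
  proof -
    have "S (\<lambda>r m s n. act (F r m s n) (X r m n s)) = S (\<lambda>r m s n. act (F r m n s) (X r m s n))" by (rule swap2)
    also have "\<dots> = S (\<lambda>r m s n. - act (F r m s n) (X r m s n))"
      by (rule S_cong) (subst F(2), simp add: act_minus_left)
    finally show ?thesis by (simp only: S_minus)
  qed
  have T12: "S (\<lambda>r m s n. act (F r m s n) (X m r n s)) = ?T"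
  proof -
    have "S (\<lambda>r m s n. act (F r m s n) (X m r n s)) = S (\<lambda>r m s n. act (F m r s n) (X r m n s))" by (rule swap1)
    also have "\<dots> = S (\<lambda>r m s n. - act (F r m s n) (X r m n s))"
      by (rule S_cong) (subst F(1), simp add: act_minus_left)
    also have "\<dots> = ?T" by (simp only: S_minus T2 minus_minus)
    finally show ?thesis .
  qed
  have "S (\<lambda>r m s n. act (F r m s n) (Riem m r s n)) =
    S (\<lambda>r m s n. act (F r m s n) (X r m s n) - act (F r m s n) (X m r s n) - act (F r m s n) (X r m n s) + act (F r m s n) (X m r n s))"
    by (rule S_cong) (simp add: Riem_eq X_def act_add_right act_diff_right)
  also have "\<dots> = ?T - S (\<lambda>r m s n. act (F r m s n) (X m r s n)) - S (\<lambda>r m s n. act (F r m s n) (X r m n s))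
      + S (\<lambda>r m s n. act (F r m s n) (X m r n s))"
    unfolding S_def by (simp only: sum.distrib sum_subtractf)
  also have "\<dots> = smult 4 ?T"
    unfolding T1 T2 T12 by (rule poly_mapping_eqI) (simp only: lookup_add lookup_minus lookup_uminus lookup_smult, simp)
  finally have "?T = smult (1/4) (S (\<lambda>r m s n. act (F r m s n) (Riem m r s n)))" by simp
  also have "\<dots> \<in> represented"
    unfolding S_def by (intro represented_smult represented_sum act_Riem_represented) auto
  finally show ?thesis unfolding T .
qed

lemma hh_closed_represented:
  assumes k: "\<And>a b. k a b \<in> S4" and 0: "dQ (\<Sum>a<4. \<Sum>b<4. act (k a b) (hh a b)) = 0"
  shows "(\<Sum>a<4. \<Sum>b<4. act (k a b) (hh a b)) \<in> represented"
proof -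
  let ?v = "\<Sum>a<4. \<Sum>b<4. act (k a b) (hh a b)"
  define \<kappa> where "\<kappa> = (\<Sum>c<4. sym_const (eta c c) * k c c)"
  \<comment> \<open>The symbol of the same element with respect to \<open>hhat\<close>: the
    symmetrisation of \<open>k\<close>, minus the trace term caused by expressing \<open>hh\<close>
    through \<open>hhat\<close>.\<close>
  define f where "f a b = sym_const (1/2) * (k a b + k b a) - sym_const (eta a b / 2) * \<kappa>" for a b
  have f_sym: "f a b = f b a" for a b by (simp add: f_def add.commute eta_sym)
  have fS4: "f a b \<in> S4" for a b unfolding f_def \<kappa>_def using k by (intro S4_intros)
  let ?t = "\<Sum>c<4. smult (eta c c) (hhat c c)"
  have diag: "(\<Sum>a<4. \<Sum>b<4. smult (eta a b) (G a b)) = (\<Sum>a<4. smult (eta a a) (G a a))" for G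
    by (rule sum_eta_diag)
  have v: "?v = (\<Sum>a<4. \<Sum>b<4. act (f a b) (hhat a b))"
  proof -
    have "(\<Sum>a<4. \<Sum>b<4. act (f a b) (hhat a b)) =
       smult (1/2) (\<Sum>a<4. \<Sum>b<4. act (k a b) (hhat a b)) + smult (1/2) (\<Sum>a<4. \<Sum>b<4. act (k b a) (hhat a b))
       - smult (1/2) (\<Sum>a<4. \<Sum>b<4. smult (eta a b) (act \<kappa> (hhat a b)))"
      by (simp add: f_def act_diff_left act_sym_const act_add_left PV.scale_right_distrib sum.distrib sum_subtractf PV.scale_sum_right)
    also have "(\<Sum>a<4. \<Sum>b<4. act (k b a) (hhat a b)) = (\<Sum>a<4. \<Sum>b<4. act (k a b) (hhat a b))"
      by (subst sum.swap) (simp add: hhat_sym)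
    also have "(\<Sum>a<4. \<Sum>b<4. smult (eta a b) (act \<kappa> (hhat a b))) = act \<kappa> ?t"
      by (simp add: diag act_sum_right act_smult_right)
    also have "act \<kappa> ?t = (\<Sum>a<4. \<Sum>b<4. smult (eta a b) (act (k a b) ?t))"
      by (simp add: diag \<kappa>_def act_sum_left act_sym_const)
    finally have e: "(\<Sum>a<4. \<Sum>b<4. act (f a b) (hhat a b)) =
       smult (1/2) (\<Sum>a<4. \<Sum>b<4. act (k a b) (hhat a b)) + smult (1/2) (\<Sum>a<4. \<Sum>b<4. act (k a b) (hhat a b))
       - smult (1/2) (\<Sum>a<4. \<Sum>b<4. smult (eta a b) (act (k a b) ?t))" .
    have "?v = (\<Sum>a<4. \<Sum>b<4. act (k a b) (hhat a b)) - smult (1/2) (\<Sum>a<4. \<Sum>b<4. smult (eta a b) (act (k a b) ?t))"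
    proof -
      have "act (k a b) (hh a b) = act (k a b) (hhat a b) - smult (1/2) (smult (eta a b) (act (k a b) ?t))" for a b
        by (subst hh_hhat) (simp only: act_diff_right act_smult_right PV.scale_scale, simp)
      then show ?thesis by (simp only: sum_subtractf PV.scale_sum_right)
    qed
    then show ?thesis unfolding e by (simp flip: PV.scale_left_distrib)
  qed
  define t where "t b = (\<Sum>a<4. xi a * f a b)" for b
  have tS4: "t b \<in> S4" for b unfolding t_def using fS4 by (intro S4_intros) auto
  have "dQ ?v = (\<Sum>a<4. \<Sum>b<4. act (f a b) (smult (- \<i> / 2) (dmu a (jet0 (U b)) + dmu b (jet0 (U a)))))"
    unfolding v dQ_sum by (intro sum.cong refl) (simp only: dQ_act hhat_Lin dQ_hhat lessThan_iff)
  also have "\<dots> = smult (- \<i> / 2) ((\<Sum>a<4. \<Sum>b<4. act (f a b) (dmu a (jet0 (U b)))) + (\<Sum>a<4. \<Sum>b<4. act (f a b) (dmu b (jet0 (U a)))))"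
    unfolding act_smult_right act_add_right PV.scale_sum_right[symmetric] sum.distrib ..
  also have "(\<Sum>a<4. \<Sum>b<4. act (f a b) (dmu b (jet0 (U a)))) = (\<Sum>a<4. \<Sum>b<4. act (f a b) (dmu a (jet0 (U b))))"
    by (subst sum.swap) (simp add: f_sym)
  also have "(\<Sum>a<4. \<Sum>b<4. act (f a b) (dmu a (jet0 (U b)))) = (\<Sum>b<4. act (t b) (jet0 (U b)))"
    by (subst sum.swap) (simp add: t_def act_sum_left act_xi U_Lin)
  finally have "smult (- \<i> / 2) ((\<Sum>b<4. act (t b) (jet0 (U b))) + (\<Sum>b<4. act (t b) (jet0 (U b)))) = 0" using 0 by simp
  then have "(\<Sum>b<4. act (t b) (jet0 (U b))) + (\<Sum>b<4. act (t b) (jet0 (U b))) = 0"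
    by (simp only: PV.scale_eq_0_iff) auto
  then have "smult (1/2) ((\<Sum>b<4. act (t b) (jet0 (U b))) + (\<Sum>b<4. act (t b) (jet0 (U b)))) = 0" by (simp only: PV.scale_zero_right)
  then have z: "(\<Sum>b<4. act (t b) (jet0 (U b))) = 0"
    by (simp only: PV.scale_right_distrib flip: PV.scale_left_distrib) simp
  have "\<exists>g. b < 4 \<longrightarrow> t b = xi2 * g" for b using independent_U[OF tS4 z, of b] by metis
  then obtain g where g: "\<And>b. b < 4 \<Longrightarrow> t b = xi2 * g b" by metis
  define D where "D = (\<Sum>c<4. xi c * g c)"
  \<comment> \<open>This is the \<open>hhat\<close> symbol of
    \<open>smult 2 (\<Sum>a<4. act (g a) (hdiv a))\<close>, hence of an exact element; the term with
    \<open>D\<close> comes from the trace in \<open>div_hhat\<close>. Its divergence is exactly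
    \<open>xi2 * g b\<close>.\<close>
  define e where "e a b = sym_const (eta b b) * (xi b * g a) + sym_const (eta a a) * (xi a * g b) - sym_const (eta a b) * D" for a b
  have e_sym: "e a b = e b a" for a b by (simp add: e_def eta_sym add.commute)
  have diag_const: "(\<Sum>a<4. sym_const (eta a b) * G a) = sym_const (eta b b) * G b" if "b < 4" for b G
  proof -
    have "(\<Sum>a<4. sym_const (eta a b) * G a) = (\<Sum>a<4. if a = b then sym_const (eta b b) * G b else 0)"
      by (intro sum.cong refl) (simp add: eta_def)
    then show ?thesis using that by simp
  qed
  have div_e: "(\<Sum>a<4. xi a * e a b) = xi2 * g b" if "b < 4" for b
  proof -
    have "(\<Sum>a<4. xi a * e a b) = sym_const (eta b b) * (xi b * D) + (\<Sum>a<4. sym_const (eta a a) * (xi a * xi a)) * g b - (\<Sum>a<4. sym_const (eta a b) * (xi a * D))"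
      by (simp add: e_def D_def algebra_simps sum.distrib sum_subtractf sum_distrib_left sum_distrib_right)
    then show ?thesis using diag_const[OF that, of "\<lambda>a. xi a * D"] by (simp add: xi2_def)
  qed
  have f'_represented: "(\<Sum>a<4. \<Sum>b<4. act (f a b - e a b) (hhat a b)) \<in> represented"
  proof (rule divergence_free_represented)
    show "f a b - e a b = f b a - e b a" for a b by (simp add: f_sym[of a] e_sym[of a])
    show "(\<Sum>a<4. xi a * (f a b - e a b)) = 0" if "b < 4" for b
      using g[OF that] div_e[OF that] by (simp add: right_diff_distrib sum_subtractf t_def)
  qed
  have eB: "(\<Sum>a<4. \<Sum>b<4. act (e a b) (hhat a b)) \<in> lin_exact"
  proof -
    let ?E = "\<Sum>a<4. \<Sum>b<4. smult (eta b b) (act (g a) (dmu b (hhat b a)))"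
    have "(\<Sum>a<4. \<Sum>b<4. act (e a b) (hhat a b)) =
      (\<Sum>a<4. \<Sum>b<4. smult (eta b b) (act (g a) (dmu b (hhat a b))))
      + (\<Sum>a<4. \<Sum>b<4. smult (eta a a) (act (g b) (dmu a (hhat a b))))
      - (\<Sum>a<4. \<Sum>b<4. smult (eta a b) (act D (hhat a b)))"
      by (simp add: e_def act_diff_left act_add_left act_sym_const act_xi sum.distrib sum_subtractf)
    also have "(\<Sum>a<4. \<Sum>b<4. smult (eta b b) (act (g a) (dmu b (hhat a b)))) = ?E"
      by (intro sum.cong refl) (simp add: hhat_sym)
    also have "(\<Sum>a<4. \<Sum>b<4. smult (eta a a) (act (g b) (dmu a (hhat a b)))) = ?E" by (rule sum.swap)
    also have "?E = (\<Sum>a<4. act (g a) (\<Sum>b<4. smult (eta b b) (dmu b (hhat b a))))"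
      by (simp add: act_sum_right act_smult_right)
    also have "\<dots> = (\<Sum>a<4. act (g a) (hdiv a) - smult (1/2) (act (g a) (dmu a htr)))"
      by (intro sum.cong refl) (simp only: div_hhat lessThan_iff act_diff_right act_smult_right)
    also have "\<dots> = (\<Sum>a<4. act (g a) (hdiv a)) - smult (1/2) (\<Sum>a<4. act (g a) (dmu a htr))"
      by (simp only: sum_subtractf PV.scale_sum_right)
    also have "(\<Sum>a<4. \<Sum>b<4. smult (eta a b) (act D (hhat a b))) = act D ?t"
      by (simp add: diag act_sum_right act_smult_right)
    also have "\<dots> = - (\<Sum>a<4. act (g a) (dmu a htr))"
      unfolding trace_hhat by (simp add: act_minus_right D_def act_sum_left act_xi)
    finally have "(\<Sum>a<4. \<Sum>b<4. act (e a b) (hhat a b)) = smult 2 (\<Sum>a<4. act (g a) (hdiv a))"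
    proof -
      have "(x - smult (1/2) y) + (x - smult (1/2) y) - (- y) = smult 2 x" for x y
        by (rule poly_mapping_eqI) (simp only: lookup_add lookup_minus lookup_uminus lookup_smult, simp)
      then show "(\<Sum>a<4. \<Sum>b<4. act (e a b) (hhat a b)) =
        (\<Sum>a<4. act (g a) (hdiv a)) - smult (1/2) (\<Sum>a<4. act (g a) (dmu a htr)) +
        ((\<Sum>a<4. act (g a) (hdiv a)) - smult (1/2) (\<Sum>a<4. act (g a) (dmu a htr))) -
        - (\<Sum>a<4. act (g a) (dmu a htr)) \<Longrightarrow> ?thesis" by simp
    qed
    also have "\<dots> \<in> lin_exact" by (intro lin_exact_intros act_lin_exact hdiv_lin_exact) auto
    finally show ?thesis .
  qed
  have veq: "?v = (\<Sum>a<4. \<Sum>b<4. act (f a b - e a b) (hhat a b)) + (\<Sum>a<4. \<Sum>b<4. act (e a b) (hhat a b))"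
    unfolding v by (simp add: act_diff_left sum_subtractf)
  show ?thesis unfolding veq by (rule represented_add[OF f'_represented represented_lin_exact[OF eB]])
qed

theorem linear_cohomology:
  assumes "v \<in> Lin" "dQ v = 0"
  shows "v \<in> represented"
proof -
  obtain k t s where red: "\<And>a b. k a b \<in> reduced" "\<And>a. t a \<in> reduced" "\<And>a. s a \<in> reduced"
    and v: "v = (\<Sum>a<4. \<Sum>b<4. act (k a b) (hh a b)) + (\<Sum>a<4. act (t a) (jet0 (U a))) + (\<Sum>a<4. act (s a) (jet0 (Ut a)))"
    using symbol_representation[OF assms(1)] by blast
  let ?h = "\<Sum>a<4. \<Sum>b<4. act (k a b) (hh a b)" and ?u = "\<Sum>a<4. act (t a) (jet0 (U a))"
    and ?w = "\<Sum>a<4. act (s a) (jet0 (Ut a))"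
  have hL: "?h \<in> LinF Hs" by (intro LinF_intros act_LinF hh_LinF) auto
  have wL: "?w \<in> LinF (Us \<union> Uts)"
    using LinF_mono[of Uts "Us \<union> Uts"] by (intro LinF_intros act_LinF) (use Ut_LinF in blast)
  have "dQ ?u = 0" by (simp add: dQ_sum dQ_act U_Lin dQ_U)
  then have sum0: "dQ ?h + dQ ?w = 0" using assms(2) unfolding v dQ_add by simp
  \<comment> \<open>Parity separates the contributions: \<open>dQ ?h\<close> is odd and
    \<open>dQ ?w\<close> is even, so each of them vanishes.\<close>
  have ah: "alpha (dQ ?h) = - dQ ?h"
    using dQ_LinF_Hs[OF hL] by (rule LinF_odd) (auto simp: Us_def Uts_def)
  have aw: "alpha (dQ ?w) = dQ ?w"
    using dQ_LinF_Us_Uts[OF wL] by (rule LinF_even) (auto simp: Hs_def)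
  have "- dQ ?h + dQ ?w = 0" using arg_cong[OF sum0, of alpha] by (simp only: alpha_add ah aw alpha_0)
  then have eq: "dQ ?w = dQ ?h" by (simp only: add.commute[of "- dQ ?h"] diff_conv_add_uminus[symmetric] right_minus_eq)
  have "smult (1/2) (dQ ?h + dQ ?h) = 0" using sum0 unfolding eq by (simp only: PV.scale_zero_right)
  then have dh: "dQ ?h = 0" by (simp only: PV.scale_right_distrib flip: PV.scale_left_distrib) simp
  then have dw: "dQ ?w = 0" using eq by (simp only:)
  have "s a = 0" if "a < 4" for a by (rule antighost_injective[OF red(3) dw that])
  then have "?w = 0" by simp
  moreover have "?h \<in> represented" using red(1) by (intro hh_closed_represented dh) (auto simp: reduced_def)
  moreover have "?u \<in> represented" by (intro represented_sum act_U_represented) auto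
  ultimately show ?thesis unfolding v by (simp add: represented_add)
qed

lemma span_subalg: "x \<in> PV.span G \<Longrightarrow> x \<in> subalg G"
proof (induction rule: PV.span_induct_alt)
  case base then show ?case using subalg.const[of 0 G] by (simp add: const_def)
next
  case (step c x y) then show ?case unfolding smult_def by (intro subalg.add[OF subalg.mul[OF subalg.const subalg.gen]])
qed

theorem mainTheorem4:
  assumes "p \<in> Pset" and "dQ p = 0"
  shows "\<exists>b\<in>Pset. p - dQ b \<in> subalg R0_u_gens"
proof (rule cohomologous_subalg_if_linear[OF _ assms])
  fix v assume v: "v \<in> Lin" "dQ v = 0"
  then obtain w b where w: "w \<in> PV.span R0_u_gens" "b \<in> Lin" "v = w + dQ b"
    using linear_cohomology[OF v] by (auto simp: represented_def lin_exact_def)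
  \<comment> \<open>Membership of \<open>w\<close> in \<open>Pset\<close> is obtained from this
    difference of linear elements, not from validity of the individual generators in
    \<open>R0_u_gens\<close>.\<close>
  then have "w = v - dQ b" by simp
  then have "w \<in> Lin" using v w(2) by (auto intro: LinF_intros dQ_Lin)
  then show "\<exists>w\<in>subalg R0_u_gens \<inter> Pset. \<exists>b\<in>Lin. v = w + dQ b"
    using w span_subalg LinF_Pset by blast
qed

end
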